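(* Consider a weighted projective space $\mathbb{P}(q_0,q_1,\ldots,q_n)$ with $q_0 = 1$ and $\operatorname{lcm}(q_i,q_j,q_k) = d$ for all pairwise distinct $i,j,k$, where $d := \operatorname{lcm}(q_1,\ldots,q_n)$. Let $a_i := d/q_i$ and $b_{ij} := \operatorname{lcm}(q_i,q_j)/q_i$ for all $i,j \in \{0,1,\ldots,n\}$. Then the following are injective morphisms: \[\varphi_1 \colon \mathbb{P}(q_0,\ldots,q_n) \to \mathbb{P}^{n+1},\quad [x_0:\ldots:x_n] \mapsto [x_0^d : x_0^{d-q_1}x_1 : x_1^{a_1} + x_0^{d-q_2}x_2 : x_2^{a_2}+x_0^{d-q_3}x_3 : \ldots : x_{n-1}^{a_{n-1}} + x_0^{d-q_n}x_n : x_n^{a_n}],\] and, for each $k \geq 2$, \[\varphi_k \colon \mathbb{P}(q_0,\ldots,q_n) \to \mathbb{P}^{2n},\quad [x_0:\ldots:x_n] \mapsto \Big[\sum_{\substack{i+j=\ell\\ i \leq j}} x_i^{k a_i - b_{ij}} x_j^{b_{ji}} \;\Big|\; \ell = 0,1,\ldots,2n\Big].\] In particular, \[\operatorname{injdim}(\mathbb{P}(q_0,\ldots,q_n),\mathcal{O}(kd)) = \begin{cases} \infty & \text{if } k \leq 0,\\ n & \text{if } k=1 \text{ and } q_1 = \ldots = q_n,\\ n+1 & \text{if } k = 1 \text{ and } q_1,\ldots,q_n \text{ not all equal},\\ 2n & \text{if } k \geq 2.\end{cases}\]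
   Context: Over $\mathbb{C}$. $\mathbb{P}(q_0,\ldots,q_n) = \operatorname{Proj}\mathbb{C}[x_0,\ldots,x_n]$ with $\deg x_i = q_i$, and $\mathcal{O}(m)$ is its twisting sheaf of degree $m$ (global sections: weighted homogeneous polynomials of degree $m$). For a line bundle $\mathscr{L}$ on a projective variety $X$ and a nonzero subspace $V \subseteq H^0(X,\mathscr{L})$, $\varphi_V \colon X \dashrightarrow \mathbb{P}(V^* )$ is the rational map given by the sections in $V$; $\operatorname{injdim}(X,\mathscr{L}) := \inf\{\dim V - 1 : \varphi_V \text{ is an injective morphism}\}$, with $\inf\emptyset=\infty$. *)

theory Defs
  imports Complex_Main "HOL-Library.Extended_Nat"
begin

text \<open>Points of C^{n+1}: vectors x :: nat => complex, coordinates x 0, ..., x n.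
  Points of the weighted projective space P(q_0,...,q_n): nonzero such vectors modulo
  lambda . x = (lambda^(q_i) x_i).\<close>

definition wps_pt :: "nat \<Rightarrow> (nat \<Rightarrow> complex) \<Rightarrow> bool" where
  "wps_pt n x \<longleftrightarrow> (\<forall>i>n. x i = 0) \<and> (\<exists>i\<le>n. x i \<noteq> 0)"

definition wps_equiv :: "(nat \<Rightarrow> nat) \<Rightarrow> nat \<Rightarrow> (nat \<Rightarrow> complex) \<Rightarrow> (nat \<Rightarrow> complex) \<Rightarrow> bool" where
  "wps_equiv q n x y \<longleftrightarrow> (\<exists>l::complex. l \<noteq> 0 \<and> (\<forall>i\<le>n. y i = l ^ q i * x i))"

definition mono :: "nat \<Rightarrow> (nat \<Rightarrow> nat) \<Rightarrow> (nat \<Rightarrow> complex) \<Rightarrow> complex" where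
  "mono n \<alpha> x = (\<Prod>i\<le>n. x i ^ \<alpha> i)"

definition wdeg :: "(nat \<Rightarrow> nat) \<Rightarrow> nat \<Rightarrow> (nat \<Rightarrow> nat) \<Rightarrow> nat" where
  "wdeg q n \<alpha> = (\<Sum>i\<le>n. q i * \<alpha> i)"

definition exps :: "(nat \<Rightarrow> nat) \<Rightarrow> nat \<Rightarrow> int \<Rightarrow> (nat \<Rightarrow> nat) set" where
  "exps q n m = {\<alpha>. (\<forall>i>n. \<alpha> i = 0) \<and> int (wdeg q n \<alpha>) = m}"

text \<open>H^0(P(q_0..q_n), O(m)): weighted homogeneous polynomials of degree m, viewed as
  polynomial functions on C^{n+1}.\<close>

definition H0 :: "(nat \<Rightarrow> nat) \<Rightarrow> nat \<Rightarrow> int \<Rightarrow> ((nat \<Rightarrow> complex) \<Rightarrow> complex) set" where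
  "H0 q n m = {f. \<exists>c :: (nat \<Rightarrow> nat) \<Rightarrow> complex.
                    f = (\<lambda>x. \<Sum>\<alpha>\<in>exps q n m. c \<alpha> * mono n \<alpha> x)}"

definition inj_morph :: "(nat \<Rightarrow> nat) \<Rightarrow> nat \<Rightarrow> nat \<Rightarrow> (nat \<Rightarrow> (nat \<Rightarrow> complex) \<Rightarrow> complex) \<Rightarrow> bool" where
  "inj_morph q n N F \<longleftrightarrow>
     (\<forall>x. wps_pt n x \<longrightarrow> (\<exists>i\<le>N. F i x \<noteq> 0)) \<and>
     (\<forall>x y. wps_pt n x \<longrightarrow> wps_pt n y \<longrightarrow> (\<exists>c. \<forall>i\<le>N. F i x = c * F i y) \<longrightarrow> wps_equiv q n x y)"

definition lin_indep_fams :: "nat \<Rightarrow> (nat \<Rightarrow> (nat \<Rightarrow> complex) \<Rightarrow> complex) \<Rightarrow> bool" where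
  "lin_indep_fams N F \<longleftrightarrow>
     (\<forall>c :: nat \<Rightarrow> complex. (\<forall>x. (\<Sum>i\<le>N. c i * F i x) = 0) \<longrightarrow> (\<forall>i\<le>N. c i = 0))"

text \<open>injdim(P(q), O(m)) = inf { dim V - 1 : phi_V injective morphism }, where V is described
  by a basis F 0, ..., F N (so dim V - 1 = N); inf of the empty set is infinity.\<close>

definition injdim :: "(nat \<Rightarrow> nat) \<Rightarrow> nat \<Rightarrow> int \<Rightarrow> enat" where
  "injdim q n m = (INF N \<in> {N. \<exists>F. (\<forall>i\<le>N. F i \<in> H0 q n m) \<and> lin_indep_fams N F
                                      \<and> inj_morph q n N F}. enat N)"

end

theory Submission
  imports Defs "HOL-Analysis.Analysis" "HOL-Number_Theory.Cong" "Jordan_Normal_Form.Determinant"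
begin

text \<open>
  Lower bounds. If \<open>F\<^sub>0, \<dots>, F\<^sub>N\<close> are sections of degree \<open>D\<close> defining an injective morphism, the
  common zeros of the polynomials \<open>F\<^sub>j(x) - F\<^sub>j(y)\<close> form the union of the graphs of the actions of
  the \<open>D\<close>-th roots of unity. For \<open>k \<ge> 2\<close> the graphs belonging to the \<open>d\<close>-th roots of unity meet
  the other ones only at the origin; for \<open>k = 1\<close> and unequal weights the same happens on the slice
  \<open>x\<^sub>1 = \<dots> = x\<^sub>n\<close>, with the roots of unity that fix \<open>x\<^sub>1, \<dots>, x\<^sub>n\<close> in place of the \<open>d\<close>-th ones.
  But at most \<open>m - 2\<close> polynomials on \<open>m\<close>-dimensional space cannot cut out two cones \<open>A\<close>, \<open>B\<close> (each
  containing a line) that meet only at the origin; this is a case of Grothendieck's connectedness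
  theorem.

  It is proved here analytically. One constructs maps \<open>T\<close> and \<open>T'\<close> of \<open>m\<close>-space into itself, of class
  C2, that differ by a compactly supported map, so that the determinants of their matrices of
  antiholomorphic derivatives have the same integral. That of \<open>T'\<close> vanishes identically: near \<open>A\<close>
  and near \<open>B\<close> a component of \<open>T'\<close> is zero, and elsewhere the nonholomorphic part of \<open>T'\<close> is built
  from at most \<open>m - 1\<close> functions. That of \<open>T\<close> vanishes outside the unit ball, because there
  \<open>\<Sum>z\<^sub>i T\<^sub>i = 1\<close>, and is positive inside.

  Upper bounds. On the chart \<open>x\<^sub>0 = 1\<close> the coordinates are recovered one after the other. On
  \<open>x\<^sub>0 = 0\<close> one recovers the powers \<open>x\<^sub>i ^ a\<^sub>i\<close> up to a common factor; these determine the point by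
  the Chinese remainder theorem, since the \<open>a\<^sub>i\<close> with \<open>i \<ge> 1\<close> are pairwise coprime.
\<close>

section \<open>Functions of class C2 and the Cauchy-Riemann operators\<close>

text \<open>The separation argument is an explicit Mayer-Vietoris argument for the complements of
  \<open>A\<close> and \<open>B\<close>, whose union is the complement of the origin. That union
  carries a nonzero class of degree \<open>m - 1\<close>, the Bochner-Martinelli class. It dies off
  \<open>A\<close>: since \<open>A\<close> contains a coordinate axis, one of the other
  \<open>m - 1\<close> coordinates is nonzero there; likewise off \<open>B\<close>. So it would come
  from degree \<open>m - 2\<close> on the complement of both cones, which is covered by at most
  \<open>m - 2\<close> sets where a single polynomial is nonzero and hence has no holomorphic
  cohomology in that degree. In \<open>T'\<close> the two vanishings become degenerate determinants:
  a zero row near each cone, and elsewhere at most \<open>m - 2\<close> functions that combine the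
  polynomials to 1, plus one function gluing the regimes of \<open>A\<close> and \<open>B\<close>,
  which makes \<open>m - 1\<close> differentials in \<open>m\<close> rows. This is why the lower
  bounds need cones that contain lines, and why coordinates are always chosen so that these lines
  are axes 0 and 1.\<close>

type_synonym pt = "nat \<Rightarrow> complex"

text \<open>Points of affine space are functions on all of \<open>nat\<close>, so that the dimension can be a variable;
  continuity refers to the product topology.\<close>

definition pder :: "(pt \<Rightarrow> complex) \<Rightarrow> nat \<Rightarrow> complex \<Rightarrow> pt \<Rightarrow> complex" where
  "pder f j v z = vector_derivative (\<lambda>t. f (z(j := z j + of_real t * v))) (at 0)"

definition C1 :: "(pt \<Rightarrow> complex) \<Rightarrow> bool" where
  "C1 f \<longleftrightarrow> continuous_on UNIV f \<and>
     (\<forall>j v z. ((\<lambda>t. f (z(j := z j + of_real t * v))) has_vector_derivative pder f j v z) (at 0)) \<and>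
     (\<forall>j v. continuous_on UNIV (pder f j v))"

text \<open>Symmetry of the mixed derivatives is a clause here instead of a consequence of Schwarz's
  theorem: the functions in use arise from coordinates by operations that visibly preserve
  it.\<close>

definition C2 :: "(pt \<Rightarrow> complex) \<Rightarrow> bool" where
  "C2 f \<longleftrightarrow> C1 f \<and> (\<forall>j v. C1 (pder f j v)) \<and>
     (\<forall>j v k w. pder (pder f j v) k w = pder (pder f k w) j v)"

lemma C1I:
  assumes "continuous_on UNIV f"
    and "\<And>j v z. ((\<lambda>t. f (z(j := z j + of_real t * v))) has_vector_derivative f' j v z) (at 0)"
    and "\<And>j v. continuous_on UNIV (f' j v)"
  shows "C1 f" and "pder f = f'"
proof -
  show *: "pder f = f'"
    unfolding pder_def using assms(2) by (intro ext vector_derivative_at)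
  show "C1 f" unfolding C1_def * using assms by blast
qed

lemma C1_cont: "C1 f \<Longrightarrow> continuous_on UNIV f"
  and C1_cont_pder: "C1 f \<Longrightarrow> continuous_on UNIV (pder f j v)"
  and C1_deriv: "C1 f \<Longrightarrow> ((\<lambda>t. f (z(j := z j + of_real t * v))) has_vector_derivative pder f j v z) (at 0)"
  unfolding C1_def by blast+

lemma C2_C1: "C2 f \<Longrightarrow> C1 f"
  and C2_pder: "C2 f \<Longrightarrow> C1 (pder f j v)"
  and C2_sym: "C2 f \<Longrightarrow> pder (pder f j v) k w = pder (pder f k w) j v"
  unfolding C2_def by blast+

lemma C2I:
  assumes "C1 f" "pder f = f'" "\<And>j v. C1 (f' j v)"
    and "\<And>j v k w z. pder (f' j v) k w z = pder (f' k w) j v z"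
  shows "C2 f"
  unfolding C2_def assms(2) by (intro conjI allI ext assms)

lemma C2_sym': "C2 f \<Longrightarrow> pder (pder f j v) k w z = pder (pder f k w) j v z"
  by (simp add: C2_sym)

lemma C1_const: "C1 (\<lambda>z. c)" "pder (\<lambda>z. c) = (\<lambda>j v z. 0)"
  by (rule C1I[where f'="\<lambda>j v z. 0"]; simp)+

lemma C2_const: "C2 (\<lambda>z. c)"
  unfolding C2_def C1_const(2) by (auto simp: C1_const)

lemma C1_coord: "C1 (\<lambda>z. z i)" "pder (\<lambda>z. z i) = (\<lambda>j v z. if j = i then v else 0)"
proof -
  have *: "((\<lambda>t. (z(j := z j + of_real t * v)) i) has_vector_derivative (if j = i then v else 0)) (at 0)"
    for j v and z :: pt
    by (cases "j = i") (auto intro!: derivative_eq_intros simp: has_vector_derivative_def scaleR_conv_of_real)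
  show "C1 (\<lambda>z. z i)" "pder (\<lambda>z. z i) = (\<lambda>j v z. if j = i then v else 0)"
    by (rule C1I[OF _ *]; simp add: continuous_on_product_coordinates split: if_splits)+
qed

lemma C2_coord: "C2 (\<lambda>z. z i)"
  unfolding C2_def C1_coord(2) by (auto simp: C1_coord C1_const)

lemma C1_add:
  assumes "C1 f" "C1 g"
  shows "C1 (\<lambda>z. f z + g z)" "pder (\<lambda>z. f z + g z) = (\<lambda>j v z. pder f j v z + pder g j v z)"
proof -
  note * = has_vector_derivative_add[OF C1_deriv[OF assms(1)] C1_deriv[OF assms(2)]]
  note c = C1_cont[OF assms(1)] C1_cont[OF assms(2)] C1_cont_pder[OF assms(1)] C1_cont_pder[OF assms(2)]
  show "C1 (\<lambda>z. f z + g z)" by (rule C1I(1)[OF _ *]) (intro continuous_on_add c)+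
  show "pder (\<lambda>z. f z + g z) = (\<lambda>j v z. pder f j v z + pder g j v z)"
    by (rule C1I(2)[OF _ *]) (intro continuous_on_add c)+
qed

lemma C1_mult:
  assumes "C1 f" "C1 g"
  shows "C1 (\<lambda>z. f z * g z)"
    "pder (\<lambda>z. f z * g z) = (\<lambda>j v z. f z * pder g j v z + pder f j v z * g z)"
proof -
  have *: "((\<lambda>t. f (z(j := z j + of_real t * v)) * g (z(j := z j + of_real t * v)))
     has_vector_derivative f z * pder g j v z + pder f j v z * g z) (at 0)" for j v z
    using has_vector_derivative_mult[OF C1_deriv[OF assms(1), of z j v] C1_deriv[OF assms(2), of z j v]] by simp
  show "C1 (\<lambda>z. f z * g z)"
    "pder (\<lambda>z. f z * g z) = (\<lambda>j v z. f z * pder g j v z + pder f j v z * g z)"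
    by (rule C1I[OF _ *]; intro continuous_on_add continuous_on_mult
      C1_cont[OF assms(1)] C1_cont[OF assms(2)] C1_cont_pder[OF assms(1)] C1_cont_pder[OF assms(2)])+
qed

lemma C2_add:
  assumes "C2 f" "C2 g" shows "C2 (\<lambda>z. f z + g z)"
proof (rule C2I[OF C1_add[OF C2_C1[OF assms(1)] C2_C1[OF assms(2)]]])
  note C = C2_pder[OF assms(1)] C2_pder[OF assms(2)]
  show "C1 (\<lambda>z. pder f j v z + pder g j v z)" for j v by (intro C1_add C)
  show "pder (\<lambda>z. pder f j v z + pder g j v z) k w z = pder (\<lambda>z. pder f k w z + pder g k w z) j v z" for j v k w z
    by (simp only: C1_add(2)[OF C] C2_sym'[OF assms(1), of j] C2_sym'[OF assms(2), of j])
qed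

lemma C2_mult:
  assumes "C2 f" "C2 g" shows "C2 (\<lambda>z. f z * g z)"
proof (rule C2I[OF C1_mult[OF C2_C1[OF assms(1)] C2_C1[OF assms(2)]]])
  note C = C2_C1[OF assms(1)] C2_C1[OF assms(2)] C2_pder[OF assms(1)] C2_pder[OF assms(2)]
  show "C1 (\<lambda>z. f z * pder g j v z + pder f j v z * g z)" for j v by (intro C1_add C1_mult C)
  have "pder (\<lambda>z. f z * pder g j v z + pder f j v z * g z) k w z =
    f z * pder (pder g j v) k w z + pder f k w z * pder g j v z +
    (pder f j v z * pder g k w z + pder (pder f j v) k w z * g z)" for j v k w z
    by (simp only: C1_add(2)[OF C1_mult(1)[OF C(1,4)] C1_mult(1)[OF C(3,2)]] C1_mult(2)[OF C(1,4)] C1_mult(2)[OF C(3,2)])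
  then show "pder (\<lambda>z. f z * pder g j v z + pder f j v z * g z) k w z =
    pder (\<lambda>z. f z * pder g k w z + pder f k w z * g z) j v z" for j v k w z
    by (simp only: C2_sym'[OF assms(1), of j] C2_sym'[OF assms(2), of j] ac_simps)
qed

lemma C1_bounded_linear:
  assumes "bounded_linear L" "C1 f"
  shows "C1 (\<lambda>z. L (f z))" "pder (\<lambda>z. L (f z)) = (\<lambda>j v z. L (pder f j v z))"
proof -
  have *: "((\<lambda>t. L (f (z(j := z j + of_real t * v)))) has_vector_derivative L (pder f j v z)) (at 0)" for j v z
    by (rule bounded_linear.has_vector_derivative[OF assms(1) C1_deriv[OF assms(2)]])
  show "C1 (\<lambda>z. L (f z))" "pder (\<lambda>z. L (f z)) = (\<lambda>j v z. L (pder f j v z))"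
    by (rule C1I[OF _ *]; intro bounded_linear.continuous_on[OF assms(1)] C1_cont[OF assms(2)] C1_cont_pder[OF assms(2)])+
qed

lemma C2_bounded_linear:
  assumes "bounded_linear L" "C2 f" shows "C2 (\<lambda>z. L (f z))"
proof (rule C2I[OF C1_bounded_linear[OF assms(1) C2_C1[OF assms(2)]]])
  note C = C1_bounded_linear[OF assms(1) C2_pder[OF assms(2)]]
  show "C1 (\<lambda>z. L (pder f j v z))" for j v by (rule C)
  show "pder (\<lambda>z. L (pder f j v z)) k w z = pder (\<lambda>z. L (pder f k w z)) j v z" for j v k w z
    by (simp only: C(2) C2_sym'[OF assms(2), of j])
qed

lemmas C1_cnj = C1_bounded_linear[OF bounded_linear_cnj]
lemmas C2_cnj = C2_bounded_linear[OF bounded_linear_cnj]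

lemma bounded_linear_Re_complex: "bounded_linear (\<lambda>w. complex_of_real (Re w))"
  using bounded_linear_compose[OF bounded_linear_of_real bounded_linear_Re] .

lemma C1_inverse:
  assumes "C1 f" "\<And>z. f z \<noteq> 0"
  shows "C1 (\<lambda>z. inverse (f z))"
    "pder (\<lambda>z. inverse (f z)) = (\<lambda>j v z. - (inverse (f z) * pder f j v z * inverse (f z)))"
proof -
  have *: "((\<lambda>t. inverse (f (z(j := z j + of_real t * v)))) has_vector_derivative
      - (inverse (f z) * pder f j v z * inverse (f z))) (at 0)" for j v z
    using C1_deriv[OF assms(1), of z j v] assms(2)[of z]
    unfolding has_vector_derivative_def by (auto intro!: derivative_eq_intros)
  show "C1 (\<lambda>z. inverse (f z))"
    "pder (\<lambda>z. inverse (f z)) = (\<lambda>j v z. - (inverse (f z) * pder f j v z * inverse (f z)))"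
    by (rule C1I[OF _ *]; intro continuous_on_minus continuous_on_mult continuous_on_inverse
      C1_cont[OF assms(1)] C1_cont_pder[OF assms(1)] assms(2) ballI)+
qed

lemma C1_uminus:
  assumes "C1 f"
  shows "C1 (\<lambda>z. - f z)" "pder (\<lambda>z. - f z) = (\<lambda>j v z. - pder f j v z)"
  using C1_bounded_linear[OF bounded_linear_minus[OF bounded_linear_ident] assms] by auto

lemma C2_uminus: "C2 f \<Longrightarrow> C2 (\<lambda>z. - f z)"
  by (rule C2_bounded_linear[OF bounded_linear_minus[OF bounded_linear_ident]])

lemma C1_diff:
  assumes "C1 f" "C1 g"
  shows "C1 (\<lambda>z. f z - g z)" "pder (\<lambda>z. f z - g z) = (\<lambda>j v z. pder f j v z - pder g j v z)"
  using C1_add[OF assms(1) C1_uminus(1)[OF assms(2)]] by (auto simp: C1_uminus assms)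

lemma C2_diff: "C2 f \<Longrightarrow> C2 g \<Longrightarrow> C2 (\<lambda>z. f z - g z)"
  using C2_add[OF _ C2_uminus, of f g] by simp

lemma C2_inverse:
  assumes "C2 f" "\<And>z. f z \<noteq> 0"
  shows "C2 (\<lambda>z. inverse (f z))"
proof (rule C2I[OF C1_inverse[OF C2_C1[OF assms(1)] assms(2)]])
  note I = C1_inverse[OF C2_C1[OF assms(1)] assms(2)]
  note C = I(1) C2_pder[OF assms(1)]
  note M = C1_mult[OF C]
  note MM = C1_mult[OF M(1) C(1)]
  show "C1 (\<lambda>z. - (inverse (f z) * pder f j v z * inverse (f z)))" for j v
    by (intro C1_uminus MM)
  have "pder (\<lambda>z. - (inverse (f z) * pder f j v z * inverse (f z))) k w z =
    - (inverse (f z) * pder f j v z * - (inverse (f z) * pder f k w z * inverse (f z)) +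
       (inverse (f z) * pder (pder f j v) k w z +
       - (inverse (f z) * pder f k w z * inverse (f z)) * pder f j v z) * inverse (f z))" for j v k w z
    by (simp only: C1_uminus(2)[OF MM(1)] MM(2) M(2) I(2))
  then show "pder (\<lambda>z. - (inverse (f z) * pder f j v z * inverse (f z))) k w z =
     pder (\<lambda>z. - (inverse (f z) * pder f k w z * inverse (f z))) j v z" for j v k w z
    by (simp only: C2_sym'[OF assms(1), of j]) (simp add: algebra_simps)
qed

text \<open>With \<open>p = 3\<close> this is a cutoff of class C2.\<close>

definition pos_pow :: "nat \<Rightarrow> complex \<Rightarrow> complex" where
  "pos_pow p w = of_real (max 0 (Re w) ^ p)"

lemma has_real_derivative_max_power:
  fixes x :: real
  assumes "p \<ge> 1"
  shows "((\<lambda>x. max 0 x ^ Suc p) has_real_derivative real (Suc p) * max 0 x ^ p) (at x)"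
proof (cases "x = 0")
  case False
  have ev: "eventually (\<lambda>y. (if x > 0 then y else 0) ^ Suc p = max 0 y ^ Suc p) (nhds x)"
  proof (cases "x > 0")
    case True
    then have "eventually (\<lambda>y. y \<in> {0<..}) (nhds x)" by (intro eventually_nhds_in_open) auto
    then show ?thesis by eventually_elim (use True in auto)
  next
    case F: False
    with False have "eventually (\<lambda>y. y \<in> {..<0}) (nhds x)" by (intro eventually_nhds_in_open) auto
    then show ?thesis by eventually_elim (use F in \<open>auto simp: max_def\<close>)
  qed
  have "((\<lambda>y. (if x > 0 then y else 0) ^ Suc p) has_real_derivative real (Suc p) * max 0 x ^ p) (at x)"
    using assms DERIV_pow[of "Suc p" x UNIV]
    by (cases "x > 0") (auto simp: max_def algebra_simps power_0_left)
  then show ?thesis using DERIV_cong_ev[OF refl ev refl] by blast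
next
  case True
  have "((\<lambda>h. max 0 h ^ Suc p / h) \<longlongrightarrow> 0) (at (0::real))"
  proof (rule Lim_null_comparison)
    show "eventually (\<lambda>h. norm (max 0 h ^ Suc p / h) \<le> \<bar>h\<bar> ^ p) (at (0::real))"
      by (rule eventually_at_topological[THEN iffD2])
         (auto intro!: exI[of _ UNIV] simp: max_def abs_mult)
    show "((\<lambda>h. \<bar>h\<bar> ^ p) \<longlongrightarrow> 0) (at (0::real))"
      using assms by (intro tendsto_eq_intros refl) auto
  qed
  then show ?thesis using True assms by (simp add: DERIV_def power_0_left)
qed

lemma continuous_on_pos_pow: "continuous_on UNIV f \<Longrightarrow> continuous_on UNIV (\<lambda>z. pos_pow p (f z))"
  unfolding pos_pow_def by (intro continuous_on_of_real continuous_on_power continuous_on_max continuous_on_const continuous_on_Re)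

lemma C1_pos_pow:
  assumes "C1 f" "p \<ge> 1"
  shows "C1 (\<lambda>z. pos_pow (Suc p) (f z))"
    "pder (\<lambda>z. pos_pow (Suc p) (f z)) = (\<lambda>j v z. of_nat (Suc p) * pos_pow p (f z) * of_real (Re (pder f j v z)))"
proof -
  have *: "((\<lambda>t. pos_pow (Suc p) (f (z(j := z j + of_real t * v)))) has_vector_derivative
      of_nat (Suc p) * pos_pow p (f z) * of_real (Re (pder f j v z))) (at 0)" for j v z
  proof -
    have "((\<lambda>t. Re (f (z(j := z j + of_real t * v)))) has_real_derivative Re (pder f j v z)) (at 0)"
      using C1_deriv[OF assms(1), of z j v] bounded_linear.has_vector_derivative[OF bounded_linear_Re]
      by (simp add: has_real_derivative_iff_has_vector_derivative)
    moreover have "((\<lambda>x. max 0 x ^ Suc p) has_real_derivative real (Suc p) * max 0 (Re (f z)) ^ p)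
        (at (Re (f (z(j := z j + of_real 0 * v)))))"
      using has_real_derivative_max_power[OF assms(2)] by simp
    ultimately have "((\<lambda>t. max 0 (Re (f (z(j := z j + of_real t * v)))) ^ Suc p) has_real_derivative
       real (Suc p) * max 0 (Re (f z)) ^ p * Re (pder f j v z)) (at 0)"
      by (rule DERIV_chain2[rotated])
    then show ?thesis unfolding pos_pow_def
      using bounded_linear.has_vector_derivative[OF bounded_linear_of_real]
      by (fastforce simp: has_real_derivative_iff_has_vector_derivative simp del: power_Suc)
  qed
  show "C1 (\<lambda>z. pos_pow (Suc p) (f z))"
    "pder (\<lambda>z. pos_pow (Suc p) (f z)) = (\<lambda>j v z. of_nat (Suc p) * pos_pow p (f z) * of_real (Re (pder f j v z)))"
    by (rule C1I[OF _ *]; intro continuous_on_mult continuous_on_const continuous_on_of_real continuous_on_Re continuous_on_pos_pow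
      C1_cont[OF assms(1)] C1_cont_pder[OF assms(1)])+
qed

lemma C2_pos_pow:
  assumes "C2 f"
  shows "C2 (\<lambda>z. pos_pow 3 (f z))"
proof -
  have 1: "C1 (\<lambda>z. pos_pow 3 (f z))"
    and 2: "pder (\<lambda>z. pos_pow 3 (f z)) = (\<lambda>j v z. 3 * pos_pow 2 (f z) * of_real (Re (pder f j v z)))"
    using C1_pos_pow[OF C2_C1[OF assms], of 2] by (simp_all add: numeral_3_eq_3)
  have c2: "C1 (\<lambda>z. pos_pow 2 (f z))"
    and p2: "pder (\<lambda>z. pos_pow 2 (f z)) = (\<lambda>j v z. 2 * pos_pow 1 (f z) * of_real (Re (pder f j v z)))"
    using C1_pos_pow[OF C2_C1[OF assms], of 1] by (simp_all add: numeral_2_eq_2)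
  note R = C1_bounded_linear[OF bounded_linear_Re_complex]
  note RR = R[OF C2_pder[OF assms]]
  have c3: "C1 (\<lambda>z. 3 * pos_pow 2 (f z))" by (intro C1_mult C1_const c2)
  have p3: "pder (\<lambda>z. 3 * pos_pow 2 (f z)) = (\<lambda>j v z. 3 * (2 * pos_pow 1 (f z) * of_real (Re (pder f j v z))))"
    by (simp add: C1_mult(2)[OF C1_const(1) c2] C1_const p2)
  note M = C1_mult[OF c3 RR(1)]
  show ?thesis
  proof (rule C2I[OF 1 2])
    show "C1 (\<lambda>z. 3 * pos_pow 2 (f z) * complex_of_real (Re (pder f j v z)))" for j v
      by (rule M)
    show "pder (\<lambda>z. 3 * pos_pow 2 (f z) * complex_of_real (Re (pder f j v z))) k w z =
      pder (\<lambda>z. 3 * pos_pow 2 (f z) * complex_of_real (Re (pder f k w z))) j v z" for j v k w z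
      by (simp only: M(2) p3 RR(2) C2_sym'[OF assms, of j]) (simp only: ac_simps)
  qed
qed

lemma C1_sum:
  assumes "\<And>i. i \<in> I \<Longrightarrow> C1 (f i)"
  shows "C1 (\<lambda>z. \<Sum>i\<in>I. f i z)" "pder (\<lambda>z. \<Sum>i\<in>I. f i z) = (\<lambda>j v z. \<Sum>i\<in>I. pder (f i) j v z)"
proof -
  have "C1 (\<lambda>z. \<Sum>i\<in>I. f i z) \<and> pder (\<lambda>z. \<Sum>i\<in>I. f i z) = (\<lambda>j v z. \<Sum>i\<in>I. pder (f i) j v z)"
    using assms by (induction I rule: infinite_finite_induct) (simp_all add: C1_const C1_add)
  then show "C1 (\<lambda>z. \<Sum>i\<in>I. f i z)"
    "pder (\<lambda>z. \<Sum>i\<in>I. f i z) = (\<lambda>j v z. \<Sum>i\<in>I. pder (f i) j v z)" by blast+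
qed

lemma C2_sum: "(\<And>i. i \<in> I \<Longrightarrow> C2 (f i)) \<Longrightarrow> C2 (\<lambda>z. \<Sum>i\<in>I. f i z)"
  by (induction I rule: infinite_finite_induct) (auto simp: C2_const intro: C2_add)

lemma C1_prod: "(\<And>i. i \<in> I \<Longrightarrow> C1 (f i)) \<Longrightarrow> C1 (\<lambda>z. \<Prod>i\<in>I. f i z)"
  by (induction I rule: infinite_finite_induct) (auto simp: C1_const intro: C1_mult)

lemma C2_prod: "(\<And>i. i \<in> I \<Longrightarrow> C2 (f i)) \<Longrightarrow> C2 (\<lambda>z. \<Prod>i\<in>I. f i z)"
  by (induction I rule: infinite_finite_induct) (auto simp: C2_const intro: C2_mult)

section \<open>The antiholomorphic partial derivatives\<close>

definition dbar :: "(pt \<Rightarrow> complex) \<Rightarrow> nat \<Rightarrow> pt \<Rightarrow> complex" where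
  "dbar f j z = (pder f j 1 z + \<i> * pder f j \<i> z) / 2"

lemma C1_dbar: "C2 f \<Longrightarrow> C1 (dbar f j)"
proof -
  assume "C2 f"
  then have "C1 (\<lambda>z. (pder f j 1 z + \<i> * pder f j \<i> z) * (1/2))"
    by (intro C1_add(1) C1_mult(1) C1_const(1) C2_pder)
  then show ?thesis unfolding dbar_def[abs_def] by simp
qed

lemma dbar_dbar:
  assumes "C2 f"
  shows "dbar (dbar f j) k = dbar (dbar f k) j"
proof -
  have "pder (dbar f j) = (\<lambda>k w z. (pder (pder f j 1) k w z + \<i> * pder (pder f j \<i>) k w z) * (1/2))" for j
  proof -
    have "dbar f j = (\<lambda>z. (pder f j 1 z + \<i> * pder f j \<i> z) * (1/2))"
      by (auto simp: dbar_def)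
    then show ?thesis
      using assms by (simp add: C1_add C1_mult C1_const C2_pder del: times_divide_eq_right)
  qed
  then show ?thesis
    unfolding dbar_def[of "dbar f j" for j, abs_def]
    by (auto simp: C2_sym[OF assms, of j] fun_eq_iff dbar_def algebra_simps)
qed

lemma dbar_const: "dbar (\<lambda>z. c) j z = 0"
  by (simp add: dbar_def C1_const)

lemma dbar_coord: "dbar (\<lambda>z. z i) j z = 0"
  by (simp add: dbar_def C1_coord)

lemma dbar_cnj_coord: "dbar (\<lambda>z. cnj (z i)) j z = (if j = i then 1 else 0)"
  by (simp add: dbar_def C1_coord C1_cnj)

lemma dbar_add: "C1 f \<Longrightarrow> C1 g \<Longrightarrow> dbar (\<lambda>z. f z + g z) j z = dbar f j z + dbar g j z"
  by (simp add: dbar_def C1_add algebra_simps add_divide_distrib)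

lemma dbar_diff: "C1 f \<Longrightarrow> C1 g \<Longrightarrow> dbar (\<lambda>z. f z - g z) j z = dbar f j z - dbar g j z"
  by (simp add: dbar_def C1_diff algebra_simps add_divide_distrib diff_divide_distrib)

lemma dbar_mult: "C1 f \<Longrightarrow> C1 g \<Longrightarrow> dbar (\<lambda>z. f z * g z) j z = f z * dbar g j z + dbar f j z * g z"
  by (simp add: dbar_def C1_mult algebra_simps add_divide_distrib)

lemma dbar_inverse:
  "C1 f \<Longrightarrow> (\<And>z. f z \<noteq> 0) \<Longrightarrow> dbar (\<lambda>z. inverse (f z)) j z = - dbar f j z * (inverse (f z))\<^sup>2"
  by (simp add: dbar_def C1_inverse) (simp add: power2_eq_square field_simps)

lemma dbar_sum:
  "(\<And>i. i \<in> I \<Longrightarrow> C1 (f i)) \<Longrightarrow> dbar (\<lambda>z. \<Sum>i\<in>I. f i z) j z = (\<Sum>i\<in>I. dbar (f i) j z)"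
  by (simp add: dbar_def C1_sum sum.distrib sum_distrib_left sum_divide_distrib add_divide_distrib)

lemma dbar_prod:
  assumes "finite I" "\<And>i. i \<in> I \<Longrightarrow> C1 (f i)"
  shows "dbar (\<lambda>z. \<Prod>i\<in>I. f i z) j z = (\<Sum>l\<in>I. dbar (f l) j z * (\<Prod>i\<in>I-{l}. f i z))"
  using assms
proof (induction I rule: finite_induct)
  case empty then show ?case by (simp add: dbar_const)
next
  case (insert x I)
  have "dbar (\<lambda>z. f x z * (\<Prod>i\<in>I. f i z)) j z =
     f x z * (\<Sum>l\<in>I. dbar (f l) j z * (\<Prod>i\<in>I-{l}. f i z)) + dbar (f x) j z * (\<Prod>i\<in>I. f i z)"
    using insert by (subst dbar_mult) (auto intro: C1_prod)
  also have "f x z * (\<Sum>l\<in>I. dbar (f l) j z * (\<Prod>i\<in>I-{l}. f i z)) =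
      (\<Sum>l\<in>I. dbar (f l) j z * (\<Prod>i\<in>insert x I-{l}. f i z))"
    unfolding sum_distrib_left
  proof (intro sum.cong refl)
    fix l assume "l \<in> I"
    then have "insert x I - {l} = insert x (I - {l})" using insert by auto
    then show "f x z * (dbar (f l) j z * (\<Prod>i\<in>I-{l}. f i z)) =
       dbar (f l) j z * (\<Prod>i\<in>insert x I-{l}. f i z)"
      using insert by simp
  qed
  finally show ?case using insert by (simp add: add.commute)
qed

lemma real_pder: "C1 f \<Longrightarrow> (\<And>z. f z \<in> \<real>) \<Longrightarrow> pder f j v z \<in> \<real>"
proof -
  assume "C1 f" and r: "\<And>z. f z \<in> \<real>"
  then have "pder (\<lambda>z. of_real (Re (f z))) j v z = of_real (Re (pder f j v z))"
    using C1_bounded_linear[OF bounded_linear_Re_complex] by metis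
  moreover have "(\<lambda>z. of_real (Re (f z))) = f" using r by auto
  ultimately show ?thesis by (metis Reals_of_real)
qed

text \<open>A real function has real partial derivatives, so the real part in the derivative of
  \<open>pos_pow\<close> disappears; this is what lets the chain rule pass to
  \<open>dbar\<close>.\<close>

lemma dbar_pos_pow:
  assumes "C1 f" "\<And>z. f z \<in> \<real>"
  shows "dbar (\<lambda>z. pos_pow 3 (f z)) j z = 3 * pos_pow 2 (f z) * dbar f j z"
proof -
  have "pder (\<lambda>z. pos_pow 3 (f z)) = (\<lambda>j v z. 3 * pos_pow 2 (f z) * of_real (Re (pder f j v z)))"
    using C1_pos_pow[OF assms(1), of 2] by (simp add: numeral_3_eq_3)
  then show ?thesis
    using real_pder[OF assms] by (simp add: dbar_def algebra_simps)
qed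

section \<open>Integration on complex affine space\<close>

text \<open>Only the first \<open>m\<close> coordinates are confined; on the space of
  \<open>lebC m\<close> all others have the value \<open>undefined\<close>.\<close>

definition supp_box :: "nat \<Rightarrow> real \<Rightarrow> (pt \<Rightarrow> complex) \<Rightarrow> bool" where
  "supp_box m R f \<longleftrightarrow> (\<forall>z l. l < m \<longrightarrow> norm (z l) > R \<longrightarrow> f z = 0)"

lemma supp_boxD: "supp_box m R f \<Longrightarrow> l < m \<Longrightarrow> norm (z l) > R \<Longrightarrow> f z = 0"
  unfolding supp_box_def by blast

abbreviation lebC :: "nat \<Rightarrow> pt measure" where
  "lebC m \<equiv> PiM {..<m} (\<lambda>_. lborel)"

text \<open>The filler \<open>c\<close> is \<open>undefined\<close> for points of
  \<open>lebC m\<close> and 0 for the unit sphere in \<open>no_separation\<close>.\<close>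

lemma compact_box: "compact {z :: pt. \<forall>i. z i \<in> (if i < m then cball 0 R else {c})}"
proof -
  have "compactin (product_topology (\<lambda>i::nat. euclidean :: complex topology) UNIV)
     (PiE UNIV (\<lambda>i. if i < m then cball 0 R else {c}))"
    unfolding compactin_PiE by simp
  moreover have "PiE UNIV (\<lambda>i. if i < m then cball 0 R else {c}) =
      {z :: pt. \<forall>i. z i \<in> (if i < m then cball 0 R else {c})}"
    by (simp add: PiE_UNIV_domain Pi_def)
  ultimately show ?thesis by (simp add: euclidean_product_topology)
qed

lemma measurable_lebC:
  fixes f :: "pt \<Rightarrow> complex"
  assumes "continuous_on UNIV f"
  shows "f \<in> borel_measurable (lebC m)"
proof -
  have "(\<lambda>z. z) \<in> borel_measurable (lebC m)"
  proof (rule measurable_coordinatewise_then_product)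
    fix i show "(\<lambda>x. x i) \<in> borel_measurable (lebC m)"
    proof (cases "i < m")
      case True then show ?thesis by simp
    next
      case False
      then show ?thesis
        by (subst measurable_cong[where g="\<lambda>_. undefined"]) (auto simp: space_PiM PiE_def extensional_def)
    qed
  qed
  then show ?thesis
    using measurable_compose borel_measurable_continuous_onI[OF assms] by blast
qed

lemma emeasure_lebC_box:
  assumes "\<And>i. i < m \<Longrightarrow> A i \<in> sets borel"
  shows "emeasure (lebC m) (PiE {..<m} A) = (\<Prod>i<m. emeasure lborel (A i))"
proof -
  interpret product_sigma_finite "\<lambda>_. lborel" ..
  show ?thesis using assms by (intro emeasure_PiM) auto
qed

lemma integrable_lebC:
  fixes f :: "pt \<Rightarrow> complex"
  assumes c: "continuous_on UNIV f" and s: "supp_box m R f"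
  shows "integrable (lebC m) f"
proof -
  define K where "K = {z :: pt. \<forall>i. z i \<in> (if i < m then cball 0 R else {undefined})}"
  have "compact (f ` K)"
    unfolding K_def by (rule compact_continuous_image[OF continuous_on_subset[OF c subset_UNIV] compact_box])
  then have "bounded (f ` K)" by (rule compact_imp_bounded)
  then obtain B where B: "\<forall>y\<in>f ` K. norm y \<le> B"
    unfolding bounded_iff by (elim exE)
  have box: "PiE {..<m} (\<lambda>_. cball 0 R) = K"
    by (auto simp: K_def PiE_def Pi_def extensional_def split: if_splits)
  show ?thesis
  proof (rule integrableI_bounded_set[where A=K and B=B])
    show "K \<in> sets (lebC m)" unfolding box[symmetric] by (intro sets_PiM_I_finite) auto
    show "f \<in> borel_measurable (lebC m)" by (rule measurable_lebC[OF c])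
    have "emeasure (lebC m) K = (\<Prod>i<m. emeasure lborel (cball (0::complex) R))"
      unfolding box[symmetric] by (intro emeasure_lebC_box) auto
    also have "\<dots> < \<infinity>"
      using emeasure_lborel_cball_finite[of "0::complex" R] by (simp add: power_less_top_ennreal)
    finally show "emeasure (lebC m) K < \<infinity>" .
    show "AE x in lebC m. x \<in> K \<longrightarrow> norm (f x) \<le> B" using B by simp
    have "f x = 0" if "x \<in> space (lebC m)" "x \<notin> K" for x
    proof -
      have "\<exists>l<m. norm (x l) > R"
        using that by (force simp: K_def space_PiM PiE_def extensional_def not_le split: if_splits)
      then show ?thesis using supp_boxD[OF s] by blast
    qed
    then show "AE x in lebC m. x \<notin> K \<longrightarrow> f x = 0" by (intro AE_I2) auto
  qed
qed

text \<open>Difference quotients of \<open>u\<close> have integral 0 by translation invariance of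
  Lebesgue measure, and they converge to \<open>u'\<close> under a common majorant. This treats a
  complex direction \<open>v\<close> directly, without splitting the plane into lines.\<close>

lemma integral_directional_derivative_zero:
  fixes u u' :: "complex \<Rightarrow> complex"
  assumes u: "continuous_on UNIV u" and u': "continuous_on UNIV u'"
    and d: "\<And>y. ((\<lambda>t. u (y + of_real t * v)) has_vector_derivative u' y) (at 0)"
    and s: "\<And>y. norm y > R \<Longrightarrow> u y = 0"
  shows "integral\<^sup>L lborel u' = 0"
proof -
  define h where "h n = 1 / real (Suc n)" for n
  have h: "h n > 0" "h n \<le> 1" for n by (auto simp: h_def)
  define q where "q n y = (u (y + of_real (h n) * v) - u y) / of_real (h n)" for n y
  have d': "((\<lambda>t. u (y + of_real t * v)) has_vector_derivative u' (y + of_real t0 * v)) (at t0 within S)" for y t0 S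
  proof -
    have "((\<lambda>t. u ((y + of_real t0 * v) + of_real t * v)) has_vector_derivative u' (y + of_real t0 * v)) (at 0)"
      by (rule d)
    then have "((\<lambda>t. u ((y + of_real t0 * v) + of_real t * v)) \<circ> (\<lambda>t. t - t0)
        has_vector_derivative 1 *\<^sub>R u' (y + of_real t0 * v)) (at t0)"
      by (intro vector_diff_chain_at) (auto intro!: derivative_eq_intros)
    then show ?thesis by (auto simp: o_def algebra_simps intro: has_vector_derivative_at_within)
  qed
  obtain B where B: "\<And>y. y \<in> cball 0 (R + 2 * norm v) \<Longrightarrow> norm (u' y) \<le> B"
    using compact_imp_bounded[OF compact_continuous_image[OF continuous_on_subset[OF u'] compact_cball]]
    unfolding bounded_iff by blast
  \<comment> \<open>Steps have length at most \<open>norm v\<close>, so the quotients vanish outside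
    radius \<open>R + norm v\<close>; inside, the segment from \<open>y\<close> stays within
    \<open>R + 2 * norm v\<close>, where \<open>B\<close> bounds \<open>u'\<close>.\<close>
  define w :: "complex \<Rightarrow> real" where "w = (\<lambda>y. indicator (cball 0 (R + norm v)) y * B)"
  have um[measurable]: "u \<in> borel_measurable borel" "u' \<in> borel_measurable borel"
    using u u' by (auto intro: borel_measurable_continuous_onI)
  have qlim: "(\<lambda>n. q n y) \<longlonglongrightarrow> u' y" for y
  proof -
    have "((\<lambda>t. (u (y + of_real t * v) - u y) / of_real t) \<longlongrightarrow> u' y) (at (0::real))"
    proof (rule Lim_null[THEN iffD2], rule tendsto_norm_zero_cancel)
      have "((\<lambda>t. norm (u (y + of_real (0 + t) * v) - u (y + of_real 0 * v) - t *\<^sub>R u' y) / norm t) \<longlongrightarrow> 0) (at 0)"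
        using d[of y] unfolding has_vector_derivative_def has_derivative_at by blast
      moreover have "norm (u (y + of_real (0 + t) * v) - u (y + of_real 0 * v) - t *\<^sub>R u' y) / norm t =
          norm ((u (y + of_real t * v) - u y) / of_real t - u' y)" if "t \<noteq> 0" for t
      proof -
        have "(u (y + of_real t * v) - u y) / of_real t - u' y = (u (y + of_real t * v) - u y - of_real t * u' y) / of_real t"
          using that by (simp add: diff_divide_distrib)
        then show ?thesis by (simp add: norm_divide scaleR_conv_of_real)
      qed
      ultimately show "((\<lambda>t. norm ((u (y + of_real t * v) - u y) / of_real t - u' y)) \<longlongrightarrow> 0) (at (0::real))"
        by (subst (asm) LIM_equal) auto
    qed
    moreover have "filterlim h (at 0) sequentially"
      unfolding filterlim_at using LIMSEQ_inverse_real_of_nat h(1)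
      by (auto simp: h_def[abs_def] inverse_eq_divide)
    ultimately show ?thesis unfolding q_def by (rule filterlim_compose)
  qed
  have qb: "norm (q n y) \<le> w y" for n y
  proof (cases "norm y \<le> R + norm v")
    case True
    have "norm (u (y + of_real (h n) * v) - u (y + of_real 0 * v)) \<le> B * norm (h n - 0)"
    proof (rule differentiable_bound[where S="{0..h n}"])
      show "((\<lambda>t. u (y + of_real t * v)) has_derivative (\<lambda>s. s *\<^sub>R u' (y + of_real t * v))) (at t within {0..h n})" for t
        using d' unfolding has_vector_derivative_def by blast
      fix t assume t: "t \<in> {0..h n}"
      have "norm (y + of_real t * v) \<le> norm y + \<bar>t\<bar> * norm v"
        by (metis norm_triangle_ineq norm_mult norm_of_real)
      also have "\<dots> \<le> (R + norm v) + 1 * norm v"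
        using t h[of n] True by (intro add_mono mult_right_mono) auto
      finally have "norm (u' (y + of_real t * v)) \<le> B" by (intro B) auto
      then show "onorm (\<lambda>s. s *\<^sub>R u' (y + of_real t * v)) \<le> B"
        by (intro onorm_le) (metis abs_ge_zero mult.commute mult_left_mono norm_scaleR real_norm_def)
    qed (use h[of n] in auto)
    then show ?thesis
      using True h[of n] by (simp add: q_def w_def norm_divide field_simps)
  next
    case False
    have "norm y \<le> norm (y + of_real (h n) * v) + norm (of_real (h n) * v)"
      by (metis add_diff_cancel_right' norm_triangle_ineq4)
    also have "norm (of_real (h n) * v) \<le> 1 * norm v"
      unfolding norm_mult using h[of n] by (intro mult_right_mono) auto
    finally have "norm (y + of_real (h n) * v) > R" using False by simp
    moreover have "norm y > R" using False norm_ge_zero[of v] by linarith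
    ultimately show ?thesis using s False by (simp add: q_def w_def)
  qed
  obtain B' where B': "\<And>y. y \<in> cball 0 R \<Longrightarrow> norm (u y) \<le> B'"
    using compact_imp_bounded[OF compact_continuous_image[OF continuous_on_subset[OF u] compact_cball]]
    unfolding bounded_iff by blast
  have ui: "integrable lborel u"
  proof (rule integrableI_bounded_set[where A="cball 0 R"])
    from B' show "AE y in lborel. y \<in> cball 0 R \<longrightarrow> norm (u y) \<le> B'" by auto
    show "AE y in lborel. y \<notin> cball 0 R \<longrightarrow> u y = 0" using s by auto
  qed (use emeasure_lborel_cball_finite in auto)
  have tr: "integrable lborel (\<lambda>y. u (y + c))" "integral\<^sup>L lborel (\<lambda>y. u (y + c)) = integral\<^sup>L lborel u" for c
  proof -
    have "integrable (distr lborel borel ((+) c)) u" using ui by (simp add: lborel_distr_plus)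
    then show "integrable lborel (\<lambda>y. u (y + c))"
      by (subst (asm) integrable_distr_eq) (auto simp: add.commute)
    have "integral\<^sup>L (distr lborel borel ((+) c)) u = integral\<^sup>L lborel (\<lambda>y. u (c + y))"
      by (rule integral_distr) auto
    then show "integral\<^sup>L lborel (\<lambda>y. u (y + c)) = integral\<^sup>L lborel u"
      by (simp add: lborel_distr_plus add.commute)
  qed
  have q0: "integral\<^sup>L lborel (q n) = 0" for n
    unfolding q_def using tr ui by simp
  have "(\<lambda>n. integral\<^sup>L lborel (q n)) \<longlonglongrightarrow> integral\<^sup>L lborel u'"
  proof (rule integral_dominated_convergence[where w=w])
    have "integrable lborel (indicator (cball (0::complex) (R + norm v)) :: complex \<Rightarrow> real)"
      by (intro integrable_real_indicator) (use emeasure_lborel_cball_finite in auto)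
    then show "integrable lborel w" unfolding w_def by (intro integrable_mult_left)
    show "q n \<in> borel_measurable lborel" for n unfolding q_def[abs_def] by simp
  qed (use qlim qb um in auto)
  then show ?thesis by (simp add: q0 LIMSEQ_const_iff)
qed

lemma continuous_on_fun_upd_line: "continuous_on UNIV (\<lambda>y. (x :: pt)(j := y))"
proof (rule continuous_on_coordinatewise_then_product)
  show "continuous_on UNIV (\<lambda>y. (x(j := y)) i)" for i
    by (cases "i = j") simp_all
qed

lemma supp_box_pder:
  assumes "C1 f" "supp_box m R f"
  shows "supp_box m R (pder f j v)"
  unfolding supp_box_def
proof (intro allI impI)
  fix z :: pt and l assume l: "l < m" "norm (z l) > R"
  have "continuous_on UNIV (\<lambda>t. norm ((z(j := z j + complex_of_real t * v)) l))"
    by (cases "l = j") (auto intro!: continuous_intros)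
  then have "open {t. norm ((z(j := z j + complex_of_real t * v)) l) > R}"
    by (intro open_Collect_less) (auto intro!: continuous_intros)
  then have "eventually (\<lambda>t. t \<in> {t. norm ((z(j := z j + complex_of_real t * v)) l) > R}) (nhds 0)"
    using l by (intro eventually_nhds_in_open) (auto simp: fun_upd_def)
  then have ev: "eventually (\<lambda>t. f (z(j := z j + complex_of_real t * v)) = 0) (nhds 0)"
    by eventually_elim (use supp_boxD[OF assms(2) l(1)] in auto)
  have "((\<lambda>t. f (z(j := z j + complex_of_real t * v))) has_vector_derivative 0) (at 0)"
    using has_vector_derivative_cong_ev[where S=UNIV and x=0 and f="\<lambda>t. f (z(j := z j + complex_of_real t * v))" and g="\<lambda>_. 0"]
      ev eventually_nhds_x_imp_x[OF ev]
    by auto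
  then show "pder f j v z = 0" unfolding pder_def by (rule vector_derivative_at)
qed

lemma integral_pder_zero:
  assumes "C1 f" "supp_box m R f" "j < m"
  shows "integral\<^sup>L (lebC m) (pder f j v) = 0"
proof -
  interpret product_sigma_finite "\<lambda>_. lborel :: complex measure" ..
  have I: "{..<m} = insert j ({..<m} - {j})" using assms(3) by auto
  have int: "integrable (lebC m) (pder f j v)"
    by (rule integrable_lebC[OF C1_cont_pder[OF assms(1)] supp_box_pder[OF assms(1,2)]])
  have "integral\<^sup>L (lebC m) (pder f j v) =
     (\<integral>x. (\<integral>y. pder f j v (x(j := y)) \<partial>lborel) \<partial>PiM ({..<m} - {j}) (\<lambda>_. lborel))"
    using product_integral_insert[of "{..<m} - {j}" j "pder f j v"] int I by auto
  also have "(\<lambda>x. (\<integral>y. pder f j v (x(j := y)) \<partial>lborel)) = (\<lambda>x. 0)"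
  proof
    fix x
    show "(\<integral>y. pder f j v (x(j := y)) \<partial>lborel) = 0"
    proof (rule integral_directional_derivative_zero[where u="\<lambda>y. f (x(j := y))" and R=R])
      show "continuous_on UNIV (\<lambda>y. f (x(j := y)))"
        using continuous_on_compose2[OF C1_cont[OF assms(1)] continuous_on_fun_upd_line] by auto
      show "continuous_on UNIV (\<lambda>y. pder f j v (x(j := y)))"
        using continuous_on_compose2[OF C1_cont_pder[OF assms(1)] continuous_on_fun_upd_line] by auto
      show "((\<lambda>t. f (x(j := y + complex_of_real t * v))) has_vector_derivative pder f j v (x(j := y))) (at 0)" for y
        using C1_deriv[OF assms(1), of "x(j := y)" j v] by simp
      show "f (x(j := y)) = 0" if "norm y > R" for y
        using supp_boxD[OF assms(2,3), of "x(j := y)"] that by simp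
    qed
  qed
  finally show ?thesis by simp
qed

lemma supp_box_mult: "supp_box m R f \<Longrightarrow> supp_box m R (\<lambda>z. f z * g z)"
  by (auto simp: supp_box_def)

lemma C1_cont_dbar: "C1 f \<Longrightarrow> continuous_on UNIV (dbar f j)"
proof -
  assume "C1 f"
  then have "continuous_on UNIV (\<lambda>z. (pder f j 1 z + \<i> * pder f j \<i> z) / 2)"
    by (intro continuous_on_divide continuous_on_add continuous_on_mult continuous_on_const C1_cont_pder) auto
  then show ?thesis unfolding dbar_def[abs_def] .
qed

lemma integral_dbar_zero:
  assumes "C1 f" "supp_box m R f" "j < m"
  shows "integral\<^sup>L (lebC m) (dbar f j) = 0"
proof -
  have "integrable (lebC m) (pder f j v)" for v
    by (rule integrable_lebC[OF C1_cont_pder[OF assms(1)] supp_box_pder[OF assms(1,2)]])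
  then show ?thesis unfolding dbar_def[abs_def]
    using integral_pder_zero[OF assms] by simp
qed

lemma supp_box_dbar: "C1 f \<Longrightarrow> supp_box m R f \<Longrightarrow> supp_box m R (dbar f j)"
  using supp_box_pder[of f m R j] unfolding supp_box_def dbar_def by simp

section \<open>Stokes' theorem for determinants of antiholomorphic derivatives\<close>

definition ldet :: "nat \<Rightarrow> (nat \<Rightarrow> nat \<Rightarrow> complex) \<Rightarrow> complex" where
  "ldet m A = (\<Sum>p | p permutes {..<m}. of_int (sign p) * (\<Prod>i<m. A i (p i)))"

text \<open>Composition with the transposition flips the sign and keeps \<open>H\<close>, so the sum
  equals its own negative.\<close>

lemma sum_permutes_swap_zero:
  fixes H :: "(nat \<Rightarrow> nat) \<Rightarrow> complex"
  assumes "i < m" "l < m" "i \<noteq> l"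
    and "\<And>p. p permutes {..<m} \<Longrightarrow> H (p \<circ> Transposition.transpose i l) = H p"
  shows "(\<Sum>p | p permutes {..<m}. of_int (sign p) * H p) = 0"
proof -
  let ?P = "{p. p permutes {..<m}}" and ?t = "Transposition.transpose i l"
  have t: "?t permutes {..<m}" using assms by (intro permutes_swap_id) auto
  have "(\<Sum>p\<in>?P. of_int (sign p) * H p) = (\<Sum>p\<in>?P. of_int (sign (p \<circ> ?t)) * H (p \<circ> ?t))"
    using sum_permutations_compose_right[OF t, of "\<lambda>p. of_int (sign p) * H p"] by simp
  also have "\<dots> = (\<Sum>p\<in>?P. - (of_int (sign p) * H p))"
  proof (intro sum.cong refl)
    fix p assume "p \<in> ?P"
    then have p: "p permutes {..<m}" by simp
    have "sign (p \<circ> ?t) = - sign p"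
      using p t assms(3) permutation_permutes[of p]
      by (subst sign_compose) (auto simp: sign_swap_id permutation_permutes intro: permutation_swap_id)
    then show "of_int (sign (p \<circ> ?t)) * H (p \<circ> ?t) = - (of_int (sign p) * H p)"
      using assms(4)[OF p] by simp
  qed
  finally show ?thesis by (simp add: sum_negf)
qed

text \<open>The determinant is the coefficient of the wedge product of the forms dbar \<tau>_k. This
  is exact up to sign: it is dbar of \<tau>_i times the wedge of the other forms, and the compact
  support of \<tau>_i removes the boundary term.\<close>

lemma integral_ldet_dbar_zero:
  assumes C: "\<And>k. k < m \<Longrightarrow> C2 (\<tau> k)" and i: "i < m" and s: "supp_box m R (\<tau> i)"
  shows "integrable (lebC m) (\<lambda>z. ldet m (\<lambda>k l. dbar (\<tau> k) l z))"
    and "integral\<^sup>L (lebC m) (\<lambda>z. ldet m (\<lambda>k l. dbar (\<tau> k) l z)) = 0"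
proof -
  let ?P = "{p. p permutes {..<m}}" and ?I = "{..<m} - {i}"
  define Q where "Q p z = (\<Prod>k\<in>?I. dbar (\<tau> k) (p k) z)" for p z
  have CQ: "C1 (Q p)" for p
    unfolding Q_def[abs_def] by (intro C1_prod C1_dbar C) auto
  have C\<phi>: "C1 (\<tau> i)" by (intro C2_C1 C i)
  have pi: "p i < m" if "p \<in> ?P" for p using that permutes_in_image[of p "{..<m}" i] i by auto
  define E where "E p z = (\<Sum>l\<in>?I. dbar (dbar (\<tau> l) (p l)) (p i) z * (\<Prod>k\<in>?I-{l}. dbar (\<tau> k) (p k) z))" for p z
  have dQ: "dbar (Q p) (p i) z = E p z" for p z
    unfolding Q_def[abs_def] E_def by (intro dbar_prod C1_dbar C) auto
  have dF: "dbar (\<lambda>z. \<tau> i z * Q p z) (p i) z = \<tau> i z * E p z + dbar (\<tau> i) (p i) z * Q p z" for p z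
    using dbar_mult[OF C\<phi> CQ] dQ by simp
  have det: "ldet m (\<lambda>k l. dbar (\<tau> k) l z) = (\<Sum>p\<in>?P. of_int (sign p) * (dbar (\<tau> i) (p i) z * Q p z))" for z
    unfolding ldet_def Q_def using i by (simp add: prod.remove[of "{..<m}" i])
  \<comment> \<open>Closedness of the remaining forms: exchanging the values of \<open>p\<close> at
    \<open>i\<close> and \<open>l\<close> leaves the second derivative of \<tau>_l unchanged, by
    symmetry, but reverses the sign.\<close>
  have E0: "(\<Sum>p\<in>?P. of_int (sign p) * E p z) = 0" for z
  proof -
    have "(\<Sum>p\<in>?P. of_int (sign p) * E p z) =
      (\<Sum>l\<in>?I. \<Sum>p\<in>?P. of_int (sign p) * (dbar (dbar (\<tau> l) (p l)) (p i) z * (\<Prod>k\<in>?I-{l}. dbar (\<tau> k) (p k) z)))"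
      unfolding E_def sum_distrib_left by (rule sum.swap)
    also have "\<dots> = (\<Sum>l\<in>?I. 0)"
    proof (intro sum.cong refl)
      fix l assume l: "l \<in> ?I"
      show "(\<Sum>p\<in>?P. of_int (sign p) * (dbar (dbar (\<tau> l) (p l)) (p i) z * (\<Prod>k\<in>?I-{l}. dbar (\<tau> k) (p k) z))) = 0"
      proof (rule sum_permutes_swap_zero[where i=i and l=l])
        fix p
        have "(\<Prod>k\<in>?I-{l}. dbar (\<tau> k) ((p \<circ> Transposition.transpose i l) k) z) = (\<Prod>k\<in>?I-{l}. dbar (\<tau> k) (p k) z)"
          by (intro prod.cong) auto
        then show "dbar (dbar (\<tau> l) ((p \<circ> Transposition.transpose i l) l)) ((p \<circ> Transposition.transpose i l) i) z *
             (\<Prod>k\<in>?I-{l}. dbar (\<tau> k) ((p \<circ> Transposition.transpose i l) k) z) =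
           dbar (dbar (\<tau> l) (p l)) (p i) z * (\<Prod>k\<in>?I-{l}. dbar (\<tau> k) (p k) z)"
          using dbar_dbar[OF C, of l "p i" "p l"] l by simp
      qed (use i l in auto)
    qed
    finally show ?thesis by simp
  qed
  have int: "integrable (lebC m) (\<lambda>z. dbar (\<tau> i) (p i) z * Q p z)" for p
    by (intro integrable_lebC[where R=R] continuous_on_mult C1_cont_dbar C1_cont C\<phi> CQ supp_box_mult supp_box_dbar s)
  show "integrable (lebC m) (\<lambda>z. ldet m (\<lambda>k l. dbar (\<tau> k) l z))"
    unfolding det by (intro Bochner_Integration.integrable_sum Bochner_Integration.integrable_mult_right int)
  have sF: "supp_box m R (\<lambda>z. \<tau> i z * Q p z)" for p by (intro supp_box_mult s)
  have cF: "C1 (\<lambda>z. \<tau> i z * Q p z)" for p by (intro C1_mult C\<phi> CQ)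
  have "(\<Sum>p\<in>?P. of_int (sign p) * (dbar (\<tau> i) (p i) z * Q p z)) =
      (\<Sum>p\<in>?P. of_int (sign p) * dbar (\<lambda>z. \<tau> i z * Q p z) (p i) z)" for z
  proof -
    have "(\<Sum>p\<in>?P. of_int (sign p) * dbar (\<lambda>z. \<tau> i z * Q p z) (p i) z) =
       \<tau> i z * (\<Sum>p\<in>?P. of_int (sign p) * E p z) + (\<Sum>p\<in>?P. of_int (sign p) * (dbar (\<tau> i) (p i) z * Q p z))"
      unfolding dF by (simp add: sum_distrib_left sum.distrib algebra_simps)
    then show ?thesis using E0 by simp
  qed
  then have "integral\<^sup>L (lebC m) (\<lambda>z. ldet m (\<lambda>k l. dbar (\<tau> k) l z)) =
     (\<integral>z. (\<Sum>p\<in>?P. of_int (sign p) * dbar (\<lambda>z. \<tau> i z * Q p z) (p i) z) \<partial>lebC m)"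
    unfolding det by simp
  also have "\<dots> = (\<Sum>p\<in>?P. of_int (sign p) * (\<integral>z. dbar (\<lambda>z. \<tau> i z * Q p z) (p i) z \<partial>lebC m))"
    using integrable_lebC[OF C1_cont_dbar[OF cF] supp_box_dbar[OF cF sF]]
    by (subst Bochner_Integration.integral_sum) auto
  also have "\<dots> = 0"
    using integral_dbar_zero[OF cF sF] pi by (intro sum.neutral) auto
  finally show "integral\<^sup>L (lebC m) (\<lambda>z. ldet m (\<lambda>k l. dbar (\<tau> k) l z)) = 0" .
qed

lemma ldet_row_diff:
  assumes "i < m" "\<And>k l. k < m \<Longrightarrow> k \<noteq> i \<Longrightarrow> A k l = B k l" "\<And>k l. k < m \<Longrightarrow> k \<noteq> i \<Longrightarrow> A k l = D k l"
    "\<And>l. D i l = A i l - B i l"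
  shows "ldet m A - ldet m B = ldet m D"
proof -
  have "of_int (sign p) * (\<Prod>k<m. A k (p k)) - of_int (sign p) * (\<Prod>k<m. B k (p k)) =
     of_int (sign p) * (\<Prod>k<m. D k (p k))" for p
  proof -
    have "(\<Prod>k\<in>{..<m}-{i}. B k (p k)) = (\<Prod>k\<in>{..<m}-{i}. A k (p k))"
      "(\<Prod>k\<in>{..<m}-{i}. D k (p k)) = (\<Prod>k\<in>{..<m}-{i}. A k (p k))"
      using assms(2,3) by (auto intro!: prod.cong)
    then show ?thesis
      using assms(1) by (simp add: prod.remove[of "{..<m}" i] assms(4) algebra_simps)
  qed
  then show ?thesis unfolding ldet_def sum_subtractf[symmetric] by simp
qed

text \<open>By multilinearity the rows are changed one at a time, and each increment is a
  determinant with one compactly supported row. The difference is integrated as a whole because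
  neither determinant need be integrable by itself.\<close>

lemma integral_ldet_dbar_perturb:
  assumes C: "\<And>k. k < m \<Longrightarrow> C2 (\<tau> k)" "\<And>k. k < m \<Longrightarrow> C2 (\<phi> k)"
    and s: "\<And>k. k < m \<Longrightarrow> supp_box m R (\<phi> k)"
  shows "integral\<^sup>L (lebC m) (\<lambda>z. ldet m (\<lambda>k l. dbar (\<lambda>z. \<tau> k z + \<phi> k z) l z) - ldet m (\<lambda>k l. dbar (\<tau> k) l z)) = 0"
proof -
  define T where "T n k = (if k < n then (\<lambda>z. \<tau> k z + \<phi> k z) else \<tau> k)" for n k
  define D where "D n z = ldet m (\<lambda>k l. dbar (T n k) l z)" for n z
  have CT: "C2 (T n k)" if "k < m" for n k unfolding T_def using C that by (auto intro: C2_add)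
  have "integrable (lebC m) (\<lambda>z. D n z - D 0 z) \<and> integral\<^sup>L (lebC m) (\<lambda>z. D n z - D 0 z) = 0" if "n \<le> m" for n
    using that
  proof (induction n)
    case 0 then show ?case by simp
  next
    case (Suc n)
    define W where "W = (T n)(n := \<phi> n)"
    have n: "n < m" using Suc by simp
    have step: "D (Suc n) z - D n z = ldet m (\<lambda>k l. dbar (W k) l z)" for z
      unfolding D_def
    proof (rule ldet_row_diff[OF n])
      show "dbar (W n) l z = dbar (T (Suc n) n) l z - dbar (T n n) l z" for l
        using n C by (simp add: W_def T_def dbar_add C2_C1)
    qed (auto simp: T_def W_def)
    have W: "\<And>k. k < m \<Longrightarrow> C2 (W k)" "supp_box m R (W n)"
      using CT C s n by (auto simp: W_def)
    note Z = integral_ldet_dbar_zero[where \<tau>=W, OF W(1) n W(2)]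
    have "(\<lambda>z. D (Suc n) z - D 0 z) = (\<lambda>z. (D n z - D 0 z) + ldet m (\<lambda>k l. dbar (W k) l z))"
      using step by (simp add: fun_eq_iff algebra_simps)
    then show ?case using Suc Z by (simp del: add_diff_eq diff_add_eq)
  qed
  from this[of m] have "integral\<^sup>L (lebC m) (\<lambda>z. D m z - D 0 z) = 0" by simp
  moreover have "D m z = ldet m (\<lambda>k l. dbar (\<lambda>z. \<tau> k z + \<phi> k z) l z)" for z
    unfolding D_def T_def ldet_def by (intro sum.cong refl arg_cong2[of _ _ _ _ "(*)"] prod.cong) auto
  moreover have "D 0 z = ldet m (\<lambda>k l. dbar (\<tau> k) l z)" for z
    unfolding D_def T_def by simp
  ultimately show ?thesis by simp
qed

section \<open>Determinants\<close>

lemma ldet_eq_det: "ldet m A = det (mat m m (\<lambda>(i, j). A i j))"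
proof -
  have "(\<Prod>i<m. A i (p i)) = (\<Prod>i = 0..<m. mat m m (\<lambda>(i, j). A i j) $$ (i, p i))"
    if "p permutes {0..<m}" for p
    using permutes_in_image[OF that] by (auto simp: lessThan_atLeast0 intro!: prod.cong)
  then show ?thesis
    by (subst det_def'[of _ m]) (auto simp: ldet_def lessThan_atLeast0 intro!: sum.cong)
qed

lemma ldet_zero_row:
  assumes "i < m" "\<And>l. l < m \<Longrightarrow> A i l = 0"
  shows "ldet m A = 0"
  unfolding ldet_def
proof (rule sum.neutral, safe)
  fix p assume "p permutes {..<m}"
  then have "p i < m" using permutes_in_image[of p "{..<m}" i] assms(1) by auto
  then have "(\<Prod>i<m. A i (p i)) = 0" using assms by (auto intro!: bexI[of _ i] simp: prod_zero_iff)
  then show "of_int (sign p) * (\<Prod>i<m. A i (p i)) = 0" by simp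
qed

lemma ldet_left_kernel:
  assumes "i < m" "x i \<noteq> 0" "\<And>l. l < m \<Longrightarrow> (\<Sum>k<m. x k * A k l) = 0"
  shows "ldet m A = 0"
proof -
  let ?M = "mat m m (\<lambda>(i, j). A i j)"
  have M: "?M \<in> carrier_mat m m" by simp
  have "det (transpose_mat ?M) = 0"
  proof (subst det_0_iff_vec_prod_zero[of _ m], simp, intro exI[of _ "vec m x"] conjI)
    show "vec m x \<in> carrier_vec m" by simp
    show "vec m x \<noteq> 0\<^sub>v m" using assms(1,2) by (metis index_vec index_zero_vec(1))
    show "transpose_mat ?M *\<^sub>v vec m x = 0\<^sub>v m"
    proof (intro eq_vecI)
      fix l assume "l < dim_vec (0\<^sub>v m :: complex vec)"
      then show "(transpose_mat ?M *\<^sub>v vec m x) $ l = 0\<^sub>v m $ l"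
        using assms(3)[of l] by (simp add: scalar_prod_def lessThan_atLeast0 mult.commute)
    qed simp
  qed
  then show ?thesis using det_transpose[OF M] by (simp add: ldet_eq_det)
qed

text \<open>The matrix factors as a product of square matrices whose first factor is padded with
  zero columns.\<close>

lemma ldet_low_rank:
  assumes "r < m" "\<And>i l. i < m \<Longrightarrow> l < m \<Longrightarrow> A i l = (\<Sum>j<r. B i j * D j l)"
  shows "ldet m A = 0"
proof -
  let ?B = "mat m m (\<lambda>(i, j). if j < r then B i j else 0)" and ?D = "mat m m (\<lambda>(i, j). D i j)"
  have "mat m m (\<lambda>(i, j). A i j) = ?B * ?D"
  proof (intro eq_matI)
    fix i l assume "i < dim_row (?B * ?D)" "l < dim_col (?B * ?D)"
    then have il: "i < m" "l < m" by auto
    have "(\<Sum>j<r. B i j * D j l) = (\<Sum>j<m. (if j < r then B i j else 0) * D j l)"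
      using assms(1) by (intro sum.mono_neutral_cong_left) auto
    then show "mat m m (\<lambda>(i, j). A i j) $$ (i, l) = (?B * ?D) $$ (i, l)"
      using il assms(2)[OF il] by (simp add: scalar_prod_def lessThan_atLeast0)
  qed auto
  moreover have "det ?B = 0"
  proof -
    have "det (mat m m (\<lambda>(j, i). if j < r then B i j else 0)) = 0"
      using ldet_zero_row[OF assms(1), of "\<lambda>j i. if j < r then B i j else 0"] by (simp add: ldet_eq_det)
    moreover have "mat m m (\<lambda>(j, i). if j < r then B i j else 0) = transpose_mat ?B"
      by (intro eq_matI) auto
    ultimately show ?thesis using det_transpose[of ?B m] by simp
  qed
  ultimately show ?thesis by (simp add: ldet_eq_det det_mult[of _ m])
qed

text \<open>A permutation that fixes every index but \<open>k\<close> fixes \<open>k\<close> too, so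
  only the identity contributes.\<close>

lemma ldet_diagonal_except_row:
  assumes k: "k < m" and A: "\<And>i j. i < m \<Longrightarrow> i \<noteq> k \<Longrightarrow> j \<noteq> i \<Longrightarrow> A i j = 0"
  shows "ldet m A = (\<Prod>i<m. A i i)"
proof -
  have "(\<Prod>i<m. A i (p i)) = 0" if p: "p permutes {..<m}" "p \<noteq> id" for p
  proof -
    have "\<exists>i<m. i \<noteq> k \<and> p i \<noteq> i"
    proof (rule ccontr)
      assume "\<not> (\<exists>i<m. i \<noteq> k \<and> p i \<noteq> i)"
      then have fix': "p i = i" if "i \<noteq> k" for i
        using p(1) that by (cases "i < m") (auto simp: permutes_def)
      moreover have "p k = k"
        using fix' permutes_inj[OF p(1)] by (metis injD)
      ultimately show False using p(2) by (metis eq_id_iff)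
    qed
    then show ?thesis using A by (auto intro!: prod_zero)
  qed
  then have "ldet m A = (\<Sum>p\<in>{id}. of_int (sign p) * (\<Prod>i<m. A i (p i)))"
    unfolding ldet_def by (intro sum.mono_neutral_right) (auto simp: finite_permutations permutes_id)
  then show ?thesis by (simp add: sign_id)
qed

lemma ldet_proportional_rows:
  assumes "i < m" "k < m" "i \<noteq> k" "\<And>j. A i j = x * v j" "\<And>j. A k j = y * v j"
  shows "ldet m A = 0"
  unfolding ldet_def
proof (rule sum_permutes_swap_zero[OF assms(1-3)])
  fix p :: "nat \<Rightarrow> nat" 
  have S: "(\<Prod>l<m. A l (f l)) = x * v (f i) * (y * v (f k)) * (\<Prod>l\<in>{..<m} - {i} - {k}. A l (f l))" for f
    using assms by (simp add: prod.remove[of "{..<m}" i] prod.remove[of "{..<m} - {i}" k])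
  have "(\<Prod>l\<in>{..<m} - {i} - {k}. A l ((p \<circ> Transposition.transpose i k) l)) =
     (\<Prod>l\<in>{..<m} - {i} - {k}. A l (p l))"
    by (intro prod.cong) auto
  then show "(\<Prod>l<m. A l ((p \<circ> Transposition.transpose i k) l)) = (\<Prod>l<m. A l (p l))"
    unfolding S by simp
qed

text \<open>The matrix determinant lemma in a form that permits \<open>c = 0\<close>: the rank-one
  term is inserted row by row, and each row contributes one summand.\<close>

lemma ldet_rank_one_perturbation:
  "ldet m (\<lambda>i j. (if i = j then c else 0) + u i * v j) = c ^ m + c ^ (m - 1) * (\<Sum>i<m. u i * v i)"
proof -
  define e where "e i j = (if i = j then c else 0)" for i j :: nat
  define A where "A n i j = (if i < n then e i j + u i * v j else e i j)" for n i j :: nat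
  have step: "ldet m (A (Suc k)) - ldet m (A k) = c ^ (m - 1) * (u k * v k)" if k: "k < m" for k
  proof -
    \<comment> \<open>Row \<open>k\<close> has become a multiple of \<open>v\<close>, so the
      multiples of \<open>v\<close> in the earlier rows can be cleared one after another;
      \<open>B 0\<close> has none left.\<close>
    define B where "B n i j = (if i = k then u k * v j else if i < n then e i j + u i * v j else e i j)" for n i j :: nat
    have B0: "ldet m (B n) = ldet m (B 0)" if "n \<le> k" for n
      using that
    proof (induction n)
      case (Suc n)
      have "ldet m (B (Suc n)) - ldet m (B n) = ldet m ((B n)(n := (\<lambda>j. u n * v j)))"
        by (rule ldet_row_diff[of n]) (use Suc k in \<open>auto simp: B_def\<close>)
      also have "\<dots> = 0"
        by (rule ldet_proportional_rows[where i=n and k=k]) (use Suc k in \<open>auto simp: B_def\<close>)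
      finally show ?case using Suc by simp
    qed simp
    have "ldet m (A (Suc k)) - ldet m (A k) = ldet m (B k)"
      by (rule ldet_row_diff[OF k]) (auto simp: A_def B_def)
    also have "\<dots> = ldet m (B 0)" by (rule B0) simp
    also have "\<dots> = (\<Prod>i<m. B 0 i i)"
      by (rule ldet_diagonal_except_row[OF k]) (auto simp: B_def e_def)
    also have "\<dots> = u k * v k * (\<Prod>i\<in>{..<m} - {k}. c)"
    proof -
      have "(\<Prod>i<m. B 0 i i) = B 0 k k * (\<Prod>i\<in>{..<m} - {k}. B 0 i i)"
        using k by (intro prod.remove) auto
      also have "(\<Prod>i\<in>{..<m} - {k}. B 0 i i) = (\<Prod>i\<in>{..<m} - {k}. c)"
        by (intro prod.cong) (auto simp: B_def e_def)
      finally show ?thesis by (simp only: B_def) simp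
    qed
    also have "\<dots> = c ^ (m - 1) * (u k * v k)" using k by simp
    finally show ?thesis .
  qed
  have "ldet m (A n) = c ^ m + c ^ (m - 1) * (\<Sum>i<n. u i * v i)" if "n \<le> m" for n
    using that
  proof (induction n)
    case 0
    have "ldet m (A 0) = (\<Prod>i<m. c)"
    proof (cases "m = 0")
      case False
      then show ?thesis
        using ldet_diagonal_except_row[of 0 m "A 0"] by (auto simp: A_def e_def)
    qed (simp add: ldet_def)
    then show ?case by simp
  next
    case (Suc n)
    then show ?case using step[of n] by (simp add: algebra_simps)
  qed
  from this[of m] have "ldet m (A m) = c ^ m + c ^ (m - 1) * (\<Sum>i<m. u i * v i)" by simp
  moreover have "ldet m (A m) = ldet m (\<lambda>i j. (if i = j then c else 0) + u i * v j)"
    unfolding ldet_def A_def e_def by (intro sum.cong prod.cong arg_cong2[of _ _ _ _ "(*)"]) auto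
  ultimately show ?thesis by simp
qed

section \<open>Two cones meeting only at the origin\<close>

lemmas C2_intros = C2_const C2_coord C2_add C2_mult C2_diff C2_cnj C2_sum C2_prod C2_pos_pow

text \<open>Functions that are flat at \<open>z\<close> form an ideal, which allows to compute first derivatives on the
  boundary of the cutoff regions.\<close>

definition flat :: "(pt \<Rightarrow> complex) \<Rightarrow> pt \<Rightarrow> bool" where
  "flat f z \<longleftrightarrow> f z = 0 \<and> (\<forall>l. dbar f l z = 0)"

lemma flatD: "flat f z \<Longrightarrow> f z = 0" "flat f z \<Longrightarrow> dbar f l z = 0"
  by (auto simp: flat_def)

lemma flat_mult1: "flat f z \<Longrightarrow> C2 f \<Longrightarrow> C2 g \<Longrightarrow> flat (\<lambda>z. f z * g z) z"
  by (simp add: flat_def dbar_mult C2_C1)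

lemma flat_mult2: "flat g z \<Longrightarrow> C2 f \<Longrightarrow> C2 g \<Longrightarrow> flat (\<lambda>z. f z * g z) z"
  by (simp add: flat_def dbar_mult C2_C1)

lemma flat_add: "flat f z \<Longrightarrow> flat g z \<Longrightarrow> C2 f \<Longrightarrow> C2 g \<Longrightarrow> flat (\<lambda>z. f z + g z) z"
  by (simp add: flat_def dbar_add C2_C1)

lemma flat_pos_pow:
  assumes "C2 f" "\<And>z. f z \<in> \<real>" "Re (f z) \<le> 0"
  shows "flat (\<lambda>z. pos_pow 3 (f z)) z"
  unfolding flat_def dbar_pos_pow[OF C2_C1[OF assms(1)] assms(2)] using assms(3) by (simp add: pos_pow_def)

lemma pos_pow_real: "pos_pow p w \<in> \<real>" "Re (pos_pow p w) \<ge> 0" "Im (pos_pow p w) = 0"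
  by (auto simp: pos_pow_def)

lemma pos_pow_pos: "Re w > 0 \<Longrightarrow> Re (pos_pow p w) > 0"
  by (auto simp: pos_pow_def)

lemma cnj_mult_self: "cnj w * w = of_real ((norm w)\<^sup>2)"
  by (metis complex_norm_square mult.commute of_real_power)

lemma sum_cnj_mult_self: "(\<Sum>i\<in>I. cnj (f i) * f i) = of_real (\<Sum>i\<in>I. (norm (f i))\<^sup>2)"
  by (simp add: cnj_mult_self)

lemma add_neq_0_real: "x \<in> \<real> \<Longrightarrow> y \<in> \<real> \<Longrightarrow> Re x > 0 \<and> Re y \<ge> 0 \<or> Re x \<ge> 0 \<and> Re y > 0 \<Longrightarrow> x + y \<noteq> 0"
  by (metis add_nonneg_pos add_pos_nonneg less_irrefl plus_complex.sel(1) zero_complex.sel(1))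

text \<open>The cones are the zero sets of \<open>a\<close> and \<open>b\<close>; the first contains the axis \<open>0\<close> and the second the
  axis \<open>1\<close>, so \<open>g\<close> can be written in terms of the coordinates other than \<open>z 0\<close> (by \<open>GA\<close>) or
  other than \<open>z 1\<close> (by \<open>GB\<close>).\<close>

locale separated_cones =
  fixes m r :: nat and g :: "nat \<Rightarrow> pt \<Rightarrow> complex" and a b :: "pt \<Rightarrow> complex"
    and GA GB :: "nat \<Rightarrow> nat \<Rightarrow> pt \<Rightarrow> complex"
  assumes rm: "r + 2 \<le> m"
    and gC: "\<And>j. C2 (g j)"
    and GC: "\<And>j i. C2 (GA j i)" "\<And>j i. C2 (GB j i)"
    and Gd: "\<And>j i l z. dbar (GA j i) l z = 0" "\<And>j i l z. dbar (GB j i) l z = 0"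
    and gG: "\<And>j z. j < r \<Longrightarrow> g j z = (\<Sum>i<m. GA j i z * z i)" "\<And>j z. j < r \<Longrightarrow> g j z = (\<Sum>i<m. GB j i z * z i)"
    and G0: "\<And>j z. GA j 0 z = 0" "\<And>j z. GB j 1 z = 0"
    and aC: "C2 a" "C2 b"
    and ar: "\<And>z. a z \<in> \<real>" "\<And>z. b z \<in> \<real>"
    and sep: "\<And>z. (\<Sum>i<m. (norm (z i))\<^sup>2) \<ge> 1 \<Longrightarrow> Re (a z) \<ge> 1 \<or> Re (b z) \<ge> 1"
    and gz: "\<And>z. Re (a z) > 0 \<Longrightarrow> Re (b z) > 0 \<Longrightarrow> \<exists>j<r. g j z \<noteq> 0"
    and line: "\<And>z. (\<forall>i<m. i \<noteq> 0 \<longrightarrow> z i = 0) \<Longrightarrow> Re (a z) < 1/3"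
      "\<And>z. (\<forall>i<m. i \<noteq> 1 \<longrightarrow> z i = 0) \<Longrightarrow> Re (b z) < 1/3"
begin

text \<open>\<open>X\<close> is \<open>0\<close> near \<open>a = 0\<close> and \<open>1\<close> near \<open>b = 0\<close>, and \<open>h\<close> cuts off the unit ball. Away from the
  cones, \<open>ka = kb = ee = 0\<close> and \<open>sg\<close> pairs with \<open>g\<close> to \<open>1\<close>; near the first (second) cone \<open>sB\<close>
  (\<open>sA\<close>) pairs with \<open>z\<close> to \<open>1\<close>. Hence \<open>T'\<close> pairs with \<open>z\<close> to \<open>h\<close>, and \<open>T = T' + \<phi>\<close>.\<close>

definition "tt z = (\<Sum>i<m. cnj (z i) * z i)"
definition "ka z = pos_pow 3 (1/3 - a z)"
definition "kb z = pos_pow 3 (1/3 - b z)"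
definition "gg z = (\<Sum>j<r. cnj (g j z) * g j z)"
definition "R z = inverse (gg z + (ka z + kb z))"
definition "sg j z = cnj (g j z) * R z"
definition "ee z = (ka z + kb z) * R z"
definition "Xden z = inverse (pos_pow 3 (a z - 1/3) + pos_pow 3 (1 - a z))"
definition "X z = pos_pow 3 (a z - 1/3) * Xden z"
definition "hden z = inverse (pos_pow 3 (tt z - 1) + pos_pow 3 (2 - tt z))"
definition "h z = pos_pow 3 (tt z - 1) * hden z"
definition "uA z = (\<Sum>i\<in>{..<m}-{0}. cnj (z i) * z i)"
definition "uB z = (\<Sum>i\<in>{..<m}-{1}. cnj (z i) * z i)"
definition "rA z = inverse (uA z + ka z)"
definition "rB z = inverse (uB z + kb z)"
definition "sA i z = (if i = 0 then 0 else cnj (z i) * rA z)"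
definition "sB i z = (if i = 1 then 0 else cnj (z i) * rB z)"
definition "S j z = h z * sg j z"
definition "P j i z = GB j i z + X z * (GA j i z - GB j i z)"
definition "T' i z = (\<Sum>j<r. S j z * P j i z) + h z * ee z * (sB i z + X z * (sA i z - sB i z))"
definition "k1 z = pos_pow 3 (1 - tt z)"
definition "F z = inverse (tt z + k1 z)"
definition "\<phi> i z = (1 - h z) * (cnj (z i) * F z)"

section \<open>Denominators and regularity of the glued map\<close>

lemma tt_eq: "tt z = of_real (\<Sum>i<m. (norm (z i))\<^sup>2)"
  unfolding tt_def by (rule sum_cnj_mult_self)

lemma tt_real: "tt z \<in> \<real>" unfolding tt_eq by simp

text \<open>All terms are nonnegative reals. Where every \<open>g j\<close> vanishes,
  \<open>gz\<close> makes \<open>a\<close> or \<open>b\<close> nonpositive, and then the cutoff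
  \<open>ka\<close> or \<open>kb\<close> is positive.\<close>

lemma nz_R: "gg z + (ka z + kb z) \<noteq> 0"
proof (rule add_neq_0_real)
  show "gg z \<in> \<real>" unfolding gg_def sum_cnj_mult_self by simp
  show "ka z + kb z \<in> \<real>" unfolding ka_def kb_def by (intro Reals_add pos_pow_real)
  have kk: "Re (ka z) \<ge> 0" "Re (kb z) \<ge> 0" unfolding ka_def kb_def by (auto intro: pos_pow_real)
  have gge: "Re (gg z) \<ge> 0" unfolding gg_def sum_cnj_mult_self by (simp add: sum_nonneg)
  show "Re (gg z) > 0 \<and> Re (ka z + kb z) \<ge> 0 \<or> Re (gg z) \<ge> 0 \<and> Re (ka z + kb z) > 0"
  proof (cases "Re (a z) > 0 \<and> Re (b z) > 0")
    case True
    then obtain j where "j < r" "g j z \<noteq> 0" using gz by blast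
    then have "(\<Sum>j<r. (norm (g j z))\<^sup>2) > 0" by (intro sum_pos2[of _ j]) auto
    then show ?thesis unfolding gg_def sum_cnj_mult_self using kk by simp
  next
    case False
    then have "Re (ka z) > 0 \<or> Re (kb z) > 0"
      unfolding ka_def kb_def by (auto simp: not_less intro!: pos_pow_pos)
    then show ?thesis using kk gge by auto
  qed
qed

lemma nz_X: "pos_pow 3 (a z - 1/3) + pos_pow 3 (1 - a z) \<noteq> 0"
proof (rule add_neq_0_real)
  show "Re (pos_pow 3 (a z - 1/3)) > 0 \<and> Re (pos_pow 3 (1 - a z)) \<ge> 0 \<or>
    Re (pos_pow 3 (a z - 1/3)) \<ge> 0 \<and> Re (pos_pow 3 (1 - a z)) > 0"
    by (cases "Re (a z) > 1/3") (auto intro!: pos_pow_pos pos_pow_real)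
qed (rule pos_pow_real)+

lemma nz_h: "pos_pow 3 (tt z - 1) + pos_pow 3 (2 - tt z) \<noteq> 0"
proof (rule add_neq_0_real)
  show "Re (pos_pow 3 (tt z - 1)) > 0 \<and> Re (pos_pow 3 (2 - tt z)) \<ge> 0 \<or>
    Re (pos_pow 3 (tt z - 1)) \<ge> 0 \<and> Re (pos_pow 3 (2 - tt z)) > 0"
    by (cases "Re (tt z) > 1") (auto intro!: pos_pow_pos pos_pow_real)
qed (rule pos_pow_real)+

lemma nz_F: "tt z + k1 z \<noteq> 0"
proof (rule add_neq_0_real)
  have "Re (tt z) \<ge> 0" unfolding tt_eq by (simp add: sum_nonneg)
  then show "Re (tt z) > 0 \<and> Re (k1 z) \<ge> 0 \<or> Re (tt z) \<ge> 0 \<and> Re (k1 z) > 0"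
    unfolding k1_def by (cases "Re (tt z) < 1") (auto intro!: pos_pow_pos pos_pow_real)
qed (auto simp: tt_real k1_def pos_pow_real)

text \<open>\<open>uA\<close> vanishes only on axis 0, where \<open>a < 1/3\<close> keeps
  \<open>ka\<close> positive; similarly for \<open>uB\<close>, axis 1 and \<open>kb\<close>.\<close>

lemma nz_r: "uA z + ka z \<noteq> 0" "uB z + kb z \<noteq> 0"
proof -
  show "uA z + ka z \<noteq> 0"
  proof (rule add_neq_0_real)
    have *: "uA z = of_real (\<Sum>i\<in>{..<m}-{0}. (norm (z i))\<^sup>2)" unfolding uA_def sum_cnj_mult_self ..
    then show "uA z \<in> \<real>" by simp
    show "ka z \<in> \<real>" unfolding ka_def by (rule pos_pow_real)
    have kk: "Re (ka z) \<ge> 0" unfolding ka_def by (rule pos_pow_real)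
    have ge: "(\<Sum>i\<in>{..<m}-{0}. (norm (z i))\<^sup>2) \<ge> 0" by (intro sum_nonneg) auto
    show "Re (uA z) > 0 \<and> Re (ka z) \<ge> 0 \<or> Re (uA z) \<ge> 0 \<and> Re (ka z) > 0"
    proof (cases "\<forall>i<m. i \<noteq> 0 \<longrightarrow> z i = 0")
      case True
      then have "Re (ka z) > 0" unfolding ka_def using line(1)[of z] by (intro pos_pow_pos) auto
      then show ?thesis using ge * by simp
    next
      case False
      then obtain i where "i < m" "i \<noteq> 0" "z i \<noteq> 0" by blast
      then have "(\<Sum>i\<in>{..<m}-{0}. (norm (z i))\<^sup>2) > 0" by (intro sum_pos2[of _ i]) auto
      then show ?thesis using kk * by simp
    qed
  qed
  show "uB z + kb z \<noteq> 0"
  proof (rule add_neq_0_real)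
    have *: "uB z = of_real (\<Sum>i\<in>{..<m}-{1}. (norm (z i))\<^sup>2)" unfolding uB_def sum_cnj_mult_self ..
    then show "uB z \<in> \<real>" by simp
    show "kb z \<in> \<real>" unfolding kb_def by (rule pos_pow_real)
    have kk: "Re (kb z) \<ge> 0" unfolding kb_def by (rule pos_pow_real)
    have ge: "(\<Sum>i\<in>{..<m}-{1}. (norm (z i))\<^sup>2) \<ge> 0" by (intro sum_nonneg) auto
    show "Re (uB z) > 0 \<and> Re (kb z) \<ge> 0 \<or> Re (uB z) \<ge> 0 \<and> Re (kb z) > 0"
    proof (cases "\<forall>i<m. i \<noteq> 1 \<longrightarrow> z i = 0")
      case True
      then have "Re (kb z) > 0" unfolding kb_def using line(2)[of z] by (intro pos_pow_pos) auto
      then show ?thesis using ge * by simp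
    next
      case False
      then obtain i where "i < m" "i \<noteq> 1" "z i \<noteq> 0" by blast
      then have "(\<Sum>i\<in>{..<m}-{1}. (norm (z i))\<^sup>2) > 0" by (intro sum_pos2[of _ i]) auto
      then show ?thesis using kk * by simp
    qed
  qed
qed

lemma C2_tt: "C2 tt" unfolding tt_def[abs_def] by (intro C2_intros)
lemma C2_ka: "C2 ka" unfolding ka_def[abs_def] by (intro C2_intros aC)
lemma C2_kb: "C2 kb" unfolding kb_def[abs_def] by (intro C2_intros aC)
lemma C2_gg: "C2 gg" unfolding gg_def[abs_def] by (intro C2_intros gC)
lemma C2_R: "C2 R" unfolding R_def[abs_def] by (intro C2_inverse nz_R C2_add C2_gg C2_ka C2_kb)
lemma C2_sg: "C2 (sg j)" unfolding sg_def[abs_def] by (intro C2_intros gC C2_R)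
lemma C2_ee: "C2 ee" unfolding ee_def[abs_def] by (intro C2_intros C2_ka C2_kb C2_R)
lemma C2_Xden: "C2 Xden" unfolding Xden_def[abs_def] by (intro C2_inverse nz_X C2_intros aC)
lemma C2_X: "C2 X" unfolding X_def[abs_def] by (intro C2_intros C2_Xden aC)
lemma C2_hden: "C2 hden" unfolding hden_def[abs_def] by (intro C2_inverse nz_h C2_intros C2_tt)
lemma C2_h: "C2 h" unfolding h_def[abs_def] by (intro C2_intros C2_hden C2_tt)
lemma C2_uA: "C2 uA" unfolding uA_def[abs_def] by (intro C2_intros)
lemma C2_uB: "C2 uB" unfolding uB_def[abs_def] by (intro C2_intros)
lemma C2_rA: "C2 rA" unfolding rA_def[abs_def] by (intro C2_inverse nz_r C2_add C2_uA C2_ka)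
lemma C2_rB: "C2 rB" unfolding rB_def[abs_def] by (intro C2_inverse nz_r C2_add C2_uB C2_kb)
lemma C2_sA: "C2 (sA i)" unfolding sA_def[abs_def] by (cases "i = 0") (auto intro!: C2_intros C2_rA)
lemma C2_sB: "C2 (sB i)" unfolding sB_def[abs_def] by (cases "i = 1") (auto intro!: C2_intros C2_rB)
lemma C2_S: "C2 (S j)" unfolding S_def[abs_def] by (intro C2_intros C2_h C2_sg)
lemma C2_P: "C2 (P j i)" unfolding P_def[abs_def] by (intro C2_intros C2_X GC)
lemma C2_T': "C2 (T' i)" unfolding T'_def[abs_def] by (intro C2_intros C2_S C2_P C2_h C2_ee C2_sA C2_sB C2_X)
lemma C2_k1: "C2 k1" unfolding k1_def[abs_def] by (intro C2_intros C2_tt)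
lemma C2_F: "C2 F" unfolding F_def[abs_def] by (intro C2_inverse nz_F C2_add C2_tt C2_k1)
lemma C2_\<phi>: "C2 (\<phi> i)" unfolding \<phi>_def[abs_def] by (intro C2_intros C2_h C2_F)

lemmas C2_local = C2_tt C2_ka C2_kb C2_gg C2_R C2_sg C2_ee C2_Xden C2_X C2_hden C2_h C2_uA C2_uB C2_rA C2_rB
  C2_sA C2_sB C2_S C2_P C2_T' C2_k1 C2_F C2_\<phi> aC gC GC

lemma flat_ka: "Re (a z) \<ge> 1/3 \<Longrightarrow> flat ka z"
  unfolding ka_def[abs_def] by (rule flat_pos_pow) (auto intro!: C2_intros aC Reals_diff ar)
lemma flat_kb: "Re (b z) \<ge> 1/3 \<Longrightarrow> flat kb z"
  unfolding kb_def[abs_def] by (rule flat_pos_pow) (auto intro!: C2_intros aC Reals_diff ar)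
lemma flat_k1: "Re (tt z) \<ge> 1 \<Longrightarrow> flat k1 z"
  unfolding k1_def[abs_def] by (rule flat_pos_pow) (auto intro!: C2_intros C2_tt Reals_diff tt_real)
lemma flat_X: "Re (a z) \<le> 1/3 \<Longrightarrow> flat X z"
  unfolding X_def[abs_def]
  by (intro flat_mult1 flat_pos_pow C2_local C2_intros) (auto intro!: Reals_diff ar)
lemma flat_h: "Re (tt z) \<le> 1 \<Longrightarrow> flat h z"
  unfolding h_def[abs_def]
  by (intro flat_mult1 flat_pos_pow C2_local C2_intros) (auto intro!: Reals_diff tt_real)

lemma X_compl: "1 - X z = pos_pow 3 (1 - a z) * Xden z"
  using nz_X[of z] unfolding X_def Xden_def by (simp add: field_simps)

lemma h_compl: "1 - h z = pos_pow 3 (2 - tt z) * hden z"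
  using nz_h[of z] unfolding h_def hden_def by (simp add: field_simps)

lemma flat_1X: "Re (a z) \<ge> 1 \<Longrightarrow> flat (\<lambda>z. 1 - X z) z"
  unfolding X_compl
  by (intro flat_mult1 flat_pos_pow C2_local C2_intros) (auto intro!: Reals_diff ar)

lemma sep_tt: "Re (tt z) \<ge> 1 \<Longrightarrow> Re (a z) \<ge> 1 \<or> Re (b z) \<ge> 1"
  using sep[of z] unfolding tt_eq by simp

section \<open>The two determinants and the contradiction\<close>

text \<open>Row 0 vanishes in the unit ball (through \<open>h\<close>), row 1 near the first cone
  (\<open>X = 0\<close>), row 0 near the second one (\<open>X = 1\<close>). Away from both cones the
  rank is at most \<open>r + 1\<close>, which is less than \<open>m\<close>.\<close>

lemma det_T'_zero: "ldet m (\<lambda>i l. dbar (T' i) l z) = 0"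
proof -
  consider "Re (tt z) \<le> 1" | "Re (a z) \<le> 1/3" | "Re (tt z) \<ge> 1" "Re (b z) \<le> 1/3"
    | "Re (a z) \<ge> 1/3" "Re (b z) \<ge> 1/3"
    by linarith
  then show ?thesis
  proof cases
    case 1
    have "T' 0 = (\<lambda>z. h z * ((\<Sum>j<r. sg j z * P j 0 z) + ee z * (sB 0 z + X z * (sA 0 z - sB 0 z))))"
      by (simp add: T'_def fun_eq_iff S_def sum_distrib_left algebra_simps)
    moreover have "flat \<dots> z"
      by (intro flat_mult1 flat_h 1 C2_local C2_intros)
    ultimately show ?thesis using rm by (intro ldet_zero_row[of 0]) (auto simp: flatD)
  next
    case 2
    have "T' 1 = (\<lambda>z. X z * ((\<Sum>j<r. S j z * GA j 1 z) + h z * ee z * sA 1 z))"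
      by (simp add: T'_def fun_eq_iff P_def G0(2)[unfolded One_nat_def] sB_def sum_distrib_left algebra_simps)
    moreover have "flat \<dots> z"
      by (intro flat_mult1 flat_X 2 C2_local C2_intros)
    ultimately show ?thesis using rm by (intro ldet_zero_row[of 1]) (auto simp: flatD)
  next
    case 3
    \<comment> \<open>Smallness of \<open>b\<close> forces \<open>X = 1\<close> only outside the
      unit ball, since separation holds only there; the inside belongs to the first case.\<close>
    then have a1: "Re (a z) \<ge> 1" using sep_tt[of z] by auto
    have "T' 0 = (\<lambda>z. (1 - X z) * ((\<Sum>j<r. S j z * GB j 0 z) + h z * ee z * sB 0 z))"
      by (simp add: T'_def fun_eq_iff P_def G0 sA_def sum_distrib_left algebra_simps sum_subtractf)
    moreover have "flat \<dots> z"
      by (intro flat_mult1 flat_1X a1 C2_local C2_intros)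
    ultimately show ?thesis using rm by (intro ldet_zero_row[of 0]) (auto simp: flatD)
  next
    case 4
    have fe: "flat ee z"
      unfolding ee_def[abs_def] by (intro flat_mult1 flat_add flat_ka flat_kb 4 C2_local C2_intros)
    \<comment> \<open>Only \<open>S j\<close> and \<open>X\<close> are nonholomorphic here, so all
      rows are combinations of their \<open>r + 1\<close> differentials. Column \<open>r\<close> of
      \<open>B\<close> collects what the product rule yields from the factor \<open>X\<close> inside
      \<open>P j i\<close>.\<close>
    define B where "B i j = (if j < r then P j i z else (\<Sum>j<r. S j z * (GA j i z - GB j i z)))" for i j
    define D where "D j l = (if j < r then dbar (S j) l z else dbar X l z)" for j l
    show ?thesis
    proof (rule ldet_low_rank[where r="Suc r"])
      show "Suc r < m" using rm by simp
      fix i l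
      have "flat (\<lambda>z. h z * ee z * (sB i z + X z * (sA i z - sB i z))) z"
        by (intro flat_mult1 flat_mult2[where g=ee] fe C2_local C2_intros)
      then have "dbar (T' i) l z = (\<Sum>j<r. dbar (\<lambda>z. S j z * P j i z) l z)"
        unfolding T'_def[abs_def]
        by (subst dbar_sum[symmetric], intro C2_C1 C2_local C2_intros, subst dbar_add)
           (auto simp: flatD intro!: C2_C1 C2_local C2_intros)
      also have "\<dots> = (\<Sum>j<r. P j i z * dbar (S j) l z + S j z * (GA j i z - GB j i z) * dbar X l z)"
      proof (rule sum.cong[OF refl])
        fix j
        have "dbar (\<lambda>z. S j z * P j i z) l z = S j z * dbar (P j i) l z + dbar (S j) l z * P j i z"
          by (intro dbar_mult C2_C1 C2_local)
        moreover have "dbar (P j i) l z = dbar X l z * (GA j i z - GB j i z)"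
          unfolding P_def[abs_def]
          by (simp add: dbar_add dbar_mult dbar_diff Gd C2_C1 C2_local C2_diff C2_mult)
        ultimately show "dbar (\<lambda>z. S j z * P j i z) l z =
           P j i z * dbar (S j) l z + S j z * (GA j i z - GB j i z) * dbar X l z"
          by (simp add: algebra_simps)
      qed
      also have "\<dots> = (\<Sum>j<Suc r. B i j * D j l)"
        by (simp add: B_def D_def sum.distrib sum_distrib_right)
      finally show "dbar (T' i) l z = (\<Sum>j<Suc r. B i j * D j l)" .
    qed
  qed
qed

text \<open>An exact identity. The error terms are grouped so that outside the unit ball each
  contains a flat factor: \<open>(1 - X z) * kb z\<close>, \<open>X z * ka z\<close> or
  \<open>k1 z\<close>.\<close>

lemma pairing_T: "(\<Sum>i<m. z i * (T' i z + \<phi> i z)) = 1 -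
   (h z * ee z * (((1 - X z) * kb z) * rB z + (X z * ka z) * rA z) + (1 - h z) * (k1 z * F z))"
proof -
  have m: "0 < m" "1 < m" using rm by auto
  have g: "(\<Sum>i<m. z i * P j i z) = g j z" if "j < r" for j
  proof -
    have "(\<Sum>i<m. z i * P j i z) = (\<Sum>i<m. GB j i z * z i) + X z * ((\<Sum>i<m. GA j i z * z i) - (\<Sum>i<m. GB j i z * z i))"
      by (simp add: P_def sum.distrib sum_distrib_left sum_subtractf algebra_simps)
    then show ?thesis using gG[OF that, of z] by simp
  qed
  have A: "(\<Sum>i<m. z i * sA i z) = uA z * rA z"
  proof -
    have "(\<Sum>i<m. z i * sA i z) = (\<Sum>i\<in>{..<m}-{0}. z i * sA i z)"
      using m by (simp add: sum.remove[of "{..<m}" 0] sA_def)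
    also have "\<dots> = (\<Sum>i\<in>{..<m}-{0}. cnj (z i) * z i * rA z)"
      by (intro sum.cong) (auto simp: sA_def)
    finally show ?thesis by (simp add: uA_def sum_distrib_right)
  qed
  have B: "(\<Sum>i<m. z i * sB i z) = uB z * rB z"
  proof -
    have "(\<Sum>i<m. z i * sB i z) = (\<Sum>i\<in>{..<m}-{1}. z i * sB i z)"
      using m by (simp add: sum.remove[of "{..<m}" 1] sB_def)
    also have "\<dots> = (\<Sum>i\<in>{..<m}-{1}. cnj (z i) * z i * rB z)"
      by (intro sum.cong) (auto simp: sB_def)
    finally show ?thesis by (simp add: uB_def sum_distrib_right)
  qed
  have A': "uA z * rA z = 1 - ka z * rA z" and B': "uB z * rB z = 1 - kb z * rB z"
    using nz_r[of z] unfolding rA_def rB_def by (simp_all add: field_simps)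
  have F': "tt z * F z = 1 - k1 z * F z"
    using nz_F[of z] unfolding F_def by (simp add: field_simps)
  have E: "gg z * R z = 1 - ee z"
    using nz_R[of z] unfolding R_def ee_def by (simp add: field_simps)
  have "(\<Sum>i<m. z i * T' i z) =
     (\<Sum>j<r. S j z * (\<Sum>i<m. z i * P j i z)) +
     h z * ee z * ((\<Sum>i<m. z i * sB i z) + X z * ((\<Sum>i<m. z i * sA i z) - (\<Sum>i<m. z i * sB i z)))"
  proof -
    have "(\<Sum>i<m. z i * (\<Sum>j<r. S j z * P j i z)) = (\<Sum>j<r. S j z * (\<Sum>i<m. z i * P j i z))"
      unfolding sum_distrib_left by (subst sum.swap) (simp add: mult.left_commute)
    then show ?thesis
      by (simp add: T'_def sum.distrib sum_distrib_left sum_subtractf algebra_simps)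
  qed
  also have "(\<Sum>j<r. S j z * (\<Sum>i<m. z i * P j i z)) = h z * (gg z * R z)"
    by (simp add: g S_def sg_def gg_def sum_distrib_left sum_distrib_right mult_ac)
  finally have T: "(\<Sum>i<m. z i * T' i z) = h z * (1 - ee z) +
     h z * ee z * ((1 - kb z * rB z) + X z * ((1 - ka z * rA z) - (1 - kb z * rB z)))"
    unfolding A B A' B' E .
  have "(\<Sum>i<m. z i * \<phi> i z) = (1 - h z) * (tt z * F z)"
    by (simp add: \<phi>_def tt_def sum_distrib_left sum_distrib_right mult_ac)
  then have "(\<Sum>i<m. z i * (T' i z + \<phi> i z)) = h z * (1 - ee z) +
     h z * ee z * ((1 - kb z * rB z) + X z * ((1 - ka z * rA z) - (1 - kb z * rB z))) + (1 - h z) * (1 - k1 z * F z)"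
    by (simp add: distrib_left sum.distrib T F')
  then show ?thesis by (simp add: algebra_simps)
qed

lemma det_T_outside:
  assumes t: "Re (tt z) \<ge> 1"
  shows "ldet m (\<lambda>i l. dbar (\<lambda>z. T' i z + \<phi> i z) l z) = 0"
proof -
  define err where "err z = h z * ee z * (((1 - X z) * kb z) * rB z + (X z * ka z) * rA z) + (1 - h z) * (k1 z * F z)" for z
  \<comment> \<open>Where \<open>kb\<close> is not flat, \<open>b < 1/3\<close>; separation then
    gives \<open>a >= 1\<close>, so that \<open>1 - X\<close> is flat instead.\<close>
  have f1: "flat (\<lambda>z. (1 - X z) * kb z) z"
  proof (cases "Re (b z) \<ge> 1/3")
    case True then show ?thesis by (intro flat_mult2 flat_kb C2_local C2_intros)
  next
    case False
    then have "Re (a z) \<ge> 1" using sep_tt[OF t] by auto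
    then show ?thesis by (intro flat_mult1 flat_1X C2_local C2_intros)
  qed
  have f2: "flat (\<lambda>z. X z * ka z) z"
  proof (cases "Re (a z) \<ge> 1/3")
    case True then show ?thesis by (intro flat_mult2 flat_ka C2_local)
  next
    case False then show ?thesis by (intro flat_mult1 flat_X C2_local) auto
  qed
  have fl: "flat err z"
    unfolding err_def[abs_def]
    by (intro flat_add flat_mult2[where f="\<lambda>z. h z * ee z"] flat_mult2[where f="\<lambda>z. 1 - h z"]
        flat_mult1[where f="\<lambda>z. (1 - X z) * kb z"] flat_mult1[where f="\<lambda>z. X z * ka z"] flat_mult1[where f=k1]
        f1 f2 flat_k1 t C2_local C2_intros)
  have Ce: "C2 err" unfolding err_def[abs_def] by (intro C2_local C2_intros)
  have CT: "C2 (\<lambda>z. T' i z + \<phi> i z)" for i by (intro C2_local C2_intros)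
  have "\<exists>i<m. z i \<noteq> 0"
  proof (rule ccontr)
    assume "\<not> ?thesis"
    then have "tt z = 0" unfolding tt_def by simp
    then show False using t by simp
  qed
  then obtain i where i: "i < m" "z i \<noteq> 0" by blast
  show ?thesis
  proof (rule ldet_left_kernel[where x=z, OF i])
    fix l
    have "(\<Sum>k<m. z k * dbar (\<lambda>z. T' k z + \<phi> k z) l z) = (\<Sum>k<m. dbar (\<lambda>z. z k * (T' k z + \<phi> k z)) l z)"
      by (simp add: dbar_mult[OF C1_coord(1) C2_C1[OF CT]] dbar_coord)
    also have "\<dots> = dbar (\<lambda>z. \<Sum>k<m. z k * (T' k z + \<phi> k z)) l z"
      by (rule dbar_sum[symmetric]) (intro C2_C1 C2_mult C2_coord CT)
    also have "(\<lambda>z. \<Sum>k<m. z k * (T' k z + \<phi> k z)) = (\<lambda>z. 1 - err z)"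
      unfolding pairing_T err_def ..
    also have "dbar (\<lambda>z. 1 - err z) l z = 0"
      by (simp add: dbar_diff C1_const C2_C1 Ce dbar_const flatD[OF fl])
    finally show "(\<Sum>k<m. z k * dbar (\<lambda>z. T' k z + \<phi> k z) l z) = 0" .
  qed
qed

text \<open>With \<open>c = 3 * pos_pow 2 (1 - tt z)\<close>, the rank-one formula gives
  \<open>F ^ m + F ^ (m + 1) * tt * (c - 1)\<close>. Writing \<open>F ^ m\<close> as
  \<open>F ^ (m + 1) * (tt + k1)\<close> cancels \<open>tt\<close> and leaves this visibly
  nonnegative form.\<close>

definition "dens z = F z ^ (m + 1) * (k1 z + 3 * tt z * pos_pow 2 (1 - tt z))"

lemma dbar_tt: "l < m \<Longrightarrow> dbar tt l z = z l"
proof -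
  assume l: "l < m"
  have "dbar tt l z = (\<Sum>i<m. (if l = i then 1 else 0) * z i)"
    unfolding tt_def[abs_def]
    by (subst dbar_sum) (auto intro!: C2_C1 C2_intros sum.cong
        simp: dbar_mult[OF C2_C1[OF C2_cnj[OF C2_coord]] C1_coord(1)] dbar_coord dbar_cnj_coord)
  also have "\<dots> = z l" using l by (simp add: if_distrib[where f="\<lambda>c. c * _"] cong: if_cong)
  finally show ?thesis .
qed

text \<open>In the unit ball \<open>h\<close> is flat, so \<open>T'\<close> contributes nothing and
  \<open>\<phi> i\<close> has the derivatives of \<open>cnj (z i) * F z\<close>. As \<open>F\<close>
  depends only on \<open>tt\<close>, the matrix is scalar plus rank one.\<close>

lemma det_T_inside:
  assumes t: "Re (tt z) \<le> 1"
  shows "ldet m (\<lambda>i l. dbar (\<lambda>z. T' i z + \<phi> i z) l z) = dens z"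
proof -
  have fh: "flat h z" by (rule flat_h[OF t])
  have m: "m \<ge> 1" using rm by simp
  \<comment> \<open>Minus the derivative of \<open>k1\<close> with respect to
    \<open>tt\<close>.\<close>
  define c where "c = 3 * pos_pow 2 (1 - tt z)"
  have dk: "dbar k1 l z = - c * z l" if "l < m" for l
    unfolding k1_def[abs_def]
    by (subst dbar_pos_pow)
       (auto intro!: C2_C1 C2_local C2_intros Reals_diff tt_real simp: c_def dbar_diff C1_const C2_C1 C2_tt dbar_const dbar_tt that)
  have dF: "dbar F l z = z l * ((c - 1) * (F z)\<^sup>2)" if "l < m" for l
  proof -
    have "dbar F l z = - dbar (\<lambda>z. tt z + k1 z) l z * (F z)\<^sup>2"
      unfolding F_def[abs_def] by (intro dbar_inverse C2_C1 C2_add C2_local nz_F)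
    also have "dbar (\<lambda>z. tt z + k1 z) l z = z l - c * z l"
      by (simp add: dbar_add C2_C1 C2_local dbar_tt dk that)
    finally show ?thesis by (simp add: algebra_simps)
  qed
  have dT: "dbar (T' i) l z = 0" for i l
  proof -
    have "T' i = (\<lambda>z. h z * ((\<Sum>j<r. sg j z * P j i z) + ee z * (sB i z + X z * (sA i z - sB i z))))"
      by (simp add: T'_def fun_eq_iff S_def sum_distrib_left algebra_simps)
    moreover have "flat \<dots> z"
      by (intro flat_mult1 fh C2_local C2_intros)
    ultimately show ?thesis by (auto simp: flatD)
  qed
  have d\<phi>: "dbar (\<phi> i) l z = (if i = l then F z else 0) + cnj (z i) * (z l * ((c - 1) * (F z)\<^sup>2))" if "l < m" for i l
  proof -
    have "dbar (\<phi> i) l z = (1 - h z) * dbar (\<lambda>z. cnj (z i) * F z) l z + dbar (\<lambda>z. 1 - h z) l z * (cnj (z i) * F z)"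
      unfolding \<phi>_def[abs_def] by (intro dbar_mult C2_C1 C2_local C2_intros)
    also have "dbar (\<lambda>z. 1 - h z) l z = 0"
      by (simp add: dbar_diff C1_const C2_C1 C2_local dbar_const flatD[OF fh])
    also have "dbar (\<lambda>z. cnj (z i) * F z) l z = cnj (z i) * dbar F l z + dbar (\<lambda>z. cnj (z i)) l z * F z"
      by (intro dbar_mult C2_C1 C2_local C2_intros)
    finally show ?thesis by (simp add: flatD[OF fh] dF that dbar_cnj_coord algebra_simps)
  qed
  have "ldet m (\<lambda>i l. dbar (\<lambda>z. T' i z + \<phi> i z) l z) =
     ldet m (\<lambda>i l. (if i = l then F z else 0) + cnj (z i) * (z l * ((c - 1) * (F z)\<^sup>2)))"
    unfolding ldet_def
  proof (intro sum.cong refl arg_cong2[where f="(*)"] prod.cong)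
    fix p i assume "p \<in> {p. p permutes {..<m}}" "i \<in> {..<m}"
    then have "p i < m" using permutes_in_image[of p "{..<m}" i] by auto
    then show "dbar (\<lambda>z. T' i z + \<phi> i z) (p i) z =
      (if i = p i then F z else 0) + cnj (z i) * (z (p i) * ((c - 1) * (F z)\<^sup>2))"
      by (simp add: dbar_add C2_C1 C2_local dT d\<phi>)
  qed
  also have "\<dots> = F z ^ m + F z ^ (m - 1) * (\<Sum>i<m. cnj (z i) * (z i * ((c - 1) * (F z)\<^sup>2)))"
    by (rule ldet_rank_one_perturbation)
  also have "(\<Sum>i<m. cnj (z i) * (z i * ((c - 1) * (F z)\<^sup>2))) = tt z * (c - 1) * (F z)\<^sup>2"
    by (simp add: tt_def sum_distrib_left sum_distrib_right mult_ac)
  also have "F z ^ (m - 1) * (tt z * (c - 1) * (F z)\<^sup>2) = F z ^ (m + 1) * (tt z * (c - 1))"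
  proof -
    have "m + 1 = (m - 1) + 2" using m by simp
    then show ?thesis by (simp only: power_add mult_ac)
  qed
  also have "F z ^ m = F z ^ (m + 1) * (tt z + k1 z)"
    using nz_F[of z] unfolding F_def by simp
  finally show ?thesis
    by (simp add: dens_def c_def algebra_simps)
qed

lemma det_T: "ldet m (\<lambda>i l. dbar (\<lambda>z. T' i z + \<phi> i z) l z) = dens z"
proof (cases "Re (tt z) \<le> 1")
  case False
  then have "dens z = 0" by (simp add: dens_def k1_def pos_pow_def max_def)
  then show ?thesis using det_T_outside[of z] False by simp
qed (rule det_T_inside)

lemma dens_real:
  obtains d where "dens z = of_real d" "d \<ge> 0" "Re (tt z) < 1 \<Longrightarrow> d > 0"
proof -
  define t where "t = (\<Sum>i<m. (norm (z i))\<^sup>2)"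
  have t: "tt z = of_real t" "t \<ge> 0" unfolding t_def tt_eq by (auto intro: sum_nonneg)
  define d where "d = inverse (t + max 0 (1 - t) ^ 3) ^ (m + 1) * (max 0 (1 - t) ^ 3 + 3 * t * max 0 (1 - t) ^ 2)"
  have pos: "t + max 0 (1 - t) ^ 3 > 0"
    using t(2) by (cases "t < 1") (auto simp: max_def intro: add_nonneg_pos)
  show ?thesis
  proof
    show "dens z = of_real d"
      unfolding dens_def F_def k1_def pos_pow_def t(1) d_def by simp
    show "d \<ge> 0" unfolding d_def using pos t(2) by (intro mult_nonneg_nonneg zero_le_power) auto
    show "d > 0" if "Re (tt z) < 1"
    proof -
      have "max 0 (1 - t) ^ 3 + 3 * t * max 0 (1 - t) ^ 2 > 0"
        using t that by (intro add_pos_nonneg) auto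
      then show ?thesis
        unfolding d_def using pos by (intro mult_pos_pos zero_less_power positive_imp_inverse_positive)
    qed
  qed
qed

lemma supp_box_\<phi>: "supp_box m 2 (\<phi> i)"
  unfolding supp_box_def
proof (intro allI impI)
  fix z :: pt and l assume l: "l < m" "norm (z l) > 2"
  have "(norm (z l))\<^sup>2 \<le> (\<Sum>i<m. (norm (z i))\<^sup>2)"
    using l by (intro member_le_sum) auto
  moreover have "(norm (z l))\<^sup>2 \<ge> 2\<^sup>2" using l by (intro power_mono) auto
  ultimately have "Re (tt z) \<ge> 2" unfolding tt_eq by simp
  then have "1 - h z = 0" unfolding h_compl by (simp add: pos_pow_def max_def)
  then show "\<phi> i z = 0" unfolding \<phi>_def by simp
qed

lemma contradiction: False
proof -
  have int: "integral\<^sup>L (lebC m) dens = 0"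
    using integral_ldet_dbar_perturb[where \<tau>=T' and \<phi>=\<phi> and m=m and R=2] C2_local supp_box_\<phi>
    by (simp add: det_T det_T'_zero)
  have re: "dens z = of_real (Re (dens z))" "Re (dens z) \<ge> 0" for z
    by (rule dens_real[of z]; simp)+
  have cont: "continuous_on UNIV dens"
  proof -
    have "continuous_on UNIV (\<lambda>z. F z ^ (m + 1) * (k1 z + 3 * tt z * pos_pow 2 (1 - tt z)))"
      by (intro continuous_on_mult continuous_on_power continuous_on_add continuous_on_pos_pow
         continuous_on_diff continuous_on_const C1_cont[OF C2_C1[OF C2_F]]
         C1_cont[OF C2_C1[OF C2_tt]] C1_cont[OF C2_C1[OF C2_k1]])
    then show ?thesis unfolding dens_def[abs_def] .
  qed
  have "supp_box m 2 dens"
    unfolding supp_box_def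
  proof (intro allI impI)
    fix z :: pt and l assume l: "l < m" "norm (z l) > 2"
    have "(norm (z l))\<^sup>2 \<le> (\<Sum>i<m. (norm (z i))\<^sup>2)"
      using l by (intro member_le_sum) auto
    moreover have "(norm (z l))\<^sup>2 \<ge> 2\<^sup>2" using l by (intro power_mono) auto
    ultimately have "Re (tt z) \<ge> 2" unfolding tt_eq by simp
    then show "dens z = 0" by (simp add: dens_def k1_def pos_pow_def max_def)
  qed
  then have I: "integrable (lebC m) dens" by (rule integrable_lebC[OF cont])
  then have I': "integrable (lebC m) (\<lambda>z. Re (dens z))" by (rule integrable_Re)
  have "integral\<^sup>L (lebC m) (\<lambda>z. Re (dens z)) = 0"
    using integral_Re[OF I] int by simp
  then have "AE z in lebC m. Re (dens z) = 0"
    using integral_nonneg_eq_0_iff_AE[OF I'] re(2) by simp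
  \<comment> \<open>The polydisc of this radius lies in the unit ball: as \<epsilon> is at most 1,
    the sum of squares is at most \<open>m * \<epsilon> < 1\<close>. It has positive measure, and
    the density is positive on it.\<close>
  define \<epsilon> where "\<epsilon> = 1 / (real m + 1)"
  have eps: "\<epsilon> > 0" by (simp add: \<epsilon>_def)
  define Bx where "Bx = PiE {..<m} (\<lambda>_. ball (0::complex) \<epsilon>)"
  have pos: "Re (dens z) > 0" if "z \<in> Bx" for z
  proof -
    have "(\<Sum>i<m. (norm (z i))\<^sup>2) \<le> (\<Sum>i<m. \<epsilon>)"
    proof (intro sum_mono)
      fix i assume "i \<in> {..<m}"
      then have n: "norm (z i) < \<epsilon>" using that by (auto simp: Bx_def PiE_def Pi_def)
      moreover have "\<epsilon> \<le> 1" by (simp add: \<epsilon>_def)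
      ultimately have "norm (z i) * norm (z i) \<le> \<epsilon> * 1" using eps by (intro mult_mono) auto
      then show "(norm (z i))\<^sup>2 \<le> \<epsilon>" by (simp add: power2_eq_square)
    qed
    also have "\<dots> < 1" by (simp add: \<epsilon>_def)
    finally have "Re (tt z) < 1" unfolding tt_eq by simp
    then show ?thesis by (rule_tac dens_real[of z]) auto
  qed
  have "AE z in lebC m. z \<notin> Bx"
    using \<open>AE z in lebC m. Re (dens z) = 0\<close> by eventually_elim (use pos in force)
  moreover have Bs: "Bx \<in> sets (lebC m)" unfolding Bx_def by (intro sets_PiM_I_finite) auto
  ultimately have "emeasure (lebC m) Bx = 0"
    using AE_iff_null_sets[OF Bs] by (simp add: null_sets_def)
  moreover have "emeasure (lebC m) Bx = (\<Prod>i<m. emeasure lborel (ball (0::complex) \<epsilon>))"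
    unfolding Bx_def by (intro emeasure_lebC_box) auto
  moreover have "emeasure lborel (ball (0::complex) \<epsilon>) > 0"
    using eps by (simp add: emeasure_ball)
  ultimately show False by (simp add: prod_zero_iff)
qed

end

section \<open>Zero sets of few polynomials\<close>

inductive_set poly_fun :: "nat \<Rightarrow> (pt \<Rightarrow> complex) set" for m where
  poly_fun_const: "(\<lambda>z. c) \<in> poly_fun m"
| poly_fun_coord: "i < m \<Longrightarrow> (\<lambda>z. z i) \<in> poly_fun m"
| poly_fun_add: "f \<in> poly_fun m \<Longrightarrow> g \<in> poly_fun m \<Longrightarrow> (\<lambda>z. f z + g z) \<in> poly_fun m"
| poly_fun_mult: "f \<in> poly_fun m \<Longrightarrow> g \<in> poly_fun m \<Longrightarrow> (\<lambda>z. f z * g z) \<in> poly_fun m"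

lemma poly_fun_C2: "f \<in> poly_fun m \<Longrightarrow> C2 f"
  by (induction rule: poly_fun.induct) (auto intro: C2_intros)

lemma poly_fun_dbar: "f \<in> poly_fun m \<Longrightarrow> dbar f l z = 0"
  by (induction rule: poly_fun.induct) (auto simp: dbar_const dbar_coord dbar_add dbar_mult C2_C1 poly_fun_C2)

lemma poly_fun_cong: "f \<in> poly_fun m \<Longrightarrow> (\<And>i. i < m \<Longrightarrow> z i = w i) \<Longrightarrow> f z = f w"
  by (induction rule: poly_fun.induct) auto

lemma poly_fun_subst:
  assumes "f \<in> poly_fun n" "\<And>i. i < n \<Longrightarrow> X i \<in> poly_fun m"
  shows "(\<lambda>z. f (\<lambda>i. X i z)) \<in> poly_fun m"
  using assms(1)
proof (induction rule: poly_fun.induct)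
  case (poly_fun_coord i) then show ?case using assms(2)[of i] by simp
qed (auto intro: poly_fun.intros)

lemma poly_fun_diff: "f \<in> poly_fun m \<Longrightarrow> g \<in> poly_fun m \<Longrightarrow> (\<lambda>z. f z - g z) \<in> poly_fun m"
  using poly_fun_add[OF _ poly_fun_mult[OF poly_fun_const[of "-1"]], of f m g] by simp

lemma poly_fun_sum: "(\<And>i. i \<in> I \<Longrightarrow> f i \<in> poly_fun m) \<Longrightarrow> (\<lambda>z. \<Sum>i\<in>I. f i z) \<in> poly_fun m"
  by (induction I rule: infinite_finite_induct) (auto intro: poly_fun.intros)

lemma poly_fun_prod: "(\<And>i. i \<in> I \<Longrightarrow> f i \<in> poly_fun m) \<Longrightarrow> (\<lambda>z. \<Prod>i\<in>I. f i z) \<in> poly_fun m"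
  by (induction I rule: infinite_finite_induct) (auto intro: poly_fun.intros)

lemma poly_fun_power: "f \<in> poly_fun m \<Longrightarrow> (\<lambda>z. f z ^ k) \<in> poly_fun m"
  by (induction k) (auto intro: poly_fun.intros)

definition axis :: "nat \<Rightarrow> pt \<Rightarrow> pt" where
  "axis i0 z = (\<lambda>i. if i = i0 then z i else 0)"

lemma poly_fun_axis: "i0 < m \<Longrightarrow> f \<in> poly_fun m \<Longrightarrow> (\<lambda>z. f (axis i0 z)) \<in> poly_fun m"
  unfolding axis_def
proof (rule poly_fun_subst[of f m "\<lambda>i z. if i = i0 then z i else 0"])
  show "(\<lambda>z. if i = i0 then z i else 0) \<in> poly_fun m" if "i < m" for i
    using that by (cases "i = i0") (auto intro: poly_fun.intros)
qed

text \<open>The difference between a polynomial and its restriction to a coordinate axis lies in the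
  ideal of the other coordinates.\<close>

lemma poly_fun_decomp:
  assumes "f \<in> poly_fun m" "i0 < m"
  shows "\<exists>G. (\<forall>i. G i \<in> poly_fun m) \<and> (\<forall>z. G i0 z = 0) \<and> (\<forall>z. f z = f (axis i0 z) + (\<Sum>i<m. G i z * z i))"
  using assms(1)
proof (induction rule: poly_fun.induct)
  case (poly_fun_const c)
  show ?case by (rule exI[of _ "\<lambda>i z. 0"]) (auto intro: poly_fun.intros)
next
  case (poly_fun_coord k)
  show ?case
  proof (cases "k = i0")
    case True
    then show ?thesis by (intro exI[of _ "\<lambda>i z. 0"]) (auto intro: poly_fun.intros simp: axis_def)
  next
    case False
    have "(\<Sum>i<m. (if i = k then 1 else 0) * z i) = z k" for z :: pt
      using poly_fun_coord by (simp add: if_distrib[where f="\<lambda>c. c * _"] cong: if_cong)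
    moreover have "(\<lambda>z. if i = k then 1 else 0) \<in> poly_fun m" for i by (rule poly_fun.poly_fun_const)
    ultimately show ?thesis
      using False by (intro exI[of _ "\<lambda>i z. if i = k then 1 else 0"]) (simp add: axis_def)
  qed
next
  case (poly_fun_add f g)
  from \<open>\<exists>G. (\<forall>i. G i \<in> poly_fun m) \<and> (\<forall>z. G i0 z = 0) \<and> (\<forall>z. f z = f (axis i0 z) + (\<Sum>i<m. G i z * z i))\<close> obtain G where
    G: "\<And>i. G i \<in> poly_fun m" "\<And>z. G i0 z = 0" "\<And>z. f z = f (axis i0 z) + (\<Sum>i<m. G i z * z i)"
    by blast
  from \<open>\<exists>G. (\<forall>i. G i \<in> poly_fun m) \<and> (\<forall>z. G i0 z = 0) \<and> (\<forall>z. g z = g (axis i0 z) + (\<Sum>i<m. G i z * z i))\<close> obtain H where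
    H: "\<And>i. H i \<in> poly_fun m" "\<And>z. H i0 z = 0" "\<And>z. g z = g (axis i0 z) + (\<Sum>i<m. H i z * z i)"
    by blast
  show ?case
  proof (intro exI[of _ "\<lambda>i z. G i z + H i z"] conjI allI)
    show "f z + g z = f (axis i0 z) + g (axis i0 z) + (\<Sum>i<m. (G i z + H i z) * z i)" for z
    proof -
      have "(\<Sum>i<m. (G i z + H i z) * z i) = (\<Sum>i<m. G i z * z i) + (\<Sum>i<m. H i z * z i)"
        by (simp add: sum.distrib distrib_right)
      then show ?thesis using G(3)[of z] H(3)[of z] by (simp only: ac_simps)
    qed
  qed (use G(1,2) H(1,2) in \<open>auto intro: poly_fun.intros\<close>)
next
  case (poly_fun_mult f g)
  from \<open>\<exists>G. (\<forall>i. G i \<in> poly_fun m) \<and> (\<forall>z. G i0 z = 0) \<and> (\<forall>z. f z = f (axis i0 z) + (\<Sum>i<m. G i z * z i))\<close> obtain G where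
    G: "\<And>i. G i \<in> poly_fun m" "\<And>z. G i0 z = 0" "\<And>z. f z = f (axis i0 z) + (\<Sum>i<m. G i z * z i)"
    by blast
  from \<open>\<exists>G. (\<forall>i. G i \<in> poly_fun m) \<and> (\<forall>z. G i0 z = 0) \<and> (\<forall>z. g z = g (axis i0 z) + (\<Sum>i<m. G i z * z i))\<close> obtain H where
    H: "\<And>i. H i \<in> poly_fun m" "\<And>z. H i0 z = 0" "\<And>z. g z = g (axis i0 z) + (\<Sum>i<m. H i z * z i)"
    by blast
  show ?case
  \<comment> \<open>With f0, g0 the restrictions to the axis: f g - f0 g0 = (f - f0) g + f0 (g -
    g0).\<close>
  proof (intro exI[of _ "\<lambda>i z. G i z * g z + f (axis i0 z) * H i z"] conjI allI)
    show "f z * g z = f (axis i0 z) * g (axis i0 z) + (\<Sum>i<m. (G i z * g z + f (axis i0 z) * H i z) * z i)" for z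
    proof -
      have "(\<Sum>i<m. (G i z * g z + f (axis i0 z) * H i z) * z i) =
         (\<Sum>i<m. G i z * z i) * g z + f (axis i0 z) * (\<Sum>i<m. H i z * z i)"
        by (simp add: sum.distrib sum_distrib_left sum_distrib_right algebra_simps)
      also have "\<dots> = (f z - f (axis i0 z)) * g z + f (axis i0 z) * (g z - g (axis i0 z))"
        using G(3)[of z] H(3)[of z] by simp
      finally show ?thesis by (simp add: algebra_simps)
    qed
    show "(\<lambda>z. G i z * g z + f (axis i0 z) * H i z) \<in> poly_fun m" for i
      by (intro poly_fun.intros poly_fun_axis assms(2) G(1) H(1) poly_fun_mult.hyps)
  qed (use G(2) H(2) in auto)
qed

text \<open>The cones enter as zero sets of nonnegative functions, with growth along rays in place
  of homogeneity. Compactness of the unit sphere turns "meeting only at the origin" into the uniform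
  separation required by \<open>separated_cones\<close>.\<close>

theorem no_separation:
  fixes a b :: "pt \<Rightarrow> complex"
  assumes rm: "r + 2 \<le> m" and g: "\<And>j. j < r \<Longrightarrow> g j \<in> poly_fun m"
    and C: "C2 a" "C2 b"
    and real: "\<And>z. a z \<in> \<real>" "\<And>z. b z \<in> \<real>" and nonneg: "\<And>z. Re (a z) \<ge> 0" "\<And>z. Re (b z) \<ge> 0"
    and dep: "\<And>z w. (\<And>i. i < m \<Longrightarrow> z i = w i) \<Longrightarrow> a z = a w" "\<And>z w. (\<And>i. i < m \<Longrightarrow> z i = w i) \<Longrightarrow> b z = b w"
    and scale: "\<And>t z. t \<ge> 1 \<Longrightarrow> Re (a (\<lambda>i. of_real t * z i)) \<ge> Re (a z)"
      "\<And>t z. t \<ge> 1 \<Longrightarrow> Re (b (\<lambda>i. of_real t * z i)) \<ge> Re (b z)"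
    and inter: "\<And>z i. a z = 0 \<Longrightarrow> b z = 0 \<Longrightarrow> i < m \<Longrightarrow> z i = 0"
    and gz: "\<And>z. (\<And>j. j < r \<Longrightarrow> g j z = 0) \<Longrightarrow> a z = 0 \<or> b z = 0"
    and lineA: "\<And>z. (\<And>i. i < m \<Longrightarrow> i \<noteq> 0 \<Longrightarrow> z i = 0) \<Longrightarrow> a z = 0 \<and> (\<forall>j<r. g j z = 0)"
    and lineB: "\<And>z. (\<And>i. i < m \<Longrightarrow> i \<noteq> 1 \<Longrightarrow> z i = 0) \<Longrightarrow> b z = 0 \<and> (\<forall>j<r. g j z = 0)"
  shows False
proof -
  \<comment> \<open>The coordinates from \<open>m\<close> on are set to 0 to make the sphere
    compact; \<open>dep\<close> carries the estimates to arbitrary points.\<close>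
  define Sph where "Sph = {z :: pt. \<forall>i. z i \<in> (if i < m then cball 0 1 else {0})} \<inter> {z. (\<Sum>i<m. (norm (z i))\<^sup>2) = 1}"
  have cs: "continuous_on UNIV (\<lambda>z :: pt. \<Sum>i<m. (norm (z i))\<^sup>2)"
    by (intro continuous_on_sum continuous_on_power continuous_on_norm continuous_on_product_coordinates)
  have "closed {z :: pt. (\<Sum>i<m. (norm (z i))\<^sup>2) = 1}"
    using cs by (intro closed_Collect_eq) auto
  then have cpt: "compact Sph"
    unfolding Sph_def by (intro compact_Int_closed compact_box)
  have "(\<lambda>i. if i = 0 then 1 else 0) \<in> Sph"
    using rm by (auto simp: Sph_def if_distrib[where f=norm] if_distrib[where f="\<lambda>x. x\<^sup>2"] cong: if_cong)
  then have ne: "Sph \<noteq> {}" by blast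
  have cont: "continuous_on Sph (\<lambda>z. Re (a z) + Re (b z))"
    by (intro continuous_on_add continuous_on_Re continuous_on_subset[OF C1_cont[OF C2_C1[OF C(1)]]]
        continuous_on_subset[OF C1_cont[OF C2_C1[OF C(2)]]] subset_UNIV)
  obtain z0 where z0: "z0 \<in> Sph" "\<And>z. z \<in> Sph \<Longrightarrow> Re (a z0) + Re (b z0) \<le> Re (a z) + Re (b z)"
    using continuous_attains_inf[OF cpt ne cont] by blast
  define c0 where "c0 = Re (a z0) + Re (b z0)"
  have c0: "c0 > 0"
  proof (rule ccontr)
    assume "\<not> c0 > 0"
    then have "Re (a z0) = 0" "Re (b z0) = 0" using nonneg[of z0] unfolding c0_def by auto
    then have "a z0 = 0" "b z0 = 0" using real[of z0] by (auto elim!: Reals_cases)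
    then have "(\<Sum>i<m. (norm (z0 i))\<^sup>2) = 0" using inter[of z0] by simp
    then show False using z0(1) by (simp add: Sph_def)
  qed
  \<comment> \<open>On the sphere \<open>a + b\<close> is at least \<open>c0\<close>, so one of the
    two is at least \<open>c0 / 2\<close>; this factor raises it to 1.\<close>
  define c where "c = complex_of_real (2 / c0)"
  define a' where "a' z = c * a z" for z
  define b' where "b' z = c * b z" for z
  have Re': "Re (a' z) = 2 / c0 * Re (a z)" "Re (b' z) = 2 / c0 * Re (b z)" for z
    by (simp_all add: a'_def b'_def c_def)
  have sep: "Re (a' z) \<ge> 1 \<or> Re (b' z) \<ge> 1" if N: "(\<Sum>i<m. (norm (z i))\<^sup>2) \<ge> 1" for z
  proof -
    define s where "s = sqrt (\<Sum>i<m. (norm (z i))\<^sup>2)"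
    have s: "s \<ge> 1" "s\<^sup>2 = (\<Sum>i<m. (norm (z i))\<^sup>2)" using N unfolding s_def by auto
    define w where "w i = (if i < m then z i / of_real s else 0)" for i
    have "(\<Sum>i<m. (norm (w i))\<^sup>2) = (\<Sum>i<m. (norm (z i))\<^sup>2) / s\<^sup>2"
      by (simp add: w_def norm_divide power_divide sum_divide_distrib)
    then have w1: "(\<Sum>i<m. (norm (w i))\<^sup>2) = 1" using s N by simp
    have "norm (w i) \<le> 1" if "i < m" for i
    proof -
      have "(norm (w i))\<^sup>2 \<le> (\<Sum>i<m. (norm (w i))\<^sup>2)" using that by (intro member_le_sum) auto
      then show ?thesis using w1 by (simp add: power_le_one_iff abs_square_le_1)
    qed
    then have "w \<in> Sph" using w1 by (auto simp: Sph_def w_def)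
    then have "c0 \<le> Re (a w) + Re (b w)" using z0(2) unfolding c0_def by blast
    moreover have "a z = a (\<lambda>i. of_real s * w i)" "b z = b (\<lambda>i. of_real s * w i)"
      using s(1) by (auto intro!: dep simp: w_def)
    ultimately have "c0 \<le> Re (a z) + Re (b z)"
      using scale[OF s(1), of w] by simp
    then show ?thesis unfolding Re' using c0 by (auto simp: field_simps)
  qed
  have m: "0 < m" "1 < m" using rm by auto
  have "\<exists>G. (\<forall>i. G i \<in> poly_fun m) \<and> (\<forall>z. G 0 z = 0) \<and> (j < r \<longrightarrow> (\<forall>z. g j z = (\<Sum>i<m. G i z * z i)))" for j
  proof (cases "j < r")
    case True
    then have "g j (axis 0 z) = 0" for z using lineA[of "axis 0 z"] by (auto simp: axis_def)
    then show ?thesis using poly_fun_decomp[OF g[OF True] m(1)] by auto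
  next
    case False
    then show ?thesis by (intro exI[of _ "\<lambda>i z. 0"]) (auto intro: poly_fun.intros)
  qed
  then obtain GA where GA: "\<And>j i. GA j i \<in> poly_fun m" "\<And>j z. GA j 0 z = 0"
    "\<And>j z. j < r \<Longrightarrow> g j z = (\<Sum>i<m. GA j i z * z i)" by metis
  have "\<exists>G. (\<forall>i. G i \<in> poly_fun m) \<and> (\<forall>z. G 1 z = 0) \<and> (j < r \<longrightarrow> (\<forall>z. g j z = (\<Sum>i<m. G i z * z i)))" for j
  proof (cases "j < r")
    case True
    then have "g j (axis 1 z) = 0" for z using lineB[of "axis 1 z"] by (auto simp: axis_def)
    then show ?thesis using poly_fun_decomp[OF g[OF True] m(2)] by auto
  next
    case False
    then show ?thesis by (intro exI[of _ "\<lambda>i z. 0"]) (auto intro: poly_fun.intros)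
  qed
  then obtain GB where GB: "\<And>j i. GB j i \<in> poly_fun m" "\<And>j z. GB j 1 z = 0"
    "\<And>j z. j < r \<Longrightarrow> g j z = (\<Sum>i<m. GB j i z * z i)" by metis
  \<comment> \<open>The locale asks for regularity at every index, so the family is continued by
    0.\<close>
  define g' where "g' j = (if j < r then g j else (\<lambda>z. 0))" for j
  have "separated_cones m r g' a' b' GA GB"
  proof
    show "r + 2 \<le> m" by (rule rm)
    show "C2 (g' j)" for j using g poly_fun_C2 by (auto simp: g'_def C2_const)
    show "C2 (GA j i)" "C2 (GB j i)" for j i using GA(1) GB(1) poly_fun_C2 by blast+
    show "dbar (GA j i) l z = 0" "dbar (GB j i) l z = 0" for j i l z using GA(1) GB(1) poly_fun_dbar by blast+
    show "g' j z = (\<Sum>i<m. GA j i z * z i)" "g' j z = (\<Sum>i<m. GB j i z * z i)" if "j < r" for j z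
      using GA(3)[OF that] GB(3)[OF that] that by (auto simp: g'_def)
    show "GA j 0 z = 0" "GB j 1 z = 0" for j z by (rule GA GB)+
    show "C2 a'" "C2 b'" unfolding a'_def[abs_def] b'_def[abs_def] by (intro C2_intros C)+
    show "a' z \<in> \<real>" "b' z \<in> \<real>" for z unfolding a'_def b'_def c_def using real by (auto intro: Reals_mult)
    show "Re (a' z) \<ge> 1 \<or> Re (b' z) \<ge> 1" if "(\<Sum>i<m. (norm (z i))\<^sup>2) \<ge> 1" for z using sep[OF that] .
    show "\<exists>j<r. g' j z \<noteq> 0" if "Re (a' z) > 0" "Re (b' z) > 0" for z
    proof (rule ccontr)
      assume "\<not> ?thesis"
      then have "a z = 0 \<or> b z = 0" by (intro gz) (auto simp: g'_def)
      then show False using that by (auto simp: a'_def b'_def)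
    qed
    show "Re (a' z) < 1/3" if "\<forall>i<m. i \<noteq> 0 \<longrightarrow> z i = 0" for z using lineA[of z] that by (simp add: a'_def)
    show "Re (b' z) < 1/3" if "\<forall>i<m. i \<noteq> 1 \<longrightarrow> z i = 0" for z using lineB[of z] that by (simp add: b'_def)
  qed
  then show False by (rule separated_cones.contradiction)
qed

section \<open>Sections of injective morphisms and graphs of roots of unity\<close>

lemma finite_exps:
  assumes "\<forall>i\<le>n. q i > 0"
  shows "finite (exps q n m)"
proof -
  have "exps q n m \<subseteq> {\<alpha>. \<forall>i. (i \<in> {..n} \<longrightarrow> \<alpha> i \<in> {..nat m}) \<and> (i \<notin> {..n} \<longrightarrow> \<alpha> i = 0)}"
  proof
    fix \<alpha> assume \<alpha>: "\<alpha> \<in> exps q n m"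
    have "\<alpha> i \<le> nat m" if "i \<le> n" for i
    proof -
      have "\<alpha> i \<le> q i * \<alpha> i" using assms that by (simp add: Suc_le_eq)
      also have "\<dots> \<le> wdeg q n \<alpha>" unfolding wdeg_def using that by (intro member_le_sum) auto
      finally show ?thesis using \<alpha> by (auto simp: exps_def)
    qed
    then show "\<alpha> \<in> {\<alpha>. \<forall>i. (i \<in> {..n} \<longrightarrow> \<alpha> i \<in> {..nat m}) \<and> (i \<notin> {..n} \<longrightarrow> \<alpha> i = 0)}"
      using \<alpha> by (auto simp: exps_def)
  qed
  then show ?thesis using finite_set_of_finite_funs[of "{..n}" "{..nat m}" 0] finite_subset by auto
qed

lemma H0_poly_fun: "f \<in> H0 q n D \<Longrightarrow> f \<in> poly_fun (Suc n)"
  unfolding H0_def mono_def by (auto intro!: poly_fun_sum poly_fun_mult poly_fun_const poly_fun_prod poly_fun_power poly_fun_coord)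

lemma H0_scale:
  assumes "f \<in> H0 q n (int D)"
  shows "f (\<lambda>i. l ^ q i * x i) = l ^ D * f x"
proof -
  obtain c where c: "f = (\<lambda>x. \<Sum>\<alpha>\<in>exps q n (int D). c \<alpha> * mono n \<alpha> x)" using assms unfolding H0_def by blast
  have "mono n \<alpha> (\<lambda>i. l ^ q i * x i) = l ^ D * mono n \<alpha> x" if "\<alpha> \<in> exps q n (int D)" for \<alpha>
  proof -
    have "mono n \<alpha> (\<lambda>i. l ^ q i * x i) = l ^ wdeg q n \<alpha> * mono n \<alpha> x"
      by (simp add: mono_def wdeg_def power_mult_distrib prod.distrib power_mult[symmetric] power_sum)
    then show ?thesis using that by (auto simp: exps_def)
  qed
  then show ?thesis unfolding c by (simp add: sum_distrib_left mult.left_commute)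
qed

locale injective_sections =
  fixes q :: "nat \<Rightarrow> nat" and n N D :: nat and F :: "nat \<Rightarrow> pt \<Rightarrow> complex"
  assumes qpos: "\<forall>i\<le>n. q i > 0" and Dpos: "D > 0"
    and FH: "\<And>j. j \<le> N \<Longrightarrow> F j \<in> H0 q n (int D)" and inj: "inj_morph q n N F"
begin

lemma F_cong: "j \<le> N \<Longrightarrow> (\<And>i. i \<le> n \<Longrightarrow> x i = y i) \<Longrightarrow> F j x = F j y"
  by (rule poly_fun_cong[OF H0_poly_fun[OF FH]]) auto

lemma F_zero: "j \<le> N \<Longrightarrow> (\<And>i. i \<le> n \<Longrightarrow> x i = 0) \<Longrightarrow> F j x = 0"
proof -
  assume j: "j \<le> N" and x: "\<And>i. i \<le> n \<Longrightarrow> x i = 0"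
  \<comment> \<open>Homogeneity is applied with \<open>l = 0\<close>; the positive degree then makes
    the value at the origin 0.\<close>
  have "F j x = F j (\<lambda>i. 0 ^ q i * x i)" using x by (intro F_cong[OF j]) simp
  also have "\<dots> = 0" using H0_scale[OF FH[OF j], of 0 x] Dpos by simp
  finally show ?thesis .
qed

lemma common_zero:
  assumes "\<And>j. j \<le> N \<Longrightarrow> F j x = 0" "i \<le> n"
  shows "x i = 0"
proof (rule ccontr)
  assume "x i \<noteq> 0"
  define x' where "x' i = (if i \<le> n then x i else 0)" for i
  have "wps_pt n x'" unfolding wps_pt_def x'_def using \<open>x i \<noteq> 0\<close> assms(2) by auto
  then obtain j where "j \<le> N" "F j x' \<noteq> 0" using inj unfolding inj_morph_def by blast
  moreover have "F j x' = F j x" if "j \<le> N" for j by (intro F_cong that) (simp add: x'_def)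
  ultimately show False using assms(1) by simp
qed

text \<open>Injectivity provides some \<open>l\<close> carrying \<open>x\<close> to
  \<open>y\<close>; comparing the values of a section that is nonzero at \<open>x\<close> forces
  \<open>l ^ D = 1\<close>.\<close>

lemma fibre:
  assumes eq: "\<And>j. j \<le> N \<Longrightarrow> F j x = F j y"
  obtains l where "l ^ D = 1" "\<And>i. i \<le> n \<Longrightarrow> y i = l ^ q i * x i"
proof (cases "\<forall>i\<le>n. x i = 0")
  case True
  then have "F j y = 0" if "j \<le> N" for j using eq[OF that] F_zero[OF that] by simp
  then have "y i = 0" if "i \<le> n" for i using common_zero that by blast
  then show ?thesis using True by (intro that[of 1]) auto
next
  case False
  then have "\<exists>j\<le>N. F j x \<noteq> 0" using common_zero by blast
  then obtain j where j: "j \<le> N" "F j x \<noteq> 0" by blast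
  have y0: "\<not> (\<forall>i\<le>n. y i = 0)" using j eq[OF j(1)] F_zero[OF j(1), of y] by auto
  define x' where "x' i = (if i \<le> n then x i else 0)" for i
  define y' where "y' i = (if i \<le> n then y i else 0)" for i
  have pt: "wps_pt n x'" "wps_pt n y'" unfolding wps_pt_def x'_def y'_def using False y0 by auto
  have F': "F j x' = F j x" "F j y' = F j y" if "j \<le> N" for j
    by (intro F_cong that; simp add: x'_def y'_def)+
  have "\<exists>c. \<forall>i\<le>N. F i x' = c * F i y'" using eq F' by (intro exI[of _ 1]) auto
  then have "wps_equiv q n x' y'" using inj pt unfolding inj_morph_def by blast
  then obtain l where l: "l \<noteq> 0" "\<And>i. i \<le> n \<Longrightarrow> y i = l ^ q i * x i"
    unfolding wps_equiv_def x'_def y'_def by auto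
  have "F j y = F j (\<lambda>i. l ^ q i * x i)" using l(2) by (intro F_cong[OF j(1)])
  then have "F j x = l ^ D * F j x" using H0_scale[OF FH[OF j(1)]] eq[OF j(1)] by simp
  then have "l ^ D = 1" using j(2) by simp
  then show ?thesis using l(2) that by blast
qed

text \<open>A linear family \<open>(X z, Y z)\<close> of pairs of points parametrizes the slice. The
  shape of \<open>X 0\<close> and \<open>Y 0\<close> puts axis 0 into the graph of 1 and, because
  \<open>q 0 = 1\<close>, axis 1 into the graph of \<xi>. The \<open>N + 1\<close> differences
  \<open>g j\<close> are at most \<open>m - 2\<close> in number.\<close>

lemma no_separating_slice:
  fixes X Y :: "nat \<Rightarrow> pt \<Rightarrow> complex"
  assumes q0: "q 0 = 1" and Nm: "N + 3 \<le> m"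
    and XY_poly: "\<And>i. i \<le> n \<Longrightarrow> X i \<in> poly_fun m" "\<And>i. i \<le> n \<Longrightarrow> Y i \<in> poly_fun m"
    and lin: "\<And>i c z. i \<le> n \<Longrightarrow> X i (\<lambda>k. c * z k) = c * X i z" "\<And>i c z. i \<le> n \<Longrightarrow> Y i (\<lambda>k. c * z k) = c * Y i z"
    and X0: "\<And>z. X 0 z = z 0 + z 1" and Y0: "\<And>z. Y 0 z = z 0 + \<xi> * z 1"
    and XY: "\<And>z i. (\<And>k. 2 \<le> k \<Longrightarrow> k < m \<Longrightarrow> z k = 0) \<Longrightarrow> 1 \<le> i \<Longrightarrow> i \<le> n \<Longrightarrow> X i z = 0 \<and> Y i z = 0"
    and L: "LA \<union> LB = {l. l ^ D = 1}" and LA: "1 \<in> LA" and LB: "\<xi> \<in> LB"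
    and sep: "\<And>l l' z k. l \<in> LA \<Longrightarrow> l' \<in> LB \<Longrightarrow> (\<And>i. i \<le> n \<Longrightarrow> Y i z = l ^ q i * X i z) \<Longrightarrow>
        (\<And>i. i \<le> n \<Longrightarrow> Y i z = l' ^ q i * X i z) \<Longrightarrow> k < m \<Longrightarrow> z k = 0"
  shows False
proof -
  have fin: "finite LA" "finite LB"
    using finite_roots_unity[of D, where 'a=complex] Dpos L by (auto intro: finite_subset[of _ "{l. l ^ D = 1}"])
  define v where "v l i z = Y i z - l ^ q i * X i z" for l i z
  \<comment> \<open>A product over \<open>\<Lambda>\<close> of sums of squares, so that it vanishes
    exactly on the union of the graphs belonging to \<open>\<Lambda>\<close>.\<close>
  define W where "W \<Lambda> z = (\<Prod>l\<in>\<Lambda>. \<Sum>i\<le>n. cnj (v l i z) * v l i z)" for \<Lambda> z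
  have W_eq: "W \<Lambda> z = of_real (\<Prod>l\<in>\<Lambda>. \<Sum>i\<le>n. (norm (v l i z))\<^sup>2)" for \<Lambda> z
    by (simp add: W_def cnj_mult_self)
  have W_zero: "W \<Lambda> z = 0 \<longleftrightarrow> (\<exists>l\<in>\<Lambda>. \<forall>i\<le>n. Y i z = l ^ q i * X i z)" if "finite \<Lambda>" for \<Lambda> z
    using that unfolding W_eq of_real_eq_0_iff by (auto simp: prod_zero_iff sum_nonneg_eq_0_iff v_def)
  have W_C2: "C2 (W \<Lambda>)" for \<Lambda>
    unfolding W_def[abs_def] v_def[abs_def] by (intro C2_intros poly_fun_C2[OF XY_poly(1)] poly_fun_C2[OF XY_poly(2)]) auto
  have W_dep: "W \<Lambda> z = W \<Lambda> w" if "\<And>i. i < m \<Longrightarrow> z i = w i" for \<Lambda> z w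
  proof -
    have "v l i z = v l i w" if "i \<le> n" for l i
      using poly_fun_cong[OF XY_poly(1)[OF that], of z w] poly_fun_cong[OF XY_poly(2)[OF that], of z w] \<open>\<And>i. i < m \<Longrightarrow> z i = w i\<close> by (simp add: v_def)
    then show ?thesis by (simp add: W_def)
  qed
  have W_scale: "Re (W \<Lambda> (\<lambda>i. of_real t * z i)) \<ge> Re (W \<Lambda> z)" if "t \<ge> 1" for \<Lambda> t z
  proof -
    have "(\<Prod>l\<in>\<Lambda>. \<Sum>i\<le>n. (norm (v l i z))\<^sup>2) \<le> (\<Prod>l\<in>\<Lambda>. \<Sum>i\<le>n. (norm (v l i (\<lambda>i. of_real t * z i)))\<^sup>2)"
    proof (intro prod_mono conjI sum_nonneg sum_mono)
      fix l i assume i: "i \<in> {..n}"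
      then have "v l i (\<lambda>i. of_real t * z i) = of_real t * v l i z"
        using lin[of i "of_real t" z] by (simp add: v_def algebra_simps)
      then have "norm (v l i (\<lambda>i. of_real t * z i)) = t * norm (v l i z)" using that by (simp add: norm_mult)
      moreover have "norm (v l i z) \<le> t * norm (v l i z)" using that by (simp add: mult_le_cancel_right1)
      ultimately show "(norm (v l i z))\<^sup>2 \<le> (norm (v l i (\<lambda>i. of_real t * z i)))\<^sup>2"
        by (simp add: power_mono)
    qed auto
    then show ?thesis unfolding W_eq Re_complex_of_real .
  qed
  define g where "g j z = F j (\<lambda>i. X i z) - F j (\<lambda>i. Y i z)" for j z
  have on_graph: "g j z = 0" if "j \<le> N" "l ^ D = 1" "\<And>i. i \<le> n \<Longrightarrow> Y i z = l ^ q i * X i z" for j z l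
  proof -
    have "F j (\<lambda>i. Y i z) = F j (\<lambda>i. l ^ q i * X i z)" using that(3) by (intro F_cong[OF that(1)])
    then show ?thesis using H0_scale[OF FH[OF that(1)]] that(2) by (simp add: g_def)
  qed
  show False
  proof (rule no_separation[of "Suc N" m g "W LA" "W LB"])
    show "Suc N + 2 \<le> m" using Nm by simp
    show "g j \<in> poly_fun m" if "j < Suc N" for j
    proof -
      have j: "j \<le> N" using that by simp
      have "(\<lambda>z. F j (\<lambda>i. X i z)) \<in> poly_fun m" "(\<lambda>z. F j (\<lambda>i. Y i z)) \<in> poly_fun m"
        by (rule poly_fun_subst[OF H0_poly_fun[OF FH[OF j]]]; simp add: XY_poly)+
      then show ?thesis unfolding g_def[abs_def] by (rule poly_fun_diff)
    qed
    show "C2 (W LA)" "C2 (W LB)" by (rule W_C2)+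
    show "W LA z \<in> \<real>" "W LB z \<in> \<real>" for z unfolding W_eq by auto
    show "Re (W LA z) \<ge> 0" "Re (W LB z) \<ge> 0" for z
      unfolding W_eq Re_complex_of_real by (auto intro!: prod_nonneg sum_nonneg)
    show "W LA z = W LA w" "W LB z = W LB w" if "\<And>i. i < m \<Longrightarrow> z i = w i" for z w
      using W_dep[OF that] by auto
    show "Re (W LA z) \<le> Re (W LA (\<lambda>i. of_real t * z i))" "Re (W LB z) \<le> Re (W LB (\<lambda>i. of_real t * z i))"
      if "1 \<le> t" for t z using W_scale[OF that] by auto
    show "z i = 0" if "W LA z = 0" "W LB z = 0" "i < m" for z i
      using that sep[of _ _ z i] unfolding W_zero[OF fin(1)] W_zero[OF fin(2)] by blast
    show "W LA z = 0 \<or> W LB z = 0" if "\<And>j. j < Suc N \<Longrightarrow> g j z = 0" for z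
    proof -
      have "F j (\<lambda>i. X i z) = F j (\<lambda>i. Y i z)" if "j \<le> N" for j
        using \<open>\<And>j. j < Suc N \<Longrightarrow> g j z = 0\<close>[of j] that by (simp add: g_def)
      then obtain l where "l ^ D = 1" "\<And>i. i \<le> n \<Longrightarrow> Y i z = l ^ q i * X i z" using fibre by blast
      then show ?thesis unfolding W_zero[OF fin(1)] W_zero[OF fin(2)] using L by blast
    qed
    show "W LA z = 0 \<and> (\<forall>j<Suc N. g j z = 0)" if z: "\<And>i. i < m \<Longrightarrow> i \<noteq> 0 \<Longrightarrow> z i = 0" for z
    proof -
      have "Y i z = 1 ^ q i * X i z" if "i \<le> n" for i
        using XY[of z i] z X0[of z] Y0[of z] that Nm by (cases "i = 0") auto
      then have "\<exists>l\<in>LA. \<forall>i\<le>n. Y i z = l ^ q i * X i z" "\<forall>j<Suc N. g j z = 0"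
        using LA on_graph[of _ 1 z] by (blast, simp)
      then show ?thesis unfolding W_zero[OF fin(1)] by blast
    qed
    show "W LB z = 0 \<and> (\<forall>j<Suc N. g j z = 0)" if z: "\<And>i. i < m \<Longrightarrow> i \<noteq> 1 \<Longrightarrow> z i = 0" for z
    proof -
      have "Y i z = \<xi> ^ q i * X i z" if "i \<le> n" for i
        using XY[of z i] z X0[of z] Y0[of z] that Nm q0 by (cases "i = 0") auto
      moreover have "\<xi> ^ D = 1" using L LB by auto
      ultimately have "\<exists>l\<in>LB. \<forall>i\<le>n. Y i z = l ^ q i * X i z" "\<forall>j<Suc N. g j z = 0"
        using LB on_graph[of _ \<xi> z] by (blast, simp)
      then show ?thesis unfolding W_zero[OF fin(2)] by blast
    qed
  qed
qed

text \<open>Substituting \<open>z 0 * z 1\<close> for the first variable turns a system whose only zero is the origin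
  into one whose zero set consists of two lines.\<close>

lemma sections_ge_dim: "n \<le> N"
proof (rule ccontr)
  assume "\<not> n \<le> N"
  define Z where "Z k z = (\<Sum>i\<in>{..<n+2}-{k}. cnj (z i) * z i)" for k :: nat and z :: pt
  have Z_eq: "Z k z = of_real (\<Sum>i\<in>{..<n+2}-{k}. (norm (z i))\<^sup>2)" for k z
    unfolding Z_def by (rule sum_cnj_mult_self)
  have Z0: "Z k z = 0 \<longleftrightarrow> (\<forall>i<n+2. i \<noteq> k \<longrightarrow> z i = 0)" for k z
    unfolding Z_eq of_real_eq_0_iff by (subst sum_nonneg_eq_0_iff) auto
  have C: "C2 (Z k)" for k unfolding Z_def[abs_def] by (intro C2_intros)
  have sc: "Re (Z k (\<lambda>i. of_real t * z i)) \<ge> Re (Z k z)" if "t \<ge> 1" for k t z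
  proof -
    have "norm (z i) \<le> norm (of_real t * z i)" for i using that by (simp add: norm_mult mult_le_cancel_right1)
    then show ?thesis unfolding Z_eq by (simp add: sum_mono power_mono)
  qed
  define x where "x z i = (if i = 0 then z 0 * z 1 else z (i + 1))" for z :: pt and i :: nat
  define g where "g j z = F j (x z)" for j z
  have gz: "g j z = 0" if "j \<le> N" "\<And>i. 2 \<le> i \<Longrightarrow> i < n + 2 \<Longrightarrow> z i = 0" "z 0 * z 1 = 0" for j z
    unfolding g_def using that by (intro F_zero) (auto simp: x_def)
  show False
  proof (rule no_separation[of "Suc N" "n + 2" g "Z 0" "Z 1"])
    \<comment> \<open>The indices start at 0: \<open>N < n\<close> means at most \<open>n\<close>
      polynomials, in \<open>n + 2\<close> variables.\<close>
    show "Suc N + 2 \<le> n + 2" using \<open>\<not> n \<le> N\<close> by simp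
    show "g j \<in> poly_fun (n + 2)" if "j < Suc N" for j
    proof -
      have "(\<lambda>z. F j (\<lambda>i. (if i = 0 then (\<lambda>z. z 0 * z 1) else (\<lambda>z. z (i + 1))) z)) \<in> poly_fun (n + 2)"
        by (rule poly_fun_subst[OF H0_poly_fun[OF FH[OF less_Suc_eq_le[THEN iffD1, OF that]]]]) (auto intro: poly_fun.intros)
      moreover have "(\<lambda>i. (if i = 0 then (\<lambda>z. z 0 * z 1) else (\<lambda>z. z (i + 1))) z) = x z" for z
        by (auto simp: x_def)
      ultimately show ?thesis unfolding g_def[abs_def] by simp
    qed
    show "C2 (Z 0)" "C2 (Z 1)" by (rule C)+
    show "Z 0 z \<in> \<real>" "Z 1 z \<in> \<real>" for z unfolding Z_eq by auto
    show "Re (Z 0 z) \<ge> 0" "Re (Z 1 z) \<ge> 0" for z unfolding Z_eq by (auto intro!: sum_nonneg)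
    show "Z 0 z = Z 0 w" "Z 1 z = Z 1 w" if "\<And>i. i < n + 2 \<Longrightarrow> z i = w i" for z w
      using that unfolding Z_def by auto
    show "Re (Z 0 z) \<le> Re (Z 0 (\<lambda>i. of_real t * z i))" "Re (Z 1 z) \<le> Re (Z 1 (\<lambda>i. of_real t * z i))"
      if "1 \<le> t" for t z using sc[OF that] by auto
    show "z i = 0" if "Z 0 z = 0" "Z 1 z = 0" "i < n + 2" for z i
      using that unfolding Z0 by (cases "i = 0") auto
    show "Z 0 z = 0 \<or> Z 1 z = 0" if "\<And>j. j < Suc N \<Longrightarrow> g j z = 0" for z
    proof -
      have x0: "x z i = 0" if "i \<le> n" for i
        by (rule common_zero[OF _ that]) (use \<open>\<And>j. j < Suc N \<Longrightarrow> g j z = 0\<close> in \<open>simp add: g_def\<close>)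
      have "z i = 0" if "2 \<le> i" "i < n + 2" for i
        using x0[of "i - 1"] that by (simp add: x_def split: if_splits)
      moreover have "z 0 = 0 \<or> z 1 = 0" using x0[of 0] by (simp add: x_def)
      moreover have "i = 0 \<or> i = 1 \<or> 2 \<le> i" for i :: nat by linarith
      ultimately show ?thesis unfolding Z0 by metis
    qed
    show "Z 0 z = 0 \<and> (\<forall>j<Suc N. g j z = 0)" if "\<And>i. i < n + 2 \<Longrightarrow> i \<noteq> 0 \<Longrightarrow> z i = 0" for z
      using that unfolding Z0 by (auto intro!: gz)
    show "Z 1 z = 0 \<and> (\<forall>j<Suc N. g j z = 0)" if "\<And>i. i < n + 2 \<Longrightarrow> i \<noteq> 1 \<Longrightarrow> z i = 0" for z
      using that unfolding Z0 by (auto intro!: gz)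
  qed
qed

end

section \<open>Lower bounds on the number of sections\<close>

text \<open>The \<open>D\<close> solutions of \<open>z ^ D = 1\<close> do not fit among the
  \<open>e\<close> solutions of \<open>z ^ e = 1\<close>.\<close>

lemma root_of_unity_not_of_order:
  assumes "0 < e" "e < D"
  obtains \<xi> :: complex where "\<xi> ^ D = 1" "\<xi> ^ e \<noteq> 1"
proof -
  have "\<not> {z :: complex. z ^ D = 1} \<subseteq> {z. z ^ e = 1}"
  proof
    assume "{z :: complex. z ^ D = 1} \<subseteq> {z. z ^ e = 1}"
    then have "card {z :: complex. z ^ D = 1} \<le> card {z :: complex. z ^ e = 1}"
      using assms by (intro card_mono finite_roots_unity) auto
    then show False using assms by (simp add: card_roots_unity_eq)
  qed
  then show ?thesis using that by blast
qed

lemma complex_root_exists: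
  assumes "k > 0"
  obtains w :: complex where "w ^ k = z"
proof (cases "z = 0")
  case True
  then show ?thesis using assms that[of 0] by simp
next
  case False
  have "exp (Ln z / of_nat k) ^ k = exp (of_nat k * (Ln z / of_nat k))" by (rule exp_of_nat_mult[symmetric])
  also have "\<dots> = z" using assms False by simp
  finally show ?thesis by (rule that)
qed

context injective_sections
begin

text \<open>All pairs of points are used, a space of dimension \<open>2 * n + 2\<close>. The
  hypothesis \<open>k >= 2\<close> makes \<open>d < D\<close>, so that some \<open>D\<close>-th root
  of unity is not a \<open>d\<close>-th one and the second cone contains a line.\<close>

lemma sections_ge_twice_dim:
  assumes q0: "q 0 = 1" and D: "D = k * d" and k: "k \<ge> 2" and dvd: "\<And>i. i \<le> n \<Longrightarrow> q i dvd d"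
  shows "2 * n \<le> N"
proof (rule ccontr)
  assume N: "\<not> 2 * n \<le> N"
  have d: "d > 0" "d < D" using D Dpos k by auto
  obtain \<xi> :: complex where \<xi>: "\<xi> ^ D = 1" "\<xi> ^ d \<noteq> 1" using root_of_unity_not_of_order[OF d] .
  \<comment> \<open>For \<open>i >= 1\<close> the two points are interleaved at positions
    \<open>2 * i\<close> and \<open>2 * i + 1\<close>. The first coordinates are parametrized so
    that the axes 0 and 1 become the lines \<open>y = x\<close> and
    \<open>y = \<xi> * x\<close>.\<close>
  define X :: "nat \<Rightarrow> pt \<Rightarrow> complex" where "X i = (if i = 0 then (\<lambda>z. z 0 + z 1) else (\<lambda>z. z (2 * i)))" for i
  define Y :: "nat \<Rightarrow> pt \<Rightarrow> complex" where "Y i = (if i = 0 then (\<lambda>z. z 0 + \<xi> * z 1) else (\<lambda>z. z (2 * i + 1)))" for i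
  show False
  proof (rule no_separating_slice[where m="2 * n + 2" and X=X and Y=Y and \<xi>=\<xi> and
        LA="{l. l ^ d = 1}" and LB="{l. l ^ D = 1 \<and> l ^ d \<noteq> 1}"])
    show "q 0 = 1" by (rule q0)
    show "N + 3 \<le> 2 * n + 2" using N by simp
    show "X i \<in> poly_fun (2 * n + 2)" "Y i \<in> poly_fun (2 * n + 2)" if "i \<le> n" for i
      using that unfolding X_def Y_def by (auto intro!: poly_fun.intros)
    show "X i (\<lambda>k. c * z k) = c * X i z" "Y i (\<lambda>k. c * z k) = c * Y i z" for i c z
      unfolding X_def Y_def by (auto simp: algebra_simps)
    show "X i z = 0 \<and> Y i z = 0" if "\<And>k. 2 \<le> k \<Longrightarrow> k < 2 * n + 2 \<Longrightarrow> z k = 0" "1 \<le> i" "i \<le> n" for z i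
      using that unfolding X_def Y_def by auto
    show "{l. l ^ d = 1} \<union> {l. l ^ D = 1 \<and> l ^ d \<noteq> 1} = {l :: complex. l ^ D = 1}"
      unfolding D by (auto simp: mult.commute[of k] power_mult)
    show "z j = 0" if l: "l \<in> {l. l ^ d = 1}" "l' \<in> {l. l ^ D = 1 \<and> l ^ d \<noteq> 1}"
      and Yl: "\<And>i. i \<le> n \<Longrightarrow> Y i z = l ^ q i * X i z" "\<And>i. i \<le> n \<Longrightarrow> Y i z = l' ^ q i * X i z"
      and j: "j < 2 * n + 2" for l l' z j
    proof -
      have Xz: "X i z = 0" if i: "i \<le> n" for i
      proof (rule ccontr)
        assume "X i z \<noteq> 0"
        then have "l ^ q i = l' ^ q i" using Yl[OF i] by simp
        moreover obtain e where "d = q i * e" using dvd[OF i] by blast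
        \<comment> \<open>Every weight divides \<open>d\<close>, so one nonzero coordinate already
          determines \<open>l ^ d\<close>; this separates the two families.\<close>
        ultimately have "l ^ d = l' ^ d" by (simp add: power_mult)
        then show False using l by simp
      qed
      then have Yz: "Y i z = 0" if i: "i \<le> n" for i using Yl(1)[OF i] i by simp
      have "z 0 + z 1 = 0" "z 0 + \<xi> * z 1 = 0" using Xz[of 0] Yz[of 0] by (auto simp: X_def Y_def)
      then have "(z 0 + \<xi> * z 1) - (z 0 + z 1) = 0" by (simp only: diff_self)
      then have "(\<xi> - 1) * z 1 = 0" by (simp only: algebra_simps) simp
      moreover have "\<xi> \<noteq> 1" using \<xi> by auto
      ultimately have "z 1 = 0" by simp
      with \<open>z 0 + z 1 = 0\<close> have z01: "z 0 = 0" "z 1 = 0" by auto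
      show ?thesis
      proof (cases "j < 2")
        case True then show ?thesis using z01 by (auto simp: less_Suc_eq numeral_2_eq_2)
      next
        case False
        then have i: "j div 2 \<le> n" "j div 2 \<noteq> 0" using j by auto
        show ?thesis
        proof (cases "even j")
          case True then show ?thesis using Xz[OF i(1)] i(2) by (simp add: X_def)
        next
          case False
          then have "Y (j div 2) z = z j" using i(2) by (simp add: Y_def)
          then show ?thesis using Yz[OF i(1)] by simp
        qed
      qed
    qed
  qed (use \<xi> in \<open>auto simp: X_def Y_def\<close>)
qed

text \<open>On the whole space the two families may meet, in points where the coordinates moved by a
  root are 0. Tying the coordinates 1 to \<open>n\<close> of the first point to the single variable
  \<open>z 2\<close> excludes this: a root that moves one of them forces all to vanish. The slice
  has dimension \<open>n + 3\<close>.\<close>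

lemma sections_gt_dim:
  assumes q0: "q 0 = 1" and dvd: "\<And>i. i \<le> n \<Longrightarrow> q i dvd D" and i0: "1 \<le> i0" "i0 \<le> n" "q i0 \<noteq> D"
  shows "n + 1 \<le> N"
proof (rule ccontr)
  assume N: "\<not> n + 1 \<le> N"
  have "0 < q i0" "q i0 < D" using qpos i0 dvd_imp_le[OF dvd[OF i0(2)] Dpos] by auto
  then obtain \<xi> :: complex where \<xi>: "\<xi> ^ D = 1" "\<xi> ^ q i0 \<noteq> 1" by (rule root_of_unity_not_of_order)
  define X :: "nat \<Rightarrow> pt \<Rightarrow> complex" where "X i = (if i = 0 then (\<lambda>z. z 0 + z 1) else (\<lambda>z. z 2))" for i
  define Y :: "nat \<Rightarrow> pt \<Rightarrow> complex" where "Y i = (if i = 0 then (\<lambda>z. z 0 + \<xi> * z 1) else (\<lambda>z. z (i + 2)))" for i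
  show False
  proof (rule no_separating_slice[where m="n + 3" and X=X and Y=Y and \<xi>=\<xi> and
        LA="{l. l ^ D = 1 \<and> (\<forall>i\<in>{1..n}. l ^ q i = 1)}" and LB="{l. l ^ D = 1 \<and> \<not> (\<forall>i\<in>{1..n}. l ^ q i = 1)}"])
    show "q 0 = 1" by (rule q0)
    show "N + 3 \<le> n + 3" using N by simp
    show "X i \<in> poly_fun (n + 3)" "Y i \<in> poly_fun (n + 3)" if "i \<le> n" for i
      using that unfolding X_def Y_def by (auto intro!: poly_fun.intros)
    show "X i (\<lambda>k. c * z k) = c * X i z" "Y i (\<lambda>k. c * z k) = c * Y i z" for i c z
      unfolding X_def Y_def by (auto simp: algebra_simps)
    show "X i z = 0 \<and> Y i z = 0" if "\<And>k. 2 \<le> k \<Longrightarrow> k < n + 3 \<Longrightarrow> z k = 0" "1 \<le> i" "i \<le> n" for z i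
      using that unfolding X_def Y_def by auto
    show "z j = 0" if l: "l \<in> {l. l ^ D = 1 \<and> (\<forall>i\<in>{1..n}. l ^ q i = 1)}"
      "l' \<in> {l. l ^ D = 1 \<and> \<not> (\<forall>i\<in>{1..n}. l ^ q i = 1)}"
      and Yl: "\<And>i. i \<le> n \<Longrightarrow> Y i z = l ^ q i * X i z" "\<And>i. i \<le> n \<Longrightarrow> Y i z = l' ^ q i * X i z"
      and j: "j < n + 3" for l l' z j
    proof -
      obtain i1 where i1: "i1 \<in> {1..n}" "l' ^ q i1 \<noteq> 1" using l(2) by blast
      then have "Y i1 z = z 2" "Y i1 z = l' ^ q i1 * z 2"
        using Yl[of i1] l(1) by (auto simp: X_def)
      then have z2: "z 2 = 0" using i1(2) by simp
      then have "z (i + 2) = 0" if "1 \<le> i" "i \<le> n" for i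
        using Yl(1)[of i] that by (simp add: X_def Y_def)
      moreover have "z 0 = 0 \<and> z 1 = 0"
      proof -
        have "X 0 z = 0"
        proof (rule ccontr)
          assume "X 0 z \<noteq> 0"
          then have "l = l'" using Yl[of 0] q0 by simp
          then show False using l by blast
        qed
        then have e: "z 0 + z 1 = 0" "z 0 + \<xi> * z 1 = 0" using Yl(1)[of 0] by (auto simp: X_def Y_def)
        then have "(z 0 + \<xi> * z 1) - (z 0 + z 1) = 0" by (simp only: diff_self)
      then have "(\<xi> - 1) * z 1 = 0" by (simp only: algebra_simps) simp
        moreover have "\<xi> \<noteq> 1" using \<xi> by auto
        ultimately show ?thesis using e by simp
      qed
      moreover have "j = 0 \<or> j = 1 \<or> j = 2 \<or> (\<exists>i. 1 \<le> i \<and> i \<le> n \<and> j = i + 2)"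
        using j by (cases "j \<le> 2") (auto intro!: exI[of _ "j - 2"])
      ultimately show ?thesis using z2 by auto
    qed
  qed (use \<xi> i0 in \<open>auto simp: X_def Y_def\<close>)
qed

end

section \<open>Weighted monomials, orbits and simultaneous roots\<close>

lemma H0_zero: "(\<lambda>x. 0) \<in> H0 q n m"
  unfolding H0_def by (auto intro!: exI[of _ "\<lambda>_. 0"])

lemma H0_add: "f \<in> H0 q n m \<Longrightarrow> g \<in> H0 q n m \<Longrightarrow> (\<lambda>x. f x + g x) \<in> H0 q n m"
proof -
  assume "f \<in> H0 q n m" "g \<in> H0 q n m"
  then obtain c c' where "f = (\<lambda>x. \<Sum>\<alpha>\<in>exps q n m. c \<alpha> * mono n \<alpha> x)" "g = (\<lambda>x. \<Sum>\<alpha>\<in>exps q n m. c' \<alpha> * mono n \<alpha> x)"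
    unfolding H0_def by blast
  then show ?thesis unfolding H0_def
    by (auto intro!: exI[of _ "\<lambda>\<alpha>. c \<alpha> + c' \<alpha>"] simp: sum.distrib distrib_right)
qed

lemma H0_sum: "(\<And>i. i \<in> I \<Longrightarrow> f i \<in> H0 q n m) \<Longrightarrow> (\<lambda>x. \<Sum>i\<in>I. f i x) \<in> H0 q n m"
  by (induction I rule: infinite_finite_induct) (auto intro: H0_zero H0_add)

lemma H0_monomial:
  assumes qpos: "\<forall>i\<le>n. q i > 0" and ij: "i \<le> n" "j \<le> n" and deg: "q i * e + q j * f = D"
  shows "(\<lambda>x. x i ^ e * x j ^ f) \<in> H0 q n (int D)"
proof -
  define \<alpha> where "\<alpha> k = (if k = i then e else 0) + (if k = j then f else 0)" for k
  have "mono n \<alpha> x = x i ^ e * x j ^ f" for x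
  proof -
    have "mono n \<alpha> x = (\<Prod>k\<le>n. (if k = i then x i ^ e else 1) * (if k = j then x j ^ f else 1))"
      unfolding mono_def \<alpha>_def by (intro prod.cong) (auto simp: power_add)
    also have "\<dots> = x i ^ e * x j ^ f" using ij by (simp add: prod.distrib)
    finally show ?thesis .
  qed
  moreover have "wdeg q n \<alpha> = D"
  proof -
    have "wdeg q n \<alpha> = (\<Sum>k\<le>n. (if k = i then q i * e else 0) + (if k = j then q j * f else 0))"
      unfolding wdeg_def \<alpha>_def by (intro sum.cong) (auto simp: algebra_simps)
    also have "\<dots> = D" using ij deg by (simp add: sum.distrib)
    finally show ?thesis .
  qed
  then have "\<alpha> \<in> exps q n (int D)" using ij unfolding exps_def by (auto simp: \<alpha>_def)
  then have "(\<Sum>\<beta>\<in>exps q n (int D). (if \<beta> = \<alpha> then 1 else 0) * mono n \<beta> x) = mono n \<alpha> x" for x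
    using finite_exps[OF qpos] by (simp add: if_distrib[where f="\<lambda>c. c * _"] cong: if_cong)
  ultimately show ?thesis unfolding H0_def
    by (auto intro!: exI[of _ "\<lambda>\<beta>. if \<beta> = \<alpha> then 1 else 0"])
qed

lemma wps_equiv_act:
  assumes "l \<noteq> 0" "wps_equiv q n x (\<lambda>i. l ^ q i * y i)"
  shows "wps_equiv q n x y"
proof -
  obtain l' where "l' \<noteq> 0" "\<forall>i\<le>n. l ^ q i * y i = l' ^ q i * x i" using assms(2) unfolding wps_equiv_def by blast
  then show ?thesis unfolding wps_equiv_def using assms(1)
    by (intro exI[of _ "l' / l"]) (auto simp: power_divide field_simps)
qed

lemma wps_equiv_eq: "(\<And>i. i \<le> n \<Longrightarrow> x i = y i) \<Longrightarrow> wps_equiv q n x y"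
  unfolding wps_equiv_def by (intro exI[of _ 1]) auto

text \<open>Chinese remaindering in multiplicative form: for each \<open>i\<close> there is a root
  of unity with \<open>q i\<close>-th power \<zeta>_i and all other \<open>q j\<close>-th powers
  equal to 1; \<open>l\<close> is the product of these.\<close>

lemma simultaneous_roots:
  fixes \<zeta> :: "nat \<Rightarrow> complex"
  assumes fin: "finite I" and pos: "\<And>i. i \<in> I \<Longrightarrow> q i > 0" and prod: "\<And>i. i \<in> I \<Longrightarrow> q i * a i = d"
    and cop: "\<And>i j. i \<in> I \<Longrightarrow> j \<in> I \<Longrightarrow> i \<noteq> j \<Longrightarrow> coprime (a i) (a j)"
    and \<zeta>: "\<And>i. i \<in> I \<Longrightarrow> \<zeta> i ^ a i = 1" and d: "d > 0"
  obtains l where "l \<noteq> 0" "\<And>i. i \<in> I \<Longrightarrow> l ^ q i = \<zeta> i"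
proof -
  have "\<exists>l. l ^ d = 1 \<and> l ^ q i = \<zeta> i \<and> (\<forall>j\<in>I - {i}. l ^ q j = 1)" if i: "i \<in> I" for i
  proof -
    obtain \<mu> where \<mu>: "\<mu> ^ q i = \<zeta> i" using complex_root_exists[OF pos[OF i]] .
    have \<mu>d: "\<mu> ^ d = 1" using \<mu> \<zeta>[OF i] prod[OF i] by (metis power_mult)
    \<comment> \<open>The exponent \<open>A * x\<close> is divisible by \<open>a j\<close> for all
      other \<open>j\<close>, which trivializes the \<open>q j\<close>-th power since
      \<open>q j * a j = d\<close>; modulo \<open>a i\<close> it is 1, which preserves
      \<zeta>_i.\<close>
    define A where "A = (\<Prod>j\<in>I - {i}. a j)"
    have "coprime A (a i)" unfolding A_def using cop i by (intro prod_coprime_left) auto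
    then obtain x where x: "[A * x = 1] (mod a i)" using cong_solve_coprime_nat[of A "a i"] by (metis One_nat_def)
    have "\<zeta> i ^ (A * x) = \<zeta> i ^ ((A * x) mod a i)"
    proof -
      have "\<zeta> i ^ (A * x) = \<zeta> i ^ (a i * ((A * x) div a i) + (A * x) mod a i)"
        by (simp only: mult_div_mod_eq)
      also have "\<dots> = \<zeta> i ^ ((A * x) mod a i)" unfolding power_add power_mult using \<zeta>[OF i] by simp
      finally show ?thesis .
    qed
    also have "\<dots> = \<zeta> i ^ (a i * (1 div a i) + 1 mod a i)"
      using x \<zeta>[OF i] unfolding power_add power_mult by (simp add: cong_def)
    also have "\<dots> = \<zeta> i" by (simp only: mult_div_mod_eq power_one_right)
    finally have z: "\<zeta> i ^ (A * x) = \<zeta> i" .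
    have "(\<mu> ^ (A * x)) ^ q j = 1" if j: "j \<in> I - {i}" for j
    proof -
      have "a j dvd A" unfolding A_def using fin j by (intro dvd_prodI) auto
      then obtain e where "A = a j * e" by blast
      then have "A * x * q j = d * (e * x)" using prod[of j] j by (simp add: ac_simps)
      then show ?thesis by (metis \<mu>d power_mult power_one)
    qed
    moreover have "(\<mu> ^ (A * x)) ^ q i = \<zeta> i" using z \<mu> by (metis mult.commute power_mult)
    moreover have "(\<mu> ^ (A * x)) ^ d = 1" using \<mu>d by (metis mult.commute power_mult power_one)
    ultimately show ?thesis by blast
  qed
  then obtain L where L: "\<And>i. i \<in> I \<Longrightarrow> L i ^ d = 1" "\<And>i. i \<in> I \<Longrightarrow> L i ^ q i = \<zeta> i"
    "\<And>i j. i \<in> I \<Longrightarrow> j \<in> I - {i} \<Longrightarrow> L i ^ q j = 1" by metis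
  show ?thesis
  proof
    have "L i \<noteq> 0" if "i \<in> I" for i using L(1)[OF that] d by (auto simp: power_0_left)
    then show "(\<Prod>i\<in>I. L i) \<noteq> 0" using fin by simp
    show "(\<Prod>i\<in>I. L i) ^ q j = \<zeta> j" if j: "j \<in> I" for j
    proof -
      have "(\<Prod>i\<in>I. L i) ^ q j = (\<Prod>i\<in>I. L i ^ q j)" by (rule prod_power_distrib)
      also have "\<dots> = L j ^ q j * (\<Prod>i\<in>I - {j}. L i ^ q j)" using fin j by (rule prod.remove)
      also have "(\<Prod>i\<in>I - {j}. L i ^ q j) = 1" using L(3) j by (intro prod.neutral) auto
      finally show ?thesis using L(2)[OF j] by simp
    qed
  qed
qed

section \<open>Injective morphisms\<close>

lemma less_multiple:
  fixes u v k :: nat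
  assumes "u \<le> v" "0 < v" "2 \<le> k"
  shows "u < k * v"
proof -
  have "2 * v \<le> k * v" using assms(3) by (rule mult_le_mono1)
  then show ?thesis using assms(1,2) by linarith
qed

section \<open>Arithmetic of the weights\<close>

locale wps =
  fixes q :: "nat \<Rightarrow> nat" and n :: nat and d :: nat
    and a :: "nat \<Rightarrow> nat" and b :: "nat \<Rightarrow> nat \<Rightarrow> nat"
  assumes n1: "n \<ge> 1"
    and qpos: "\<forall>i\<le>n. q i > 0"
    and q0: "q 0 = 1"
    and d_def: "d = Lcm (q ` {1..n})"
    and lcm3: "\<forall>i\<le>n. \<forall>j\<le>n. \<forall>k\<le>n. i \<noteq> j \<and> i \<noteq> k \<and> j \<noteq> k \<longrightarrow>
                 lcm (q i) (lcm (q j) (q k)) = d"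
    and a_def: "\<forall>i. a i = d div q i"
    and b_def: "\<forall>i j. b i j = lcm (q i) (q j) div q i"
begin

lemma d_pos: "d > 0"
proof -
  have "0 \<notin> q ` {1..n}" using qpos by auto
  then have "Lcm (q ` {1..n}) \<noteq> 0" by (metis Lcm_0_iff finite_imageI finite_atLeastAtMost)
  then show ?thesis by (simp only: d_def neq0_conv)
qed

lemma q_dvd: "i \<le> n \<Longrightarrow> q i dvd d"
  using q0 unfolding d_def by (cases "i = 0") (auto intro!: dvd_Lcm)

lemma q_a: "i \<le> n \<Longrightarrow> q i * a i = d"
  using q_dvd[of i] a_def by simp

lemma a_pos: "i \<le> n \<Longrightarrow> a i > 0"
  using q_a[of i] d_pos by (metis gr0I mult_0_right less_irrefl)

lemma q_le: "i \<le> n \<Longrightarrow> q i \<le> d"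
  using q_dvd d_pos by (simp add: dvd_imp_le)

text \<open>Index 0, of weight 1, serves as the third index.\<close>

lemma lcm2: "i \<in> {1..n} \<Longrightarrow> j \<in> {1..n} \<Longrightarrow> i \<noteq> j \<Longrightarrow> lcm (q i) (q j) = d"
  using lcm3[rule_format, of i j 0] q0 by auto

text \<open>A common divisor \<open>c\<close> of \<open>a i\<close> and \<open>a j\<close> makes
  \<open>d / c\<close> a common multiple of \<open>q i\<close> and \<open>q j\<close>, whose least
  common multiple is \<open>d\<close>.\<close>

lemma coprime_a:
  assumes "i \<in> {1..n}" "j \<in> {1..n}" "i \<noteq> j"
  shows "coprime (a i) (a j)"
proof (rule coprimeI)
  fix c assume "c dvd a i" "c dvd a j"
  then obtain u v where uv: "a i = c * u" "a j = c * v" by blast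
  have di: "d = c * (q i * u)" "d = c * (q j * v)" using q_a[of i] q_a[of j] assms uv by (auto simp: ac_simps)
  then have "c > 0" using d_pos by auto
  then have eq: "q i * u = q j * v" using di by auto
  then have "lcm (q i) (q j) dvd q i * u" by (metis dvd_triv_left lcm_least)
  then have "c * (q i * u) dvd 1 * (q i * u)" using lcm2[OF assms] di by simp
  moreover have X: "q i * u > 0" using di(1) d_pos by (metis gr0I less_irrefl mult_0_right)
  ultimately have "c * (q i * u) \<le> 1 * (q i * u)" by (intro dvd_imp_le) auto
  then have "c \<le> 1" using X by (simp only: mult_le_cancel2)
  then show "is_unit c" using \<open>c > 0\<close> by (simp add: le_Suc_eq)
qed

lemma b_0: "b 0 j = q j" "i \<le> n \<Longrightarrow> b i 0 = 1" "i \<le> n \<Longrightarrow> b i i = 1"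
  using b_def q0 qpos by auto

lemma b_a: "i \<in> {1..n} \<Longrightarrow> j \<in> {1..n} \<Longrightarrow> i \<noteq> j \<Longrightarrow> b i j = a i"
  using b_def a_def lcm2 by simp

lemma a_0: "a 0 = d" using a_def q0 by simp

lemma q_b: "q i * b i j = lcm (q i) (q j)"
  using b_def by simp

lemma b_le: "i \<le> n \<Longrightarrow> j \<le> n \<Longrightarrow> b i j \<le> a i"
proof -
  assume "i \<le> n" "j \<le> n"
  then have "lcm (q i) (q j) dvd d" using q_dvd by auto
  then have "q i * b i j \<le> q i * a i" using q_b q_a[OF \<open>i \<le> n\<close>] d_pos by (simp add: dvd_imp_le)
  then show ?thesis using qpos \<open>i \<le> n\<close> by simp
qed

text \<open>The quotients \<open>y i / x i\<close> are roots of unity whose orders divide the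
  pairwise coprime \<open>a i\<close>, so a single \<open>l\<close> realizes them all. Coordinates
  that vanish in \<open>x\<close> vanish in \<open>y\<close> too and are left out of
  \<open>I\<close>.\<close>

lemma wps_equiv_of_equal_powers:
  assumes "x 0 = 0" "y 0 = 0" "\<And>i. i \<in> {1..n} \<Longrightarrow> x i ^ a i = y i ^ a i"
  shows "wps_equiv q n x y"
proof -
  define I where "I = {i \<in> {1..n}. x i \<noteq> 0}"
  obtain l where l: "l \<noteq> 0" "\<And>i. i \<in> I \<Longrightarrow> l ^ q i = y i / x i"
  proof (rule simultaneous_roots[of I q a d "\<lambda>i. y i / x i"])
    show "finite I" "d > 0" using d_pos by (auto simp: I_def)
    show "q i > 0" if "i \<in> I" for i using that qpos by (auto simp: I_def)
    show "q i * a i = d" if "i \<in> I" for i using that q_a by (auto simp: I_def)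
    show "coprime (a i) (a j)" if "i \<in> I" "j \<in> I" "i \<noteq> j" for i j using that coprime_a by (auto simp: I_def)
    show "(y i / x i) ^ a i = 1" if "i \<in> I" for i
      using that assms(3)[of i] by (auto simp: I_def power_divide[of "y i"] simp flip: assms(3))
  qed blast
  have "y i = l ^ q i * x i" if "i \<le> n" for i
  proof -
    consider "i = 0" | "i \<in> I" | "i \<in> {1..n}" "x i = 0" using \<open>i \<le> n\<close> by (force simp: I_def)
    then show ?thesis
    proof cases
      case 3
      then have "y i ^ a i = 0" using assms(3)[of i] a_pos[of i] by (auto simp: power_0_left)
      then show ?thesis using 3 by simp
    qed (use assms l(2)[of i] in \<open>auto simp: I_def\<close>)
  qed
  then show ?thesis unfolding wps_equiv_def using l(1) by blast
qed

lemma wps_equiv_of_proportional_powers: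
  assumes "x 0 = 0" "y 0 = 0" "c \<noteq> 0" "\<And>i. i \<in> {1..n} \<Longrightarrow> x i ^ a i = c * y i ^ a i"
  shows "wps_equiv q n x y"
proof -
  obtain l where l: "l ^ d = c" using complex_root_exists[OF d_pos] .
  have "wps_equiv q n x (\<lambda>i. l ^ q i * y i)"
  proof (rule wps_equiv_of_equal_powers)
    show "x i ^ a i = (l ^ q i * y i) ^ a i" if "i \<in> {1..n}" for i
      using that assms(4)[OF that] q_a[of i] l by (simp add: power_mult_distrib power_mult[symmetric])
  qed (use assms in auto)
  moreover have "l \<noteq> 0" using l assms(3) d_pos by (auto simp: power_0_left)
  ultimately show ?thesis by (rule wps_equiv_act[rotated])
qed

text \<open>Moving \<open>y\<close> within its orbit until the first coordinates agree turns
  proportionality into equality, because the first section is a pure power of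
  \<open>x 0\<close>.\<close>

lemma match_first_coordinate:
  fixes F :: "nat \<Rightarrow> pt \<Rightarrow> complex"
  assumes F: "\<And>j. j \<le> N \<Longrightarrow> F j \<in> H0 q n (int D)" and F0: "\<And>x. F 0 x = x 0 ^ D" and D: "D > 0"
    and eq: "\<And>j. j \<le> N \<Longrightarrow> F j x = c * F j y" and x0: "x 0 \<noteq> 0"
  obtains l where "l \<noteq> 0" "l * y 0 = x 0" "\<And>j. j \<le> N \<Longrightarrow> F j x = F j (\<lambda>i. l ^ q i * y i)"
proof
  have e0: "x 0 ^ D = c * y 0 ^ D" using eq[OF le0] by (simp only: F0)
  then have y0: "y 0 \<noteq> 0" using x0 D by (auto simp: power_0_left)
  show "x 0 / y 0 \<noteq> 0" "x 0 / y 0 * y 0 = x 0" using x0 y0 by auto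
  have "(x 0 / y 0) ^ D = c" using e0 y0 by (simp add: power_divide)
  then show "F j x = F j (\<lambda>i. (x 0 / y 0) ^ q i * y i)" if "j \<le> N" for j
    using H0_scale[OF F[OF that]] eq[OF that] by simp
qed

section \<open>The morphism given by n + 2 sections of degree d\<close>

definition F1 :: "nat \<Rightarrow> pt \<Rightarrow> complex" where
  "F1 = (\<lambda>l x. if l = 0 then x 0 ^ d
                     else if l = 1 then x 0 ^ (d - q 1) * x 1
                     else if l \<le> n then x (l - 1) ^ a (l - 1) + x 0 ^ (d - q l) * x l
                     else x n ^ a n)"

lemma F1_H0: "l \<le> n + 1 \<Longrightarrow> F1 l \<in> H0 q n (int d)"
proof -
  assume l: "l \<le> n + 1"
  have pw: "(\<lambda>x. x i ^ a i) \<in> H0 q n (int d)" if "i \<le> n" for i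
    using H0_monomial[OF qpos that that, of "a i" 0 d] q_a[OF that] by simp
  have m: "(\<lambda>x. x 0 ^ (d - q i) * x i) \<in> H0 q n (int d)" if "i \<le> n" for i
    using H0_monomial[OF qpos _ that, of 0 "d - q i" 1 d] q_le[OF that] q0 by simp
  consider "l = 0" | "l = 1" | "2 \<le> l" "l \<le> n" | "l = n + 1" "l \<ge> 2" using l n1 by linarith
  then show ?thesis
  proof cases
    case 1 then show ?thesis using pw[of 0] a_0 by (simp add: F1_def)
  next
    case 2 then show ?thesis using m[of 1] n1 by (simp add: F1_def)
  next
    case 3
    then show ?thesis using H0_add[OF pw[of "l - 1"] m[of l]] by (simp add: F1_def)
  next
    case 4 then show ?thesis using pw[of n] by (simp add: F1_def)
  qed
qed

text \<open>Downward induction from the last section, a pure power. As \<open>c = 0\<close> is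
  allowed, it also shows that there are no common zeros.\<close>

lemma F1_powers:
  assumes x0: "x 0 = 0" and y0: "y 0 = 0" and eq: "\<And>l. l \<le> n + 1 \<Longrightarrow> F1 l x = c * F1 l y"
    and i: "i \<in> {1..n}"
  shows "x i ^ a i = c * y i ^ a i"
proof -
  \<comment> \<open>If \<open>q l = d\<close>, the factor is \<open>0 ^ 0 = 1\<close> and the linear
    term survives on \<open>x 0 = 0\<close>. Then \<open>a l = 1\<close>, so it is the power treated
    in the preceding induction step.\<close>
  have z: "0 ^ (d - q l) * w l = (if q l = d then w l ^ a l else 0)" if "l \<in> {1..n}" for l and w :: pt
  proof (cases "q l = d")
    case True
    then have "a l = 1" using a_def d_pos by simp
    then show ?thesis using True by simp
  next
    case False
    then have "q l < d" using q_le[of l] that by simp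
    then show ?thesis using False by (simp add: power_0_left)
  qed
  have "x (n - k) ^ a (n - k) = c * y (n - k) ^ a (n - k)" if "k < n" for k
    using that
  proof (induction k)
    case 0
    show ?case using eq[of "n + 1"] n1 by (simp add: F1_def)
  next
    case (Suc k)
    define l where "l = n - k"
    have l: "l - 1 = n - Suc k" "2 \<le> l" "l \<le> n" using Suc by (auto simp: l_def)
    have IH: "x l ^ a l = c * y l ^ a l" using Suc by (simp add: l_def)
    have "x (l - 1) ^ a (l - 1) + 0 ^ (d - q l) * x l = c * (y (l - 1) ^ a (l - 1) + 0 ^ (d - q l) * y l)"
      using eq[of l] l x0 y0 by (simp add: F1_def)
    then have "x (l - 1) ^ a (l - 1) = c * y (l - 1) ^ a (l - 1)"
      using z[of l x] z[of l y] l IH by (auto simp: algebra_simps split: if_splits)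
    then show ?case using l by simp
  qed
  from this[of "n - i"] show ?thesis using i by auto
qed

lemma F1_inj: "inj_morph q n (n + 1) F1"
  unfolding inj_morph_def
proof (intro conjI allI impI)
  have bp: "\<exists>i\<le>n + 1. F1 i x \<noteq> 0" if pt: "wps_pt n x" for x
  proof (rule ccontr)
    assume "\<not> ?thesis"
    then have z: "\<And>l. l \<le> n + 1 \<Longrightarrow> F1 l x = 0" by blast
    have x0: "x 0 = 0" using z[of 0] by (simp add: F1_def)
    \<comment> \<open>The instance \<open>c = 0\<close>, with \<open>x\<close> in both
      places.\<close>
    have "x i = 0" if "i \<le> n" for i
      using F1_powers[where x=x and y=x and c=0 and i=i, OF x0 x0] z x0 that by (cases "i = 0") auto
    then show False using pt unfolding wps_pt_def by blast
  qed
  show "\<exists>i\<le>n + 1. F1 i x \<noteq> 0" if "wps_pt n x" for x by (rule bp[OF that])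
  fix x y assume pt: "wps_pt n x" "wps_pt n y" and "\<exists>c. \<forall>i\<le>n + 1. F1 i x = c * F1 i y"
  then obtain c where eq: "\<And>l. l \<le> n + 1 \<Longrightarrow> F1 l x = c * F1 l y" by blast
  have c: "c \<noteq> 0" using bp[OF pt(1)] eq by fastforce
  have F0: "F1 0 x = x 0 ^ d" for x by (simp add: F1_def)
  show "wps_equiv q n x y"
  proof (cases "x 0 = 0")
    case True
    then have "y 0 ^ d = 0" using eq[of 0] c d_pos F0 by (simp add: power_0_left)
    then have "y 0 = 0" by simp
    then show ?thesis
      using wps_equiv_of_proportional_powers[where x=x and y=y and c=c] F1_powers[where x=x and y=y and c=c] True c eq
      by blast
  next
    case False
    obtain l where l: "l \<noteq> 0" "l * y 0 = x 0" "\<And>j. j \<le> n + 1 \<Longrightarrow> F1 j x = F1 j (\<lambda>i. l ^ q i * y i)"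
      using match_first_coordinate[where N="n + 1" and F=F1 and D=d and x=x and c=c and y=y,
            OF F1_H0 F0 d_pos eq False] by blast
    define w where "w i = l ^ q i * y i" for i
    have w: "w 0 = x 0" "\<And>j. j \<le> n + 1 \<Longrightarrow> F1 j x = F1 j w" using l q0 by (auto simp: w_def[abs_def])
    have "x i = w i" if "i \<le> n" for i
      using that
    proof (induction i)
      case 0 then show ?case using w by simp
    next
      case (Suc i)
      then have IH: "x i = w i" by simp
      show ?case
      proof (cases "i = 0")
        case True
        then show ?thesis using w(2)[of 1] w(1) False by (simp add: F1_def)
      next
        case i: False
        then show ?thesis using w(2)[of "Suc i"] w(1) False IH Suc.prems by (simp add: F1_def)
      qed
    qed
    then have "wps_equiv q n x w" by (rule wps_equiv_eq)
    then show ?thesis unfolding w_def[abs_def] by (rule wps_equiv_act[OF l(1)])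
  qed
qed

text \<open>On the plane of coordinates 0 and \<open>i\<close> only \<open>c 0\<close>,
  \<open>c i\<close> and \<open>c (Suc i)\<close> remain. This yields \<open>c 0 = 0\<close> and
  makes all further coefficients equal up to sign, so a single zero among them suffices.\<close>

lemma F1_indep:
  assumes neq: "\<not> (\<forall>i\<in>{1..n}. \<forall>j\<in>{1..n}. q i = q j)"
  shows "lin_indep_fams (n + 1) F1"
  unfolding lin_indep_fams_def
proof (intro allI impI)
  fix c l assume c: "\<forall>x. (\<Sum>i\<le>n + 1. c i * F1 i x) = 0" and l: "l \<le> n + 1"
  define p where "p i s t = (\<lambda>k. if k = 0 then s else if k = i then t else (0::complex))" for i :: nat and s t
  have F0: "F1 0 x = x 0 ^ d" for x by (simp add: F1_def)
  have F1p: "F1 k (p i s t) = (if k = 0 then s ^ d else if k = i then s ^ (d - q i) * t else if k = Suc i then t ^ a i else 0)"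
    if i: "i \<in> {1..n}" and k: "k \<le> n + 1" for i k s t
  proof -
    have ap: "j \<le> n \<Longrightarrow> a j \<noteq> 0" for j using a_pos[of j] by simp
    consider "k = 0" | "k = 1" | "2 \<le> k" "k \<le> n" | "k = n + 1" "k \<ge> 2" using k n1 by linarith
    then show ?thesis
    proof cases
      case 1 then show ?thesis by (simp add: F1_def p_def)
    next
      case 2 then show ?thesis using i by (auto simp: F1_def p_def)
    next
      case 3
      then obtain k' where k': "k = Suc k'" "k' \<ge> 1" by (cases k) auto
      then show ?thesis using i 3 ap[of k'] by (auto simp: F1_def p_def power_0_left)
    next
      case 4 then show ?thesis using i ap[of n] by (auto simp: F1_def p_def power_0_left)
    qed
  qed
  have eq: "c 0 * s ^ d + c i * (s ^ (d - q i) * t) + c (Suc i) * t ^ a i = 0" if i: "i \<in> {1..n}" for i s t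
  proof -
    have "0 = (\<Sum>k\<le>n + 1. c k * F1 k (p i s t))" using c by simp
    also have "\<dots> = (\<Sum>k\<in>{0, i, Suc i}. c k * F1 k (p i s t))"
      using i by (intro sum.mono_neutral_right) (auto simp: F1p)
    also have "\<dots> = c 0 * s ^ d + c i * (s ^ (d - q i) * t) + c (Suc i) * t ^ a i"
      using i by (simp add: F1p)
    finally show ?thesis by simp
  qed
  have c0: "c 0 = 0" using eq[of 1 1 0] n1 a_pos[of 1] by (simp add: power_0_left)
  have st: "c (Suc i) = - c i" if "i \<in> {1..n}" for i
    using eq[OF that, of 1 1] c0 by (simp add: add_eq_0_iff)
  \<comment> \<open>If all weights were \<open>d\<close> they would be equal. For
    \<open>q i0 < d\<close> the mixed term vanishes at \<open>s = 0\<close>, which isolates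
    \<open>c (Suc i0)\<close>.\<close>
  obtain i0 where i0: "i0 \<in> {1..n}" "q i0 \<noteq> d" using neq by metis
  then have "q i0 < d" using q_le[of i0] by auto
  then have "c (Suc i0) = 0" using eq[OF i0(1), of 0 1] c0 by (simp add: power_0_left)
  then have ci0: "c i0 = 0" using st[OF i0(1)] by simp
  have nc: "norm (c (Suc k)) = norm (c 1)" if "k \<le> n" for k
    using that
  proof (induction k)
    case (Suc k)
    then show ?case using st[of "Suc k"] by simp
  qed simp
  have "norm (c (Suc (i0 - 1))) = norm (c 1)" using i0 by (intro nc) auto
  then have "c 1 = 0" using i0 ci0 by simp
  then have "c (Suc k) = 0" if "k \<le> n" for k using nc[OF that] by simp
  then show "c l = 0" using c0 l by (cases l) auto
qed

section \<open>The morphism given by 2n + 1 sections of degree kd\<close>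

definition Gk :: "nat \<Rightarrow> nat \<Rightarrow> pt \<Rightarrow> complex" where
  "Gk k = (\<lambda>l x. \<Sum>(i, j) \<in> {(i, j). i \<le> n \<and> j \<le> n \<and> i \<le> j \<and> i + j = l}.
                          x i ^ (k * a i - b i j) * x j ^ b j i)"

definition index_pairs :: "nat \<Rightarrow> (nat \<times> nat) set" where
  "index_pairs l = {(i, j). i \<le> n \<and> j \<le> n \<and> i \<le> j \<and> i + j = l}"

lemma finite_index_pairs: "finite (index_pairs l)"
  by (rule finite_subset[of _ "{..n} \<times> {..n}"]) (auto simp: index_pairs_def)

lemma Gk_eq: "Gk k l x = (\<Sum>(i, j) \<in> index_pairs l. x i ^ (k * a i - b i j) * x j ^ b j i)"
  by (simp add: Gk_def index_pairs_def)

lemma Gk_H0: "k \<ge> 2 \<Longrightarrow> Gk k l \<in> H0 q n (int (k * d))"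
proof -
  assume k: "k \<ge> 2"
  have "(\<lambda>x. \<Sum>p \<in> index_pairs l. (case p of (i, j) \<Rightarrow> \<lambda>x. x i ^ (k * a i - b i j) * x j ^ b j i) x) \<in> H0 q n (int (k * d))"
  proof (rule H0_sum)
    fix p assume "p \<in> index_pairs l"
    then obtain i j where p: "p = (i, j)" "i \<le> n" "j \<le> n" by (auto simp: index_pairs_def)
    have "b i j \<le> k * a i" using less_multiple[OF b_le[OF p(2,3)] a_pos[OF p(2)] k] by simp
    then have "q i * (k * a i - b i j) + q j * b j i = q i * (k * a i) - q i * b i j + q i * b i j"
      using q_b[of i j] q_b[of j i] by (simp add: diff_mult_distrib2 lcm.commute)
    also have "\<dots> = q i * (k * a i)" using \<open>b i j \<le> k * a i\<close> by simp
    also have "\<dots> = k * d" using q_a[OF p(2)] by (simp add: ac_simps)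
    finally show "(case p of (i, j) \<Rightarrow> \<lambda>x. x i ^ (k * a i - b i j) * x j ^ b j i) \<in> H0 q n (int (k * d))"
      using H0_monomial[OF qpos p(2,3)] unfolding p(1) prod.case by blast
  qed
  moreover have "Gk k l = (\<lambda>x. \<Sum>p \<in> index_pairs l. (case p of (i, j) \<Rightarrow> \<lambda>x. x i ^ (k * a i - b i j) * x j ^ b j i) x)"
    by (auto simp: Gk_eq fun_eq_iff intro!: sum.cong)
  ultimately show ?thesis by simp
qed

lemma Gk_0: "k \<ge> 2 \<Longrightarrow> Gk k 0 x = x 0 ^ (k * d)"
proof -
  assume "k \<ge> 2"
  have "index_pairs 0 = {(0, 0)}" by (auto simp: index_pairs_def)
  then show ?thesis using b_0(3)[of 0] a_0 d_pos \<open>k \<ge> 2\<close>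
    by (simp add: Gk_eq power_add[symmetric] power_Suc2[symmetric] del: power_Suc)
qed

text \<open>For distinct \<open>i\<close>, \<open>j\<close> in \<open>{1..n}\<close> the lcm
  condition gives \<open>b i j = a i\<close>, so on \<open>x 0 = 0\<close> the sections are
  polynomials in the powers \<open>x i ^ a i\<close> alone.\<close>

lemma Gk_powers:
  assumes x0: "x 0 = 0" and k: "k \<ge> 2"
  shows "Gk k l x = (\<Sum>(i, j) \<in> index_pairs l. (x i ^ a i) ^ (k - 1) * x j ^ a j)"
  unfolding Gk_eq
proof (intro sum.cong refl, clarify)
  fix i j assume "(i, j) \<in> index_pairs l"
  then have ij: "i \<le> n" "j \<le> n" "i \<le> j" by (auto simp: index_pairs_def)
  have ai: "a i > 0" using a_pos[OF ij(1)] .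
  show "x i ^ (k * a i - b i j) * x j ^ b j i = (x i ^ a i) ^ (k - 1) * x j ^ a j"
  proof (cases "i = 0")
    case True
    \<comment> \<open>Both sides are 0: the exponents of \<open>x 0\<close>,
      \<open>k * d - q j\<close> on the left and \<open>d * (k - 1)\<close> on the right, are
      positive because \<open>k >= 2\<close>.\<close>
    have "q j < k * d" by (rule less_multiple[OF q_le[OF ij(2)] d_pos k])
    then show ?thesis using True x0 b_0(1)[of j] a_0 d_pos k by (simp add: power_0_left)
  next
    case False
    show ?thesis
    proof (cases "i = j")
      case True
      have "k * a i - 1 + 1 = a i * (k - 1) + a i"
        using ai k by (simp add: algebra_simps diff_mult_distrib2)
      then have "x i ^ (k * a i - 1 + 1) = x i ^ (a i * (k - 1) + a i)" by simp
      then show ?thesis using True b_0(3)[OF ij(1)] by (simp only: power_add power_mult power_one_right)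
    next
      case ne: False
      then have "b i j = a i" "b j i = a j" using b_a[of i j] b_a[of j i] ij False by auto
      moreover have "k * a i - a i = a i * (k - 1)" by (simp add: algebra_simps diff_mult_distrib2)
      ultimately show ?thesis by (simp add: power_mult)
    qed
  qed
qed

text \<open>Any other ordered pair with sum \<open>2 * i\<close> has its smaller index below
  \<open>i\<close>, and \<open>k >= 2\<close> keeps that factor in the term.\<close>

lemma leading_term:
  fixes X :: "nat \<Rightarrow> complex"
  assumes k: "k \<ge> 2" and i: "i \<le> n" and z: "\<And>i'. i' < i \<Longrightarrow> X i' = 0"
  shows "(\<Sum>(i, j) \<in> index_pairs (2 * i). X i ^ (k - 1) * X j) = X i ^ k"
proof -
  have "(\<Sum>(i, j) \<in> index_pairs (2 * i). X i ^ (k - 1) * X j) = (\<Sum>(i, j) \<in> {(i, i)}. X i ^ (k - 1) * X j)"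
  proof (rule sum.mono_neutral_right[OF finite_index_pairs])
    show "{(i, i)} \<subseteq> index_pairs (2 * i)" using i by (auto simp: index_pairs_def)
    show "\<forall>p\<in>index_pairs (2 * i) - {(i, i)}. (case p of (i, j) \<Rightarrow> X i ^ (k - 1) * X j) = 0"
    proof
      fix p assume "p \<in> index_pairs (2 * i) - {(i, i)}"
      then obtain i' j where p: "p = (i', j)" "i' < i" by (force simp: index_pairs_def)
      then show "(case p of (i, j) \<Rightarrow> X i ^ (k - 1) * X j) = 0" using z k by (simp add: power_0_left)
    qed
  qed
  also have "\<dots> = X i ^ (k - 1) * X i" by simp
  also have "\<dots> = X i ^ k" using k by (cases k) (auto simp: mult.commute)
  finally show ?thesis .
qed

text \<open>Where \<open>x 0\<close> is nonzero, section \<open>i\<close> is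
  \<open>x 0 ^ (k * d - q i) * x i\<close> plus terms in earlier coordinates. On
  \<open>x 0 = 0\<close> the first nonzero power \<open>X i0\<close> takes over the part of
  \<open>x 0\<close>, and section \<open>i0 + j\<close> determines \<open>X j\<close>.\<close>

lemma Gk_inj:
  assumes k: "k \<ge> 2"
  shows "inj_morph q n (2 * n) (Gk k)"
  unfolding inj_morph_def
proof (intro conjI allI impI)
  have kd: "k * d > 0" using k d_pos by simp
  note G0 = Gk_0[OF k]
  have first: "\<exists>i\<le>n. x i ^ a i \<noteq> 0 \<and> (\<forall>i'<i. x i' ^ a i' = 0)" if pt: "wps_pt n x" for x
  proof -
    have "\<exists>i. i \<le> n \<and> x i ^ a i \<noteq> 0" using pt unfolding wps_pt_def by auto
    then show ?thesis using exists_least_iff[of "\<lambda>i. i \<le> n \<and> x i ^ a i \<noteq> 0"]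
      by (metis le_trans less_imp_le)
  qed
  have bp: "\<exists>l\<le>2 * n. Gk k l x \<noteq> 0" if pt: "wps_pt n x" for x
  proof (cases "x 0 = 0")
    case True
    obtain i where i: "i \<le> n" "x i ^ a i \<noteq> 0" "\<And>i'. i' < i \<Longrightarrow> x i' ^ a i' = 0" using first[OF pt] by blast
    have "Gk k (2 * i) x = (x i ^ a i) ^ k"
      unfolding Gk_powers[where x=x, OF True k] using leading_term[OF k i(1), of "\<lambda>i. x i ^ a i"] i(3) by simp
    then have "Gk k (2 * i) x \<noteq> 0" using i(2) by simp
    then show ?thesis using i(1) by (intro exI[of _ "2 * i"]) auto
  next
    case False
    then show ?thesis using G0[of x] by (intro exI[of _ 0]) auto
  qed
  show "\<exists>l\<le>2 * n. Gk k l x \<noteq> 0" if "wps_pt n x" for x by (rule bp[OF that])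
  fix x y assume pt: "wps_pt n x" "wps_pt n y" and "\<exists>c. \<forall>i\<le>2 * n. Gk k i x = c * Gk k i y"
  then obtain c where eq: "\<And>l. l \<le> 2 * n \<Longrightarrow> Gk k l x = c * Gk k l y" by blast
  have c: "c \<noteq> 0" using bp[OF pt(1)] eq by fastforce
  show "wps_equiv q n x y"
  proof (cases "x 0 = 0")
    case False
    obtain l where l: "l \<noteq> 0" "l * y 0 = x 0" "\<And>j. j \<le> 2 * n \<Longrightarrow> Gk k j x = Gk k j (\<lambda>i. l ^ q i * y i)"
      using match_first_coordinate[where N="2 * n" and F="Gk k" and D="k * d" and x=x and c=c and y=y,
            OF Gk_H0[OF k] G0 kd eq False] by blast
    define w where "w i = l ^ q i * y i" for i
    have w: "w 0 = x 0" "\<And>j. j \<le> 2 * n \<Longrightarrow> Gk k j x = Gk k j w" using l q0 by (auto simp: w_def[abs_def])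
    have "x i = w i" if "i \<le> n" for i
      using that
    proof (induction i rule: less_induct)
      case (less i)
      show ?case
      proof (cases "i = 0")
        case True then show ?thesis using w by simp
      next
        case i0: False
        let ?f = "\<lambda>x (i, j). x i ^ (k * a i - b i j) * x j ^ b j i :: complex"
        have mem: "(0, i) \<in> index_pairs i" using less.prems by (auto simp: index_pairs_def)
        have S: "Gk k i z = ?f z (0, i) + (\<Sum>p \<in> index_pairs i - {(0, i)}. ?f z p)" for z
          unfolding Gk_eq by (rule sum.remove[OF finite_index_pairs mem])
        have "(\<Sum>p \<in> index_pairs i - {(0, i)}. ?f x p) = (\<Sum>p \<in> index_pairs i - {(0, i)}. ?f w p)"
        proof (intro sum.cong refl)
          fix p assume "p \<in> index_pairs i - {(0, i)}"
          then obtain i' j where p: "p = (i', j)" "i' < i" "j < i" "i' \<le> n" "j \<le> n"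
            by (force simp: index_pairs_def)
          then show "?f x p = ?f w p" using less.IH[of i'] less.IH[of j] by simp
        qed
        then have "?f x (0, i) = ?f w (0, i)" using w(2)[of i] S[of x] S[of w] less.prems by simp
        then show ?thesis using w(1) False b_0(2)[OF less.prems] by simp
      qed
    qed
    then have "wps_equiv q n x w" by (rule wps_equiv_eq)
    then show ?thesis unfolding w_def[abs_def] by (rule wps_equiv_act[OF l(1)])
  next
    case True
    have "y 0 ^ (k * d) = 0" using eq[of 0] c kd G0[of x] G0[of y] True by (simp add: power_0_left)
    then have y0: "y 0 = 0" by simp
    define X where "X i = x i ^ a i" for i
    define Y where "Y i = y i ^ a i" for i
    let ?G = "\<lambda>X l. \<Sum>(i, j) \<in> index_pairs l. X i ^ (k - 1) * X j :: complex"
    have e: "?G X l = c * ?G Y l" if "l \<le> 2 * n" for l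
      using eq[OF that] unfolding Gk_powers[where x=x, OF True k] Gk_powers[where x=y, OF y0 k] X_def Y_def .
    obtain i0 where i0: "i0 \<le> n" "X i0 \<noteq> 0" "\<And>i'. i' < i0 \<Longrightarrow> X i' = 0"
      using first[OF pt(1)] unfolding X_def by blast
    have Y0: "Y i = 0" if "i < i0" for i
      using that
    proof (induction i rule: less_induct)
      case (less i)
      have "X i ^ k = c * Y i ^ k"
        using e[of "2 * i"] leading_term[OF k, of i X] leading_term[OF k, of i Y] less i0 by simp
      then show ?case using i0(3)[OF less.prems] c k by (auto simp: power_0_left)
    qed
    have lk: "X i0 ^ k = c * Y i0 ^ k"
      using e[of "2 * i0"] leading_term[OF k i0(1), of X] leading_term[OF k i0(1), of Y] i0 Y0 by simp
    then have Yi0: "Y i0 \<noteq> 0" using i0(2) k by (auto simp: power_0_left)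
    \<comment> \<open>The factor \<open>c\<close> fixes only \<open>s ^ k\<close>; the position
      \<open>i0\<close> selects the root, and all other powers must follow it.\<close>
    define s where "s = X i0 / Y i0"
    have s: "s \<noteq> 0" "X i0 = s * Y i0" using Yi0 i0(2) by (auto simp: s_def)
    have sk: "s ^ k = c" using lk Yi0 by (simp add: s_def power_divide)
    have "X j = s * Y j" if "j \<le> n" for j
      using that
    proof (induction j rule: less_induct)
      case (less j)
      consider "j < i0" | "j = i0" | "j > i0" by linarith
      then show ?case
      proof cases
        case 1 then show ?thesis using i0(3) Y0 by simp
      next
        case 2 then show ?thesis using s by simp
      next
        case 3
        let ?f = "\<lambda>X (i, j). X i ^ (k - 1) * X j :: complex"
        have mem: "(i0, j) \<in> index_pairs (i0 + j)" using 3 less.prems i0(1) by (auto simp: index_pairs_def)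
        have S: "?G Z (i0 + j) = ?f Z (i0, j) + (\<Sum>p \<in> index_pairs (i0 + j) - {(i0, j)}. ?f Z p)" for Z
          by (rule sum.remove[OF finite_index_pairs mem])
        have sk': "s ^ (k - 1) * s = c" using sk k by (cases k) (auto simp: mult.commute)
        have "(\<Sum>p \<in> index_pairs (i0 + j) - {(i0, j)}. ?f X p) = (\<Sum>p \<in> index_pairs (i0 + j) - {(i0, j)}. c * ?f Y p)"
        proof (intro sum.cong refl)
          fix p assume "p \<in> index_pairs (i0 + j) - {(i0, j)}"
          then obtain i' j' where p: "p = (i', j')" "i' + j' = i0 + j" "i' \<le> j'" "i' \<noteq> i0" "i' \<le> n" "j' \<le> n"
            by (force simp: index_pairs_def)
          show "?f X p = c * ?f Y p"
          proof (cases "i' < i0")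
            case True
            then show ?thesis using i0(3)[OF True] Y0[OF True] p k by (simp add: power_0_left)
          next
            case False
            \<comment> \<open>From \<open>i' + j' = i0 + j\<close> and \<open>i0 < i' <= j'\<close>
              both indices lie strictly below \<open>j\<close>.\<close>
            then have "i' < j" "j' < j" using p by auto
            then have "X i' = s * Y i'" "X j' = s * Y j'" using less.IH p by auto
            then have "?f X p = (s ^ (k - 1) * s) * ?f Y p" using p(1) by (simp add: power_mult_distrib)
            then show ?thesis using sk' by simp
          qed
        qed
        then have "?f X (i0, j) = c * ?f Y (i0, j)"
          using e[of "i0 + j"] S[of X] S[of Y] less.prems i0(1)
          by (simp add: distrib_left sum_distrib_left[symmetric])
        then have "(s * Y i0) ^ (k - 1) * X j = (s ^ (k - 1) * s) * (Y i0 ^ (k - 1) * Y j)"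
          using s(2) sk' by simp
        then show ?thesis using s(1) Yi0 by (simp add: power_mult_distrib)
      qed
    qed
    then show ?thesis
      using wps_equiv_of_proportional_powers[where x=x and y=y, OF True y0 s(1)] unfolding X_def Y_def by auto
  qed
qed

text \<open>A unit vector at \<open>i\<close> sees only the pair \<open>(i, i)\<close> and isolates
  \<open>c (2 * i)\<close>. The sum of the unit vectors at \<open>i\<close> and \<open>Suc i\<close>
  sees, among the odd sums, only \<open>(i, Suc i)\<close>, which gives the odd
  coefficients.\<close>

lemma Gk_indep:
  assumes k: "k \<ge> 2"
  shows "lin_indep_fams (2 * n) (Gk k)"
  unfolding lin_indep_fams_def
proof (intro allI impI)
  fix c l assume c: "\<forall>x. (\<Sum>i\<le>2 * n. c i * Gk k i x) = 0" and l: "l \<le> 2 * n"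
  have van: "x i ^ (k * a i - b i j) * x j ^ b j i = 0"
    if "i \<le> n" "j \<le> n" "x i = 0 \<or> x j = 0" for i j and x :: pt
  proof -
    have "b i j < k * a i" by (rule less_multiple[OF b_le[OF that(1,2)] a_pos[OF that(1)] k])
    moreover have "b j i > 0"
      using q_b[of j i] qpos that by (metis gr0I lcm_eq_0_iff less_irrefl mult_0_right)
    ultimately show ?thesis using that(3) by (auto simp: power_0_left)
  qed
  define u where "u i = (\<lambda>k. if k = i then 1 else (0::complex))" for i :: nat
  define v where "v i = (\<lambda>k. if k = i \<or> k = Suc i then 1 else (0::complex))" for i :: nat
  have Gu: "Gk k l (u i) = (if l = 2 * i then 1 else 0)" if "i \<le> n" for l i
  proof -
    have "Gk k l (u i) = (\<Sum>p\<in>index_pairs l. if p = (i, i) then 1 else 0)"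
      unfolding Gk_eq
    proof (intro sum.cong refl)
      fix p assume "p \<in> index_pairs l"
      then obtain i' j' where p: "p = (i', j')" "i' \<le> n" "j' \<le> n" by (auto simp: index_pairs_def)
      show "(case p of (ia, j) \<Rightarrow> u i ia ^ (k * a ia - b ia j) * u i j ^ b j ia) = (if p = (i, i) then 1 else 0)"
        using van[OF p(2,3), of "u i"] p by (auto simp: u_def)
    qed
    also have "\<dots> = (if l = 2 * i then 1 else 0)"
      using finite_index_pairs that by (auto simp: index_pairs_def)
    finally show ?thesis .
  qed
  have Gv: "Gk k (2 * i + 1) (v i) = 1" if "Suc i \<le> n" for i
  proof -
    have "Gk k (2 * i + 1) (v i) = (\<Sum>p\<in>index_pairs (2 * i + 1). if p = (i, Suc i) then 1 else 0)"
      unfolding Gk_eq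
    proof (intro sum.cong refl)
      fix p assume "p \<in> index_pairs (2 * i + 1)"
      then obtain i' j' where p: "p = (i', j')" "i' \<le> n" "j' \<le> n" "i' \<le> j'" "i' + j' = 2 * i + 1" by (auto simp: index_pairs_def)
      show "(case p of (ia, j) \<Rightarrow> v i ia ^ (k * a ia - b ia j) * v i j ^ b j ia) = (if p = (i, Suc i) then 1 else 0)"
      proof (cases "i' = i")
        case True
        then have "j' = Suc i" using p by simp
        then show ?thesis using True p by (simp add: v_def)
      next
        case False
        then have "v i i' = 0" using p by (auto simp: v_def)
        then show ?thesis using van[OF p(2,3), of "v i"] p False by simp
      qed
    qed
    also have "\<dots> = 1"
      using finite_index_pairs that by (auto simp: index_pairs_def)
    finally show ?thesis .
  qed
  have even0: "c (2 * i) = 0" if "i \<le> n" for i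
  proof -
    have "(\<Sum>l\<le>2 * n. c l * Gk k l (u i)) = c (2 * i)"
      using that by (simp add: Gu if_distrib[where f="\<lambda>t. _ * t"] cong: if_cong)
    then show ?thesis using c by simp
  qed
  have odd0: "c (2 * i + 1) = 0" if "Suc i \<le> n" for i
  proof -
    have "c l * Gk k l (v i) = 0" if "l \<le> 2 * n" "l \<noteq> 2 * i + 1" for l
    proof (cases "even l")
      case True
      then obtain i' where "l = 2 * i'" by (elim evenE)
      then show ?thesis using even0[of i'] that by simp
    next
      case False
      have "Gk k l (v i) = 0"
        unfolding Gk_eq
      proof (intro sum.neutral ballI)
        fix p assume "p \<in> index_pairs l"
        then obtain i' j' where p: "p = (i', j')" "i' \<le> n" "j' \<le> n" "i' + j' = l" by (auto simp: index_pairs_def)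
        have "v i i' = 0 \<or> v i j' = 0"
          using p that False by (auto simp: v_def split: if_splits)
        then show "(case p of (ia, j) \<Rightarrow> v i ia ^ (k * a ia - b ia j) * v i j ^ b j ia) = 0"
          using van[OF p(2,3), of "v i"] p by simp
      qed
      then show ?thesis by simp
    qed
    then have "(\<Sum>l\<le>2 * n. c l * Gk k l (v i)) = (\<Sum>l\<in>{2 * i + 1}. c l * Gk k l (v i))"
      using that by (intro sum.mono_neutral_right) auto
    then show ?thesis using c Gv[OF that] by simp
  qed
  show "c l = 0"
  proof (cases "even l")
    case True then show ?thesis using even0 l by (elim evenE) auto
  next
    case False then show ?thesis using odd0 l by (elim oddE) auto
  qed
qed

section \<open>Equal weights\<close>

definition E1 :: "nat \<Rightarrow> pt \<Rightarrow> complex" where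
  "E1 l x = (if l = 0 then x 0 ^ d else x l)"

lemma equal_weights:
  assumes "\<forall>i\<in>{1..n}. \<forall>j\<in>{1..n}. q i = q j" "i \<in> {1..n}"
  shows "q i = d"
proof -
  have "q j = q i" if "j \<in> {1..n}" for j using assms that by blast
  then have "q ` {1..n} = {q i}" using assms(2) by blast
  then show ?thesis by (simp add: d_def)
qed

text \<open>Equal weights are all equal to \<open>d\<close>, and these sections give the standard
  identification of P(1,d,...,d) with projective \<open>n\<close>-space.\<close>

lemma E1_props:
  assumes eqw: "\<forall>i\<in>{1..n}. \<forall>j\<in>{1..n}. q i = q j"
  shows "l \<le> n \<Longrightarrow> E1 l \<in> H0 q n (int d)" "lin_indep_fams n E1" "inj_morph q n n E1"
proof -
  note w = equal_weights[OF eqw]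
  show "E1 l \<in> H0 q n (int d)" if "l \<le> n"
  proof (cases "l = 0")
    case True
    then show ?thesis using H0_monomial[OF qpos, of 0 0 d 0 d] q0 by (simp add: E1_def[abs_def])
  next
    case False
    then show ?thesis using H0_monomial[OF qpos that that, of 1 0 d] w[of l] that by (simp add: E1_def[abs_def])
  qed
  show "lin_indep_fams n E1"
    unfolding lin_indep_fams_def
  proof (intro allI impI)
    fix c l assume c: "\<forall>x. (\<Sum>i\<le>n. c i * E1 i x) = 0" and l: "l \<le> n"
    have "E1 i (\<lambda>k. if k = l then 1 else 0) = (if i = l then 1 else 0)" for i
      using d_pos by (auto simp: E1_def power_0_left)
    then have "(\<Sum>i\<le>n. c i * E1 i (\<lambda>k. if k = l then 1 else 0)) = c l"
      using l by (simp add: if_distrib[where f="\<lambda>t. _ * t"] cong: if_cong)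
    then show "c l = 0" using c by metis
  qed
  have bp: "\<exists>i\<le>n. E1 i x \<noteq> 0" if "wps_pt n x" for x
  proof -
    obtain i where "i \<le> n" "x i \<noteq> 0" using \<open>wps_pt n x\<close> unfolding wps_pt_def by blast
    then show ?thesis by (intro exI[of _ i]) (auto simp: E1_def)
  qed
  show "inj_morph q n n E1"
    unfolding inj_morph_def
  proof (intro conjI allI impI bp)
    fix x y assume pt: "wps_pt n x" "wps_pt n y" and "\<exists>c. \<forall>i\<le>n. E1 i x = c * E1 i y"
    then obtain c where eq: "\<And>l. l \<le> n \<Longrightarrow> E1 l x = c * E1 l y" by blast
    have c: "c \<noteq> 0" using bp[OF pt(1)] eq by fastforce
    obtain l where l: "l ^ d = c" using complex_root_exists[OF d_pos] .
    have l0: "l \<noteq> 0" using l c d_pos by (auto simp: power_0_left)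
    have x0: "x 0 ^ d = (l * y 0) ^ d" using eq[of 0] l by (simp add: E1_def power_mult_distrib)
    have xi: "x i = l ^ d * y i" if "i \<in> {1..n}" for i using eq[of i] that l by (simp add: E1_def)
    show "wps_equiv q n x y"
    proof (cases "x 0 = 0")
      case True
      then have "(l * y 0) ^ d = 0" using x0 d_pos by (simp add: power_0_left)
      then have "y 0 = 0" using l0 by simp
      have "x i = l ^ q i * y i" if "i \<le> n" for i
        using xi[of i] w[of i] True \<open>y 0 = 0\<close> that by (cases "i = 0") auto
      then show ?thesis by (rule wps_equiv_act[OF l0 wps_equiv_eq])
    next
      case False
      then have y0: "y 0 \<noteq> 0" using x0 d_pos by (auto simp: power_0_left)
      \<comment> \<open>An arbitrary \<open>d\<close>-th root of \<open>c\<close> would match the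
        first coordinates only up to a root of unity; this one matches them exactly and has the same
        \<open>d\<close>-th power.\<close>
      define s where "s = x 0 / y 0"
      have "s ^ d = l ^ d" using x0 y0 by (simp add: s_def power_divide power_mult_distrib)
      then have "x i = s ^ q i * y i" if "i \<le> n" for i
        using xi[of i] w[of i] y0 q0 that by (cases "i = 0") (auto simp: s_def)
      moreover have "s \<noteq> 0" using False y0 by (simp add: s_def)
      ultimately show ?thesis by (rule wps_equiv_act[OF _ wps_equiv_eq, rotated])
    qed
  qed
qed

section \<open>The values of the injection dimension\<close>

lemma injdim_eqI:
  assumes "\<And>j. j \<le> v \<Longrightarrow> F j \<in> H0 q n m" "lin_indep_fams v F" "inj_morph q n v F"
    and "\<And>N F. (\<And>j. j \<le> N \<Longrightarrow> F j \<in> H0 q n m) \<Longrightarrow> inj_morph q n N F \<Longrightarrow> v \<le> N"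
  shows "injdim q n m = enat v"
  unfolding injdim_def
proof (rule antisym)
  show "(INF N\<in>{N. \<exists>F. (\<forall>i\<le>N. F i \<in> H0 q n m) \<and> lin_indep_fams N F \<and> inj_morph q n N F}. enat N) \<le> enat v"
    using assms(1-3) by (intro INF_lower) blast
  show "enat v \<le> (INF N\<in>{N. \<exists>F. (\<forall>i\<le>N. F i \<in> H0 q n m) \<and> lin_indep_fams N F \<and> inj_morph q n N F}. enat N)"
    using assms(4) by (intro INF_greatest) auto
qed

text \<open>Sections of nonpositive degree are constant functions, while \<open>n >= 1\<close>
  provides two inequivalent points, the first two unit vectors.\<close>

lemma injdim_nonpos:
  assumes "k \<le> 0"
  shows "injdim q n (k * int d) = \<infinity>"
proof -
  have const: "f x = f y" if f: "f \<in> H0 q n (k * int d)" for f x y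
  proof -
    obtain c where c: "f = (\<lambda>x. \<Sum>\<alpha>\<in>exps q n (k * int d). c \<alpha> * mono n \<alpha> x)" using f unfolding H0_def by blast
    have "mono n \<alpha> x = 1" if "\<alpha> \<in> exps q n (k * int d)" for \<alpha> x
    proof -
      have "int (wdeg q n \<alpha>) \<le> 0" using that assms by (auto simp: exps_def mult_le_0_iff)
      then have "wdeg q n \<alpha> = 0" by linarith
      then have "\<forall>i\<le>n. q i * \<alpha> i = 0" by (auto simp: wdeg_def)
      then have "\<forall>i\<le>n. \<alpha> i = 0" using qpos by force
      then show ?thesis by (simp add: mono_def)
    qed
    then show ?thesis unfolding c by simp
  qed
  have "\<not> inj_morph q n N F" if F: "\<forall>i\<le>N. F i \<in> H0 q n (k * int d)" for N F
  proof
    assume inj: "inj_morph q n N F"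
    define x where "x = (\<lambda>k::nat. if k = 0 then 1 else (0::complex))"
    define y where "y = (\<lambda>k::nat. if k = 1 then 1 else (0::complex))"
    have "wps_pt n x" "wps_pt n y" using n1 by (auto simp: wps_pt_def x_def y_def)
    moreover have "\<exists>c. \<forall>i\<le>N. F i x = c * F i y" using F const by (intro exI[of _ 1]) auto
    ultimately have "wps_equiv q n x y" using inj unfolding inj_morph_def by blast
    then obtain l where "l \<noteq> 0" "\<And>i. i \<le> n \<Longrightarrow> y i = l ^ q i * x i" unfolding wps_equiv_def by blast
    from this(2)[of 0] this(1) show False by (simp add: x_def y_def)
  qed
  then have "{N. \<exists>F. (\<forall>i\<le>N. F i \<in> H0 q n (k * int d)) \<and> lin_indep_fams N F \<and> inj_morph q n N F} = {}" by blast
  then have "injdim q n (k * int d) = (INF N\<in>{}. enat N)" unfolding injdim_def by (rule arg_cong)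
  then show ?thesis by (simp add: top_enat_def)
qed

lemma injective_sectionsI:
  assumes "D > 0" "\<And>j. j \<le> N \<Longrightarrow> F j \<in> H0 q n (int D)" "inj_morph q n N F"
  shows "injective_sections q n N D F"
  using assms qpos by unfold_locales auto

lemma injdim_formula:
  "injdim q n (k * int d) =
        (if k \<le> 0 then \<infinity>
         else if k = 1 \<and> (\<forall>i\<in>{1..n}. \<forall>j\<in>{1..n}. q i = q j) then enat n
         else if k = 1 then enat (n + 1)
         else enat (2 * n))"
proof -
  define Q where "Q \<longleftrightarrow> (\<forall>i\<in>{1..n}. \<forall>j\<in>{1..n}. q i = q j)"
  consider "k \<le> 0" | "k = 1" "Q" | "k = 1" "\<not> Q" | "k \<ge> 2" by linarith
  then have "injdim q n (k * int d) =
      (if k \<le> 0 then \<infinity> else if k = 1 \<and> Q then enat n else if k = 1 then enat (n + 1) else enat (2 * n))"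
  proof cases
    case 1 then show ?thesis using injdim_nonpos by simp
  next
    case 2
    have "injdim q n (int d) = enat n"
    proof (rule injdim_eqI[where F=E1])
      show "n \<le> N" if "\<And>j. j \<le> N \<Longrightarrow> F j \<in> H0 q n (int d)" "inj_morph q n N F" for N F
        using injective_sections.sections_ge_dim[OF injective_sectionsI[OF d_pos that]] .
    qed (use E1_props[OF 2(2)[unfolded Q_def]] in auto)
    then show ?thesis using 2 by simp
  next
    case 3
    obtain i0 where i0: "1 \<le> i0" "i0 \<le> n" "q i0 \<noteq> d" using 3(2) unfolding Q_def by (metis atLeastAtMost_iff)
    have "injdim q n (int d) = enat (n + 1)"
    proof (rule injdim_eqI[where F=F1])
      show "n + 1 \<le> N" if "\<And>j. j \<le> N \<Longrightarrow> F j \<in> H0 q n (int d)" "inj_morph q n N F" for N F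
        using injective_sections.sections_gt_dim[OF injective_sectionsI[OF d_pos that] q0 q_dvd i0] .
    qed (use F1_H0 F1_indep[OF 3(2)[unfolded Q_def]] F1_inj in auto)
    then show ?thesis using 3 by auto
  next
    case 4
    define k' where "k' = nat k"
    have k': "k' \<ge> 2" "k * int d = int (k' * d)" using 4 by (auto simp: k'_def)
    have kd: "k' * d > 0" using k' d_pos by simp
    have "injdim q n (int (k' * d)) = enat (2 * n)"
    proof (rule injdim_eqI[where F="Gk k'"])
      show "2 * n \<le> N" if "\<And>j. j \<le> N \<Longrightarrow> F j \<in> H0 q n (int (k' * d))" "inj_morph q n N F" for N F
        using injective_sections.sections_ge_twice_dim[OF injective_sectionsI[OF kd that] q0 refl k'(1) q_dvd] .
    qed (use Gk_H0 Gk_indep Gk_inj k'(1) in auto)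
    then show ?thesis unfolding k'(2) using 4 by simp
  qed
  then show ?thesis unfolding Q_def .
qed

end

theorem theorem4p5:
  fixes q :: "nat \<Rightarrow> nat" and n :: nat and d :: nat
    and a :: "nat \<Rightarrow> nat" and b :: "nat \<Rightarrow> nat \<Rightarrow> nat"
  assumes n1: "n \<ge> 1"
    and qpos: "\<forall>i\<le>n. q i > 0"
    and q0: "q 0 = 1"
    and d_def: "d = Lcm (q ` {1..n})"
    and lcm3: "\<forall>i\<le>n. \<forall>j\<le>n. \<forall>k\<le>n. i \<noteq> j \<and> i \<noteq> k \<and> j \<noteq> k \<longrightarrow>
                 lcm (q i) (lcm (q j) (q k)) = d"
    and a_def: "\<forall>i. a i = d div q i"
    and b_def: "\<forall>i j. b i j = lcm (q i) (q j) div q i"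
  shows
    "(let F = (\<lambda>l x. if l = 0 then x 0 ^ d
                     else if l = 1 then x 0 ^ (d - q 1) * x 1
                     else if l \<le> n then x (l - 1) ^ a (l - 1) + x 0 ^ (d - q l) * x l
                     else x n ^ a n)
      in (\<forall>l\<le>n + 1. F l \<in> H0 q n (int d)) \<and> inj_morph q n (n + 1) F)
   \<and> (\<forall>k::nat. k \<ge> 2 \<longrightarrow>
       (let G = (\<lambda>l x. \<Sum>(i, j) \<in> {(i, j). i \<le> n \<and> j \<le> n \<and> i \<le> j \<and> i + j = l}.
                          x i ^ (k * a i - b i j) * x j ^ b j i)
        in (\<forall>l\<le>2 * n. G l \<in> H0 q n (int (k * d))) \<and> inj_morph q n (2 * n) G))
   \<and> (\<forall>k::int. injdim q n (k * int d) =
        (if k \<le> 0 then \<infinity>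
         else if k = 1 \<and> (\<forall>i\<in>{1..n}. \<forall>j\<in>{1..n}. q i = q j) then enat n
         else if k = 1 then enat (n + 1)
         else enat (2 * n)))"
proof -
  interpret wps q n d a b by (rule wps.intro[OF assms])
  show ?thesis
    unfolding Let_def F1_def[symmetric] Gk_def[symmetric]
    using F1_H0 F1_inj Gk_H0 Gk_inj injdim_formula by blast
qed

end
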